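(* Let $\Bbbk=\mathbb F_2[t_1,t_2,t_3]/(t_1^2,t_2^2,t_3^2)$, let $M=\Bbbk^3/\langle t_1e_1+t_2e_2+t_3e_3\rangle$, where $e_1,e_2,e_3$ is the standard basis of $\Bbbk^3$, and let $\mathfrak g=\mathcal F'(M)$ be the image of the canonical Lie algebra homomorphism $\mathcal F(M)\to T(M)$ (equivalently, the Lie subalgebra of the tensor algebra $T(M)$ generated by $M$). Then $$H^{\mathsf{CE}}_2(\mathfrak g)\neq 0\qquad\text{and}\qquad H^{\mathsf{RT}}_2(\mathfrak g)=0.$$
   Context: Lie algebras over $\Bbbk$ have alternating bracket. $\mathcal F(M)$ is the free Lie algebra on the $\Bbbk$-module $M$ (left adjoint to the forgetful functor from Lie algebras over $\Bbbk$ to $\Bbbk$-modules); $T(M)$ is the tensor algebra over $\Bbbk$ with commutator bracket, and $\mathcal F(M)\to T(M)$ is the Lie homomorphism extending $M\hookrightarrow T(M)$. $H^{\mathsf{CE}}_n(\mathfrak g)=H_n(\mathsf{CE}_\bullet(\mathfrak g))$, where $\mathsf{CE}_n(\mathfrak g)=\Lambda^n_\Bbbk\mathfrak g$ and $\partial(x_1\wedge\dots\wedge x_n)=\sum_{i<j}(-1)^{i+j}[x_i,x_j]\wedge x_1\wedge\dots\wedge\hat x_i\wedge\dots\wedge\hat x_j\wedge\dots\wedge x_n$. $H^{\mathsf{RT}}_n(\mathfrak g)=\mathrm{Tor}^{(U\mathfrak g,\Bbbk)}_n(\Bbbk,\Bbbk)$, where $U\mathfrak g$ is the universal enveloping algebra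 acting on $\Bbbk$ via the augmentation. For a ring $R$ with subring $S$, $\mathrm{Tor}^{(R,S)}_n(M,N)=H_n(P_\bullet\otimes_R N)$, where $P_\bullet\to M$ is a resolution by $(R,S)$-projective right $R$-modules (direct summands of modules $A\otimes_S R$ with $A$ a right $S$-module) whose augmented complex is contractible as a complex of $S$-modules. *)

theory Defs
  imports
    "HOL-Algebra.QuotRing"
    "HOL-Algebra.Module"
    "HOL-Library.Poly_Mapping"
    "HOL-Library.Numeral_Type"
    "HOL-Library.Z2"
begin

section \<open>Conventions\<close>

text \<open>
  Modules, associative algebras and Lie algebras over a commutative ring \<open>R\<close> are all records of
  type \<^typ>\<open>('c, 'b) module\<close>. In an associative algebra the field \<^const>\<open>mult\<close> is the product; in
  a Lie algebra it is the bracket and \<^const>\<open>one\<close> is not used; in a module neither is used.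
\<close>

definition regular_algebra :: "('c, 'r) ring_scheme \<Rightarrow> ('c, 'c) module" where
  "regular_algebra R = \<lparr>carrier = carrier R, mult = mult R, one = one R,
     zero = zero R, add = add R, smult = mult R\<rparr>"

definition coord_module :: "('c, 'r) ring_scheme \<Rightarrow> ('c, 'i \<Rightarrow> 'c) module" where
  "coord_module R = \<lparr>carrier = {v. \<forall>i. v i \<in> carrier R}, mult = (\<lambda>_ _. undefined),
     one = undefined, zero = (\<lambda>_. \<zero>\<^bsub>R\<^esub>), add = (\<lambda>v w i. v i \<oplus>\<^bsub>R\<^esub> w i),
     smult = (\<lambda>c v i. c \<otimes>\<^bsub>R\<^esub> v i)\<rparr>"

definition unit_vector :: "('c, 'r) ring_scheme \<Rightarrow> 'i \<Rightarrow> 'i \<Rightarrow> 'c" where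
  "unit_vector R i = (\<lambda>j. if j = i then \<one>\<^bsub>R\<^esub> else \<zero>\<^bsub>R\<^esub>)"

definition cyclic_submodule ::
    "('c, 'r) ring_scheme \<Rightarrow> ('c, 'b, 'm) module_scheme \<Rightarrow> 'b \<Rightarrow> 'b set" where
  "cyclic_submodule R M v = {c \<odot>\<^bsub>M\<^esub> v | c. c \<in> carrier R}"

definition quotient_module ::
    "('c, 'b, 'm) module_scheme \<Rightarrow> 'b set \<Rightarrow> ('c, 'b set) module" where
  "quotient_module M N = \<lparr>carrier = a_rcosets\<^bsub>M\<^esub> N, mult = (\<lambda>_ _. undefined), one = undefined,
     zero = N, add = set_add M, smult = (\<lambda>c X. \<Union>x\<in>X. N +>\<^bsub>M\<^esub> (c \<odot>\<^bsub>M\<^esub> x))\<rparr>"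


section \<open>Objects given by generators and relations\<close>

text \<open>
  Free objects, tensor algebras, enveloping algebras, exterior powers and tensor products are all
  built as formal expressions modulo the congruence generated by the axioms of the structure in
  question and a set \<open>E\<close> of additional relations. The kind determines which structure is meant:
  modules, (nonassociative) algebras, or unital (nonassociative) algebras.
\<close>

datatype ('c, 'x) expr =
    Gen 'x
  | Zero
  | Add "('c, 'x) expr" "('c, 'x) expr"
  | Neg "('c, 'x) expr"
  | Scale 'c "('c, 'x) expr"
  | Mul "('c, 'x) expr" "('c, 'x) expr"
  | One

datatype kind = Linear | Multiplicative | Unital

inductive_set exprs :: "kind \<Rightarrow> 'c set \<Rightarrow> 'x set \<Rightarrow> ('c, 'x) expr set"
  for K C X where
  "x \<in> X \<Longrightarrow> Gen x \<in> exprs K C X"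
| "Zero \<in> exprs K C X"
| "s \<in> exprs K C X \<Longrightarrow> t \<in> exprs K C X \<Longrightarrow> Add s t \<in> exprs K C X"
| "s \<in> exprs K C X \<Longrightarrow> Neg s \<in> exprs K C X"
| "c \<in> C \<Longrightarrow> s \<in> exprs K C X \<Longrightarrow> Scale c s \<in> exprs K C X"
| "K \<noteq> Linear \<Longrightarrow> s \<in> exprs K C X \<Longrightarrow> t \<in> exprs K C X \<Longrightarrow> Mul s t \<in> exprs K C X"
| "K = Unital \<Longrightarrow> One \<in> exprs K C X"

inductive algebra_axiom :: "('c, 'r) ring_scheme \<Rightarrow> ('c, 'x) expr \<Rightarrow> ('c, 'x) expr \<Rightarrow> bool"
  for R where
  "algebra_axiom R (Add (Add s t) u) (Add s (Add t u))"
| "algebra_axiom R (Add s t) (Add t s)"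
| "algebra_axiom R (Add Zero s) s"
| "algebra_axiom R (Add (Neg s) s) Zero"
| "algebra_axiom R (Scale (c \<oplus>\<^bsub>R\<^esub> d) s) (Add (Scale c s) (Scale d s))"
| "algebra_axiom R (Scale c (Add s t)) (Add (Scale c s) (Scale c t))"
| "algebra_axiom R (Scale (c \<otimes>\<^bsub>R\<^esub> d) s) (Scale c (Scale d s))"
| "algebra_axiom R (Scale \<one>\<^bsub>R\<^esub> s) s"
| "algebra_axiom R (Mul (Add s t) u) (Add (Mul s u) (Mul t u))"
| "algebra_axiom R (Mul s (Add t u)) (Add (Mul s t) (Mul s u))"
| "algebra_axiom R (Mul (Scale c s) t) (Scale c (Mul s t))"
| "algebra_axiom R (Mul s (Scale c t)) (Scale c (Mul s t))"
| "algebra_axiom R (Mul One s) s"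
| "algebra_axiom R (Mul s One) s"

text \<open>Only axioms and relations both of whose sides lie in \<open>T\<close> are imposed.\<close>

inductive_set expr_cong ::
    "('c, 'r) ring_scheme \<Rightarrow> ('c, 'x) expr set \<Rightarrow> ('c, 'x) expr rel \<Rightarrow> ('c, 'x) expr rel"
  for R T E where
  "s \<in> T \<Longrightarrow> (s, s) \<in> expr_cong R T E"
| "(s, t) \<in> expr_cong R T E \<Longrightarrow> (t, s) \<in> expr_cong R T E"
| "(s, t) \<in> expr_cong R T E \<Longrightarrow> (t, u) \<in> expr_cong R T E \<Longrightarrow> (s, u) \<in> expr_cong R T E"
| "algebra_axiom R s t \<Longrightarrow> s \<in> T \<Longrightarrow> t \<in> T \<Longrightarrow> (s, t) \<in> expr_cong R T E"
| "(s, t) \<in> E \<Longrightarrow> s \<in> T \<Longrightarrow> t \<in> T \<Longrightarrow> (s, t) \<in> expr_cong R T E"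
| "(s, s') \<in> expr_cong R T E \<Longrightarrow> (t, t') \<in> expr_cong R T E \<Longrightarrow> Add s t \<in> T \<Longrightarrow> Add s' t' \<in> T \<Longrightarrow>
    (Add s t, Add s' t') \<in> expr_cong R T E"
| "(s, s') \<in> expr_cong R T E \<Longrightarrow> Neg s \<in> T \<Longrightarrow> Neg s' \<in> T \<Longrightarrow> (Neg s, Neg s') \<in> expr_cong R T E"
| "(s, s') \<in> expr_cong R T E \<Longrightarrow> Scale c s \<in> T \<Longrightarrow> Scale c s' \<in> T \<Longrightarrow>
    (Scale c s, Scale c s') \<in> expr_cong R T E"
| "(s, s') \<in> expr_cong R T E \<Longrightarrow> (t, t') \<in> expr_cong R T E \<Longrightarrow> Mul s t \<in> T \<Longrightarrow> Mul s' t' \<in> T \<Longrightarrow>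
    (Mul s t, Mul s' t') \<in> expr_cong R T E"

definition presented ::
    "('c, 'r) ring_scheme \<Rightarrow> ('c, 'x) expr set \<Rightarrow> ('c, 'x) expr rel \<Rightarrow> ('c, ('c, 'x) expr set) module"
  where
  "presented R T E = \<lparr>
     carrier = T // expr_cong R T E,
     mult = (\<lambda>X Y. expr_cong R T E `` {Mul s t | s t. s \<in> X \<and> t \<in> Y}),
     one = expr_cong R T E `` {One},
     zero = expr_cong R T E `` {Zero},
     add = (\<lambda>X Y. expr_cong R T E `` {Add s t | s t. s \<in> X \<and> t \<in> Y}),
     smult = (\<lambda>c X. expr_cong R T E `` {Scale c s | s. s \<in> X})\<rparr>"

text \<open>
  The homomorphism from a presented object to \<open>A\<close> that extends \<open>\<gamma>\<close> on the generators: expressions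
  are evaluated in \<open>A\<close>, and all expressions in one class have the same value whenever the axioms
  and relations hold in \<open>A\<close> under \<open>\<gamma>\<close>.
\<close>

primrec expr_eval :: "('c, 'b, 'm) module_scheme \<Rightarrow> ('x \<Rightarrow> 'b) \<Rightarrow> ('c, 'x) expr \<Rightarrow> 'b" where
  "expr_eval A \<gamma> (Gen x) = \<gamma> x"
| "expr_eval A \<gamma> Zero = \<zero>\<^bsub>A\<^esub>"
| "expr_eval A \<gamma> (Add s t) = expr_eval A \<gamma> s \<oplus>\<^bsub>A\<^esub> expr_eval A \<gamma> t"
| "expr_eval A \<gamma> (Neg s) = \<ominus>\<^bsub>A\<^esub> expr_eval A \<gamma> s"
| "expr_eval A \<gamma> (Scale c s) = c \<odot>\<^bsub>A\<^esub> expr_eval A \<gamma> s"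
| "expr_eval A \<gamma> (Mul s t) = expr_eval A \<gamma> s \<otimes>\<^bsub>A\<^esub> expr_eval A \<gamma> t"
| "expr_eval A \<gamma> One = \<one>\<^bsub>A\<^esub>"

definition extend_hom ::
    "('c, 'b, 'm) module_scheme \<Rightarrow> ('x \<Rightarrow> 'b) \<Rightarrow> ('c, 'x) expr set \<Rightarrow> 'b" where
  "extend_hom A \<gamma> X = the_elem (expr_eval A \<gamma> ` X)"

definition linear_rel ::
    "('c, 'r) ring_scheme \<Rightarrow> ('c, 'b, 'm) module_scheme \<Rightarrow> ('c, 'b) expr rel" where
  "linear_rel R M =
     {(Gen (x \<oplus>\<^bsub>M\<^esub> y), Add (Gen x) (Gen y)) | x y. x \<in> carrier M \<and> y \<in> carrier M} \<union>
     {(Gen (c \<odot>\<^bsub>M\<^esub> x), Scale c (Gen x)) | c x. c \<in> carrier R \<and> x \<in> carrier M}"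

definition assoc_rel :: "('c, 'x) expr rel" where
  "assoc_rel = {(Mul (Mul s t) u, Mul s (Mul t u)) | s t u. True}"

definition lie_rel :: "('c, 'x) expr rel" where
  "lie_rel = {(Mul s s, Zero) | s. True} \<union>
     {(Add (Mul s (Mul t u)) (Add (Mul t (Mul u s)) (Mul u (Mul s t))), Zero) | s t u. True}"


section \<open>Tensor algebra, free Lie algebra, universal enveloping algebra\<close>

definition tensor_algebra ::
    "('c, 'r) ring_scheme \<Rightarrow> ('c, 'b, 'm) module_scheme \<Rightarrow> ('c, ('c, 'b) expr set) module" where
  "tensor_algebra R M =
     presented R (exprs Unital (carrier R) (carrier M)) (linear_rel R M \<union> assoc_rel)"

definition tensor_gen ::
    "('c, 'r) ring_scheme \<Rightarrow> ('c, 'b, 'm) module_scheme \<Rightarrow> 'b \<Rightarrow> ('c, 'b) expr set" where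
  "tensor_gen R M x =
     expr_cong R (exprs Unital (carrier R) (carrier M)) (linear_rel R M \<union> assoc_rel) `` {Gen x}"

definition free_lie_algebra ::
    "('c, 'r) ring_scheme \<Rightarrow> ('c, 'b, 'm) module_scheme \<Rightarrow> ('c, ('c, 'b) expr set) module" where
  "free_lie_algebra R M =
     presented R (exprs Multiplicative (carrier R) (carrier M)) (linear_rel R M \<union> lie_rel)"

definition commutator_algebra :: "('c, 'b) module \<Rightarrow> ('c, 'b) module" where
  "commutator_algebra A = A\<lparr>mult := (\<lambda>x y. (x \<otimes>\<^bsub>A\<^esub> y) \<ominus>\<^bsub>A\<^esub> (y \<otimes>\<^bsub>A\<^esub> x))\<rparr>"

definition free_lie_to_tensor ::
    "('c, 'r) ring_scheme \<Rightarrow> ('c, 'b, 'm) module_scheme \<Rightarrow> ('c, 'b) expr set \<Rightarrow> ('c, 'b) expr set"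
  where
  "free_lie_to_tensor R M =
     extend_hom (commutator_algebra (tensor_algebra R M)) (tensor_gen R M)"

definition free_lie_image ::
    "('c, 'r) ring_scheme \<Rightarrow> ('c, 'b, 'm) module_scheme \<Rightarrow> ('c, ('c, 'b) expr set) module" where
  "free_lie_image R M = (commutator_algebra (tensor_algebra R M))
     \<lparr>carrier := free_lie_to_tensor R M ` carrier (free_lie_algebra R M)\<rparr>"

definition enveloping_algebra ::
    "('c, 'r) ring_scheme \<Rightarrow> ('c, 'b, 'm) module_scheme \<Rightarrow> ('c, ('c, 'b) expr set) module" where
  "enveloping_algebra R g = presented R (exprs Unital (carrier R) (carrier g))
     (linear_rel R g \<union> assoc_rel \<union>
      {(Add (Mul (Gen x) (Gen y)) (Neg (Mul (Gen y) (Gen x))), Gen (x \<otimes>\<^bsub>g\<^esub> y)) | x y.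
         x \<in> carrier g \<and> y \<in> carrier g})"

definition augmentation ::
    "('c, 'r) ring_scheme \<Rightarrow> ('c, 'b) expr set \<Rightarrow> 'c" where
  "augmentation R = extend_hom (regular_algebra R) (\<lambda>_. \<zero>\<^bsub>R\<^esub>)"

definition base_subring ::
    "('c, 'r) ring_scheme \<Rightarrow> ('c, 'b, 'm) module_scheme \<Rightarrow> 'b set" where
  "base_subring R A = {c \<odot>\<^bsub>A\<^esub> \<one>\<^bsub>A\<^esub> | c. c \<in> carrier R}"

text \<open>
  As \<open>R\<close> is commutative, this record describes the left and the right action of the enveloping
  algebra on \<open>R\<close> through the augmentation at the same time.
\<close>

definition trivial_rep :: "('c, 'r) ring_scheme \<Rightarrow> (('c, 'b) expr set, 'c) module" where
  "trivial_rep R = \<lparr>carrier = carrier R, mult = mult R, one = one R, zero = zero R, add = add R,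
     smult = (\<lambda>u c. augmentation R u \<otimes>\<^bsub>R\<^esub> c)\<rparr>"


section \<open>Homology and the Chevalley--Eilenberg complex\<close>

text \<open>In a complex, \<open>d n\<close> is the differential from \<open>C (Suc n)\<close> to \<open>C n\<close>.\<close>

primrec cycles :: "(nat \<Rightarrow> ('s, 'b) module) \<Rightarrow> (nat \<Rightarrow> 'b \<Rightarrow> 'b) \<Rightarrow> nat \<Rightarrow> 'b set" where
  "cycles C d 0 = carrier (C 0)"
| "cycles C d (Suc n) = a_kernel (C (Suc n)) (C n) (d n)"

definition homology :: "(nat \<Rightarrow> ('s, 'b) module) \<Rightarrow> (nat \<Rightarrow> 'b \<Rightarrow> 'b) \<Rightarrow> nat \<Rightarrow> 'b set monoid" where
  "homology C d n = (C n)\<lparr>carrier := cycles C d n\<rparr> A_Mod (d n ` carrier (C (Suc n)))"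

text \<open>The \<open>n\<close>-th exterior power is generated by the \<open>n\<close>-tuples of elements of the module.\<close>

definition exterior_exprs ::
    "('c, 'r) ring_scheme \<Rightarrow> ('c, 'b, 'm) module_scheme \<Rightarrow> nat \<Rightarrow> ('c, 'b list) expr set" where
  "exterior_exprs R M n = exprs Linear (carrier R) {xs. set xs \<subseteq> carrier M \<and> length xs = n}"

definition exterior_rel ::
    "('c, 'r) ring_scheme \<Rightarrow> ('c, 'b, 'm) module_scheme \<Rightarrow> ('c, 'b list) expr rel" where
  "exterior_rel R M =
     {(Gen (us @ [x \<oplus>\<^bsub>M\<^esub> y] @ vs), Add (Gen (us @ [x] @ vs)) (Gen (us @ [y] @ vs))) | us x y vs.
        x \<in> carrier M \<and> y \<in> carrier M} \<union>
     {(Gen (us @ [c \<odot>\<^bsub>M\<^esub> x] @ vs), Scale c (Gen (us @ [x] @ vs))) | us c x vs.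
        c \<in> carrier R \<and> x \<in> carrier M} \<union>
     {(Gen (us @ [x] @ vs @ [x] @ ws), Zero) | us x vs ws. x \<in> carrier M}"

definition exterior_power ::
    "('c, 'r) ring_scheme \<Rightarrow> ('c, 'b, 'm) module_scheme \<Rightarrow> nat \<Rightarrow> ('c, ('c, 'b list) expr set) module"
  where
  "exterior_power R M n = presented R (exterior_exprs R M n) (exterior_rel R M)"

definition wedge ::
    "('c, 'r) ring_scheme \<Rightarrow> ('c, 'b, 'm) module_scheme \<Rightarrow> 'b list \<Rightarrow> ('c, 'b list) expr set" where
  "wedge R M xs = expr_cong R (exterior_exprs R M (length xs)) (exterior_rel R M) `` {Gen xs}"

text \<open>
  List positions start at 0 rather than 1; this does not change the sign \<open>(-1)\<^sup>i\<^sup>+\<^sup>j\<close>. The list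
  \<^term>\<open>nths xs (- {i, j})\<close> is \<open>xs\<close> with the entries at positions \<open>i\<close> and \<open>j\<close> removed.
\<close>

definition CE_differential ::
    "('c, 'r) ring_scheme \<Rightarrow> ('c, 'b, 'm) module_scheme \<Rightarrow> nat \<Rightarrow>
     ('c, 'b list) expr set \<Rightarrow> ('c, 'b list) expr set" where
  "CE_differential R g n = extend_hom (exterior_power R g n) (\<lambda>xs.
     finsum (exterior_power R g n)
       (\<lambda>(i, j). ((\<ominus>\<^bsub>R\<^esub> \<one>\<^bsub>R\<^esub>) [^]\<^bsub>R\<^esub> (i + j)) \<odot>\<^bsub>exterior_power R g n\<^esub>
          wedge R g ((xs ! i \<otimes>\<^bsub>g\<^esub> xs ! j) # nths xs (- {i, j})))
       {(i, j). i < j \<and> j < length xs})"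

definition CE_homology ::
    "('c, 'r) ring_scheme \<Rightarrow> ('c, 'b, 'm) module_scheme \<Rightarrow> nat \<Rightarrow> ('c, 'b list) expr set set monoid"
  where
  "CE_homology R g n = homology (exterior_power R g) (CE_differential R g) n"


section \<open>Relative Tor\<close>

text \<open>In a right module, \<^term>\<open>r \<odot>\<^bsub>P\<^esub> x\<close> stands for the right action of \<open>r\<close> on \<open>x\<close>.\<close>

locale right_module = R?: ring R + P?: abelian_group P
  for R (structure) and P :: "('r, 'p, 'm) module_scheme" (structure) +
  assumes ract_closed: "r \<in> carrier R \<Longrightarrow> x \<in> carrier P \<Longrightarrow> r \<odot>\<^bsub>P\<^esub> x \<in> carrier P"
    and ract_add_scalar: "r \<in> carrier R \<Longrightarrow> s \<in> carrier R \<Longrightarrow> x \<in> carrier P \<Longrightarrow>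
      (r \<oplus> s) \<odot>\<^bsub>P\<^esub> x = r \<odot>\<^bsub>P\<^esub> x \<oplus>\<^bsub>P\<^esub> s \<odot>\<^bsub>P\<^esub> x"
    and ract_add: "r \<in> carrier R \<Longrightarrow> x \<in> carrier P \<Longrightarrow> y \<in> carrier P \<Longrightarrow>
      r \<odot>\<^bsub>P\<^esub> (x \<oplus>\<^bsub>P\<^esub> y) = r \<odot>\<^bsub>P\<^esub> x \<oplus>\<^bsub>P\<^esub> r \<odot>\<^bsub>P\<^esub> y"
    and ract_mult: "r \<in> carrier R \<Longrightarrow> s \<in> carrier R \<Longrightarrow> x \<in> carrier P \<Longrightarrow>
      (r \<otimes> s) \<odot>\<^bsub>P\<^esub> x = s \<odot>\<^bsub>P\<^esub> (r \<odot>\<^bsub>P\<^esub> x)"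
    and ract_one: "x \<in> carrier P \<Longrightarrow> \<one> \<odot>\<^bsub>P\<^esub> x = x"

definition right_module_hom ::
    "('r, 'k) ring_scheme \<Rightarrow> ('r, 'p, 'm) module_scheme \<Rightarrow> ('r, 'q, 'n) module_scheme \<Rightarrow> ('p \<Rightarrow> 'q) set"
  where
  "right_module_hom R P Q = {h \<in> hom (add_monoid P) (add_monoid Q).
     \<forall>r\<in>carrier R. \<forall>x\<in>carrier P. h (r \<odot>\<^bsub>P\<^esub> x) = r \<odot>\<^bsub>Q\<^esub> h x}"

text \<open>
  The tensor product of a right \<open>S\<close>-module \<open>A\<close> and a left \<open>S\<close>-module \<open>B\<close> is an abelian group:
  expressions without scalars, so that its field \<^const>\<open>smult\<close> is meaningless.
\<close>

definition tensor_exprs :: "('s, 'a, 'm) module_scheme \<Rightarrow> ('s, 'b, 'n) module_scheme \<Rightarrow>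
    ('s, 'a \<times> 'b) expr set" where
  "tensor_exprs A B = exprs Linear {} (carrier A \<times> carrier B)"

definition tensor_rel ::
    "('s, 'r) ring_scheme \<Rightarrow> ('s, 'a, 'm) module_scheme \<Rightarrow> ('s, 'b, 'n) module_scheme \<Rightarrow>
     ('s, 'a \<times> 'b) expr rel" where
  "tensor_rel S A B =
     {(Gen (a \<oplus>\<^bsub>A\<^esub> a', b), Add (Gen (a, b)) (Gen (a', b))) | a a' b.
        a \<in> carrier A \<and> a' \<in> carrier A \<and> b \<in> carrier B} \<union>
     {(Gen (a, b \<oplus>\<^bsub>B\<^esub> b'), Add (Gen (a, b)) (Gen (a, b'))) | a b b'.
        a \<in> carrier A \<and> b \<in> carrier B \<and> b' \<in> carrier B} \<union>
     {(Gen (s \<odot>\<^bsub>A\<^esub> a, b), Gen (a, s \<odot>\<^bsub>B\<^esub> b)) | s a b.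
        s \<in> carrier S \<and> a \<in> carrier A \<and> b \<in> carrier B}"

definition tensor_product ::
    "('s, 'r) ring_scheme \<Rightarrow> ('s, 'a, 'm) module_scheme \<Rightarrow> ('s, 'b, 'n) module_scheme \<Rightarrow>
     ('s, ('s, 'a \<times> 'b) expr set) module" where
  "tensor_product S A B = presented S (tensor_exprs A B) (tensor_rel S A B)"

definition pure_tensor ::
    "('s, 'r) ring_scheme \<Rightarrow> ('s, 'a, 'm) module_scheme \<Rightarrow> ('s, 'b, 'n) module_scheme \<Rightarrow>
     'a \<Rightarrow> 'b \<Rightarrow> ('s, 'a \<times> 'b) expr set" where
  "pure_tensor S A B a b = expr_cong S (tensor_exprs A B) (tensor_rel S A B) `` {Gen (a, b)}"

text \<open>\<open>A \<otimes>\<^sub>S R\<close> as a right \<open>R\<close>-module, for a subring \<open>S\<close> of \<open>R\<close> and a right \<open>S\<close>-module \<open>A\<close>.\<close>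

definition induced_module ::
    "('r, 'k) ring_scheme \<Rightarrow> 'r set \<Rightarrow> ('r, 'a, 'm) module_scheme \<Rightarrow> ('r, ('r, 'a \<times> 'r) expr set) module"
  where
  "induced_module R S A =
     (let T = tensor_product (R\<lparr>carrier := S\<rparr>) A (regular_algebra R)
      in T\<lparr>smult := (\<lambda>r. extend_hom T (\<lambda>(a, x).
           pure_tensor (R\<lparr>carrier := S\<rparr>) A (regular_algebra R) a (x \<otimes>\<^bsub>R\<^esub> r)))\<rparr>)"

text \<open>
  \<open>(R, S)\<close>-projective: isomorphic, via \<open>h\<close>, to a direct summand of some induced module, with
  complement \<open>Q\<close>. The first argument names the type over which the module \<open>A\<close> ranges.
\<close>

definition rel_projective ::
    "'a itself \<Rightarrow> ('r, 'k) ring_scheme \<Rightarrow> 'r set \<Rightarrow> ('r, 'p) module \<Rightarrow> bool" where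
  "rel_projective (_ :: 'a itself) R S P \<longleftrightarrow> right_module R P \<and>
     (\<exists>(A :: ('r, 'a) module) h Q.
        right_module (R\<lparr>carrier := S\<rparr>) A \<and>
        h \<in> right_module_hom R P (induced_module R S A) \<and> inj_on h (carrier P) \<and>
        Q \<subseteq> carrier (induced_module R S A) \<and>
        right_module R ((induced_module R S A)\<lparr>carrier := Q\<rparr>) \<and>
        h ` carrier P \<inter> Q = {\<zero>\<^bsub>induced_module R S A\<^esub>} \<and>
        h ` carrier P <+>\<^bsub>induced_module R S A\<^esub> Q = carrier (induced_module R S A))"

text \<open>
  A resolution of \<open>M\<close> by \<open>(R, S)\<close>-projective right \<open>R\<close>-modules with augmentation \<open>e\<close>; the maps
  \<open>\<sigma>\<close> and \<open>s n\<close> form an \<open>S\<close>-linear contraction of the augmented complex.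
\<close>

definition rel_projective_resolution ::
    "'a itself \<Rightarrow> ('r, 'k) ring_scheme \<Rightarrow> 'r set \<Rightarrow> ('r, 'b, 'm) module_scheme \<Rightarrow>
     (nat \<Rightarrow> ('r, 'p) module) \<Rightarrow> (nat \<Rightarrow> 'p \<Rightarrow> 'p) \<Rightarrow> ('p \<Rightarrow> 'b) \<Rightarrow> bool" where
  "rel_projective_resolution ty R S M P d e \<longleftrightarrow>
     (\<forall>n. rel_projective ty R S (P n)) \<and>
     (\<forall>n. d n \<in> right_module_hom R (P (Suc n)) (P n)) \<and>
     e \<in> right_module_hom R (P 0) M \<and>
     (\<forall>n. \<forall>x\<in>carrier (P (Suc (Suc n))). d n (d (Suc n) x) = \<zero>\<^bsub>P n\<^esub>) \<and>
     (\<forall>x\<in>carrier (P 1). e (d 0 x) = \<zero>\<^bsub>M\<^esub>) \<and>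
     (\<exists>\<sigma> s.
        \<sigma> \<in> right_module_hom (R\<lparr>carrier := S\<rparr>) M (P 0) \<and>
        (\<forall>n. s n \<in> right_module_hom (R\<lparr>carrier := S\<rparr>) (P n) (P (Suc n))) \<and>
        (\<forall>y\<in>carrier M. e (\<sigma> y) = y) \<and>
        (\<forall>x\<in>carrier (P 0). d 0 (s 0 x) \<oplus>\<^bsub>P 0\<^esub> \<sigma> (e x) = x) \<and>
        (\<forall>n. \<forall>x\<in>carrier (P (Suc n)).
           d (Suc n) (s (Suc n) x) \<oplus>\<^bsub>P (Suc n)\<^esub> s n (d n x) = x))"

text \<open>Homology of \<open>P \<otimes>\<^sub>R N\<close>; for a relative projective resolution \<open>P\<close> of \<open>M\<close> this is relative Tor.\<close>

definition tensor_complex_homology ::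
    "('r, 'k) ring_scheme \<Rightarrow> (nat \<Rightarrow> ('r, 'p) module) \<Rightarrow> (nat \<Rightarrow> 'p \<Rightarrow> 'p) \<Rightarrow>
     ('r, 'b, 'm) module_scheme \<Rightarrow> nat \<Rightarrow> ('r, 'p \<times> 'b) expr set set monoid" where
  "tensor_complex_homology R P d N n = homology (\<lambda>m. tensor_product R (P m) N)
     (\<lambda>m. extend_hom (tensor_product R (P m) N) (\<lambda>(p, y). pure_tensor R (P m) N (d m p) y)) n"

text \<open>
  The homology of \<open>g\<close> defined by relative Tor is \<open>RT_homology R g P d\<close> for any \<open>RT_resolution\<close> \<open>P\<close>; up
  to isomorphism it does not depend on the choice.
\<close>

definition RT_resolution ::
    "'a itself \<Rightarrow> ('c, 'r) ring_scheme \<Rightarrow> ('c, 'b, 'm) module_scheme \<Rightarrow>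
     (nat \<Rightarrow> (('c, 'b) expr set, 'p) module) \<Rightarrow> (nat \<Rightarrow> 'p \<Rightarrow> 'p) \<Rightarrow> ('p \<Rightarrow> 'c) \<Rightarrow> bool" where
  "RT_resolution ty R g P d e \<longleftrightarrow>
     rel_projective_resolution ty (enveloping_algebra R g)
       (base_subring R (enveloping_algebra R g)) (trivial_rep R) P d e"

definition RT_homology ::
    "('c, 'r) ring_scheme \<Rightarrow> ('c, 'b, 'm) module_scheme \<Rightarrow>
     (nat \<Rightarrow> (('c, 'b) expr set, 'p) module) \<Rightarrow> (nat \<Rightarrow> 'p \<Rightarrow> 'p) \<Rightarrow> nat \<Rightarrow>
     (('c, 'b) expr set, 'p \<times> 'c) expr set set monoid" where
  "RT_homology R g P d n =
     tensor_complex_homology (enveloping_algebra R g) P d (trivial_rep R) n"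


section \<open>The base ring and the module\<close>

text \<open>
  Polynomials in three variables (indexed by the three-element type \<open>3\<close>) over the two-element field
  \<^typ>\<open>bit\<close>, as finitely supported maps from exponent vectors to coefficients.
\<close>

type_synonym poly3 = "(3 \<Rightarrow>\<^sub>0 nat) \<Rightarrow>\<^sub>0 bit"

definition poly3_ring :: "poly3 ring" where
  "poly3_ring = \<lparr>carrier = UNIV, mult = (*), one = 1, zero = 0, add = (+)\<rparr>"

definition var :: "3 \<Rightarrow> poly3" where
  "var i = Poly_Mapping.single (Poly_Mapping.single i 1) 1"

definition squares_ideal :: "poly3 set" where
  "squares_ideal = genideal poly3_ring {var i ^ 2 | i. True}"

definition kk :: "poly3 set ring" where
  "kk = poly3_ring Quot squares_ideal"

definition tt :: "3 \<Rightarrow> poly3 set" where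
  "tt i = squares_ideal +>\<^bsub>poly3_ring\<^esub> var i"

definition kk3 :: "(poly3 set, 3 \<Rightarrow> poly3 set) module" where
  "kk3 = coord_module kk"

definition MM :: "(poly3 set, (3 \<Rightarrow> poly3 set) set) module" where
  "MM = quotient_module kk3
     (cyclic_submodule kk kk3 (\<Oplus>\<^bsub>kk3\<^esub>i\<in>UNIV. tt i \<odot>\<^bsub>kk3\<^esub> unit_vector kk i))"

type_synonym gg_elem = "(poly3 set, (3 \<Rightarrow> poly3 set) set) expr set"

definition gg :: "(poly3 set, gg_elem) module" where
  "gg = free_lie_image kk MM"

type_synonym Ugg_elem = "(poly3 set, gg_elem) expr set"

end

theory Submission
  imports Defs "HOL-Algebra.Subrings"
begin

text \<open>The image in \<open>T(M)\<close> matters: weight two of the free Lie algebra is the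
  exterior square of \<open>MM\<close>, where the determinant shows that the bracket sum belonging
  to \<omega> is not zero. It dies only in an associative algebra, where the relation r has a square
  with diagonal terms; in a Lie algebra [r, r] = 0 holds anyway and says nothing about r. The
  isomorphism of \<open>U\<close> with the tensor algebra is never constructed. The derivative is
  defined on \<open>T(M)\<close>, restricted to the Lie algebra and extended from there to
  \<open>U\<close>, which works because an algebra map respects commutators. A retract of an induced
  module is enough, hence the target U \<otimes> U instead of M \<otimes> U. Vanishing is claimed
  for all resolutions over arbitrary types, so the comparison is carried out by explicit lifts in
  low degrees. The resolution of length one plays two parts: it is the object of comparison, and it
  shows that the claim is not vacuous.\<close>

text \<open>
  The enveloping algebra of \<open>gg\<close> is the tensor algebra of \<open>MM\<close>, so its augmentation ideal is relatively
  free and \<open>kk\<close> has a relative projective resolution of length one; comparing an arbitrary resolution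
  with it gives the vanishing of \<open>H\<^sup>R\<^sup>T\<close> in degree two. Concretely, the augmentation ideal of
  \<open>U\<close> is split off \<open>U \<otimes> U\<close> by the Fox derivative, the map \<open>D\<close> with \<open>D (u v) = D u \<cdot> v + \<epsilon> u \<cdot> D v\<close>
  and \<open>D m = m \<otimes> 1\<close> for \<open>m\<close> in \<open>MM\<close>. It exists because the tensor algebra is free.

  On the Chevalley--Eilenberg side, \<open>\<omega> = t\<^sub>0t\<^sub>1 e\<^sub>0 \<and> e\<^sub>1 + t\<^sub>0t\<^sub>2 e\<^sub>0 \<and> e\<^sub>2 + t\<^sub>1t\<^sub>2 e\<^sub>1 \<and> e\<^sub>2\<close> is a cycle: its
  boundary is the square of \<open>t\<^sub>0e\<^sub>0 + t\<^sub>1e\<^sub>1 + t\<^sub>2e\<^sub>2 = 0\<close>, as \<open>t\<^sub>i\<^sup>2 = 0\<close> and the characteristic is two. The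
  alternating form \<open>det (t, v, w)\<close> on \<open>kk3\<close> descends to \<open>MM\<close> and, applied to the components of weight
  one, kills every boundary, as brackets have no such component. On \<open>\<omega>\<close> it takes the value
  \<open>3 t\<^sub>0t\<^sub>1t\<^sub>2 \<noteq> 0\<close>.
\<close>

section \<open>Presented objects\<close>

lemma exprs_simps [simp]:
  "Gen x \<in> exprs K C X \<longleftrightarrow> x \<in> X"
  "Zero \<in> exprs K C X"
  "Add s t \<in> exprs K C X \<longleftrightarrow> s \<in> exprs K C X \<and> t \<in> exprs K C X"
  "Neg s \<in> exprs K C X \<longleftrightarrow> s \<in> exprs K C X"
  "Scale c s \<in> exprs K C X \<longleftrightarrow> c \<in> C \<and> s \<in> exprs K C X"
  "Mul s t \<in> exprs K C X \<longleftrightarrow> K \<noteq> Linear \<and> s \<in> exprs K C X \<and> t \<in> exprs K C X"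
  "One \<in> exprs K C X \<longleftrightarrow> K = Unital"
  by (auto intro: exprs.intros elim: exprs.cases)

definition expr_class ::
    "('c, 'r) ring_scheme \<Rightarrow> ('c, 'x) expr set \<Rightarrow> ('c, 'x) expr rel \<Rightarrow> ('c, 'x) expr \<Rightarrow> ('c, 'x) expr set"
  where "expr_class R T E e = expr_cong R T E `` {e}"

lemma expr_cong_in: "(s, t) \<in> expr_cong R T E \<Longrightarrow> s \<in> T \<and> t \<in> T"
  by (induction rule: expr_cong.induct) auto

lemma equiv_expr_cong: "equiv T (expr_cong R T E)"
proof (rule equivI)
  show "expr_cong R T E \<subseteq> T \<times> T" using expr_cong_in by fastforce
  show "refl_on T (expr_cong R T E)"
    by (auto simp: refl_on_def intro: expr_cong.intros)
  show "sym (expr_cong R T E)" by (auto simp: sym_def intro: expr_cong.intros)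
  show "trans (expr_cong R T E)" by (auto simp: trans_def intro: expr_cong.intros(3))
qed

lemma expr_class_eqI: "(s, t) \<in> expr_cong R T E \<Longrightarrow> expr_class R T E s = expr_class R T E t"
  unfolding expr_class_def using equiv_class_eq[OF equiv_expr_cong] by blast

lemma expr_class_relI:
  "(s, t) \<in> E \<Longrightarrow> s \<in> T \<Longrightarrow> t \<in> T \<Longrightarrow> expr_class R T E s = expr_class R T E t"
  by (intro expr_class_eqI expr_cong.intros(5))

lemma expr_class_axiomI:
  "algebra_axiom R s t \<Longrightarrow> s \<in> T \<Longrightarrow> t \<in> T \<Longrightarrow> expr_class R T E s = expr_class R T E t"
  by (intro expr_class_eqI expr_cong.intros(4))

text \<open>The operations of \<open>presented\<close> saturate the set of results over all
  representatives. Once these results are congruent to each other, the saturation is a single class,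
  which is how well-definedness enters.\<close>

lemma expr_class_Image:
  assumes "e \<in> Z" "\<And>z. z \<in> Z \<Longrightarrow> (e, z) \<in> expr_cong R T E"
  shows "expr_cong R T E `` Z = expr_class R T E e"
  using assms unfolding expr_class_def by (blast intro: expr_cong.intros(3))

lemma carrier_presented: "carrier (presented R T E) = {expr_class R T E e | e. e \<in> T}"
  by (auto simp: presented_def quotient_def expr_class_def)

lemma expr_class_in_presented: "e \<in> T \<Longrightarrow> expr_class R T E e \<in> carrier (presented R T E)"
  by (auto simp: carrier_presented)

lemma expr_class_refl: "e \<in> T \<Longrightarrow> e \<in> expr_class R T E e"
  by (auto simp: expr_class_def intro: expr_cong.intros)

lemma presented_zero: "\<zero>\<^bsub>presented R T E\<^esub> = expr_class R T E Zero"
  and presented_one: "\<one>\<^bsub>presented R T E\<^esub> = expr_class R T E One"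
  by (simp_all add: presented_def expr_class_def)

lemma presented_add:
  assumes "Add s t \<in> exprs K C X"
  shows "expr_class R (exprs K C X) E s \<oplus>\<^bsub>presented R (exprs K C X) E\<^esub> expr_class R (exprs K C X) E t
    = expr_class R (exprs K C X) E (Add s t)"
proof -
  let ?c = "expr_cong R (exprs K C X) E"
  have "?c `` {Add s' t' | s' t'. s' \<in> ?c `` {s} \<and> t' \<in> ?c `` {t}} = expr_class R (exprs K C X) E (Add s t)"
    using assms
    by (intro expr_class_Image)
      (auto simp: expr_class_def intro!: expr_cong.intros(6) intro: expr_cong.intros(1) dest: expr_cong_in)
  then show ?thesis by (simp add: presented_def expr_class_def)
qed

lemma presented_mult:
  assumes "Mul s t \<in> exprs K C X"
  shows "expr_class R (exprs K C X) E s \<otimes>\<^bsub>presented R (exprs K C X) E\<^esub> expr_class R (exprs K C X) E t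
    = expr_class R (exprs K C X) E (Mul s t)"
proof -
  let ?c = "expr_cong R (exprs K C X) E"
  have "?c `` {Mul s' t' | s' t'. s' \<in> ?c `` {s} \<and> t' \<in> ?c `` {t}} = expr_class R (exprs K C X) E (Mul s t)"
    using assms
    by (intro expr_class_Image)
      (auto simp: expr_class_def intro!: expr_cong.intros(9) intro: expr_cong.intros(1) dest: expr_cong_in)
  then show ?thesis by (simp add: presented_def expr_class_def)
qed

lemma presented_smult:
  assumes "Scale c s \<in> exprs K C X"
  shows "c \<odot>\<^bsub>presented R (exprs K C X) E\<^esub> expr_class R (exprs K C X) E s
    = expr_class R (exprs K C X) E (Scale c s)"
proof -
  let ?c = "expr_cong R (exprs K C X) E"
  have "?c `` {Scale c s' | s'. s' \<in> ?c `` {s}} = expr_class R (exprs K C X) E (Scale c s)"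
    using assms
    by (intro expr_class_Image)
      (auto simp: expr_class_def intro!: expr_cong.intros(8) intro: expr_cong.intros(1) dest: expr_cong_in)
  then show ?thesis by (simp add: presented_def expr_class_def)
qed

text \<open>The common target of all evaluation maps. Premises such as c \<oplus> d \<in> C mirror
  the rule that an axiom is imposed only if both of its sides are admissible expressions. Thus
  \<open>C = {}\<close> yields plain abelian groups, as tensor products need, and
  \<open>K = Linear\<close> yields modules.\<close>

locale expr_model = abelian_group A
  for K :: kind and C :: "'c set" and R :: "('c, 'r) ring_scheme"
    and A :: "('c, 'b, 'm) module_scheme" (structure) +
  assumes smult_closed: "c \<in> C \<Longrightarrow> x \<in> carrier A \<Longrightarrow> c \<odot>\<^bsub>A\<^esub> x \<in> carrier A"
    and smult_l_distr: "c \<in> C \<Longrightarrow> d \<in> C \<Longrightarrow> c \<oplus>\<^bsub>R\<^esub> d \<in> C \<Longrightarrow> x \<in> carrier A \<Longrightarrow>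
      (c \<oplus>\<^bsub>R\<^esub> d) \<odot>\<^bsub>A\<^esub> x = c \<odot>\<^bsub>A\<^esub> x \<oplus> d \<odot>\<^bsub>A\<^esub> x"
    and smult_r_distr: "c \<in> C \<Longrightarrow> x \<in> carrier A \<Longrightarrow> y \<in> carrier A \<Longrightarrow>
      c \<odot>\<^bsub>A\<^esub> (x \<oplus> y) = c \<odot>\<^bsub>A\<^esub> x \<oplus> c \<odot>\<^bsub>A\<^esub> y"
    and smult_assoc: "c \<in> C \<Longrightarrow> d \<in> C \<Longrightarrow> c \<otimes>\<^bsub>R\<^esub> d \<in> C \<Longrightarrow> x \<in> carrier A \<Longrightarrow>
      (c \<otimes>\<^bsub>R\<^esub> d) \<odot>\<^bsub>A\<^esub> x = c \<odot>\<^bsub>A\<^esub> (d \<odot>\<^bsub>A\<^esub> x)"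
    and smult_one: "\<one>\<^bsub>R\<^esub> \<in> C \<Longrightarrow> x \<in> carrier A \<Longrightarrow> \<one>\<^bsub>R\<^esub> \<odot>\<^bsub>A\<^esub> x = x"
    and mult_closed: "K \<noteq> Linear \<Longrightarrow> x \<in> carrier A \<Longrightarrow> y \<in> carrier A \<Longrightarrow> x \<otimes> y \<in> carrier A"
    and mult_l_distr: "K \<noteq> Linear \<Longrightarrow> x \<in> carrier A \<Longrightarrow> y \<in> carrier A \<Longrightarrow> z \<in> carrier A \<Longrightarrow>
      (x \<oplus> y) \<otimes> z = x \<otimes> z \<oplus> y \<otimes> z"
    and mult_r_distr: "K \<noteq> Linear \<Longrightarrow> x \<in> carrier A \<Longrightarrow> y \<in> carrier A \<Longrightarrow> z \<in> carrier A \<Longrightarrow>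
      z \<otimes> (x \<oplus> y) = z \<otimes> x \<oplus> z \<otimes> y"
    and smult_mult_l: "K \<noteq> Linear \<Longrightarrow> c \<in> C \<Longrightarrow> x \<in> carrier A \<Longrightarrow> y \<in> carrier A \<Longrightarrow>
      (c \<odot>\<^bsub>A\<^esub> x) \<otimes> y = c \<odot>\<^bsub>A\<^esub> (x \<otimes> y)"
    and smult_mult_r: "K \<noteq> Linear \<Longrightarrow> c \<in> C \<Longrightarrow> x \<in> carrier A \<Longrightarrow> y \<in> carrier A \<Longrightarrow>
      x \<otimes> (c \<odot>\<^bsub>A\<^esub> y) = c \<odot>\<^bsub>A\<^esub> (x \<otimes> y)"
    and unit_closed: "K = Unital \<Longrightarrow> \<one> \<in> carrier A"
    and unit_l: "K = Unital \<Longrightarrow> x \<in> carrier A \<Longrightarrow> \<one> \<otimes> x = x"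
    and unit_r: "K = Unital \<Longrightarrow> x \<in> carrier A \<Longrightarrow> x \<otimes> \<one> = x"
begin

lemma eval_closed:
  assumes "e \<in> exprs K C X" "\<gamma> \<in> X \<rightarrow> carrier A"
  shows "expr_eval A \<gamma> e \<in> carrier A"
  using assms(1)
  by (induction rule: exprs.induct)
     (use assms(2) in \<open>auto intro: smult_closed mult_closed unit_closed\<close>)

lemma eval_algebra_axiom:
  assumes "algebra_axiom R s t" "s \<in> exprs K C X" "t \<in> exprs K C X"
    and g: "\<gamma> \<in> X \<rightarrow> carrier A"
  shows "expr_eval A \<gamma> s = expr_eval A \<gamma> t"
proof -
  note c = eval_closed[OF _ g]
  show ?thesis
    using assms(1-3)
  proof cases
    case 1 with assms show ?thesis by (simp add: c a_assoc)
  next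
    case 2 with assms show ?thesis by (simp add: c a_comm)
  next
    case 3 with assms show ?thesis by (simp add: c)
  next
    case 4 with assms show ?thesis by (simp add: c l_neg)
  next
    case 5 with assms show ?thesis by (simp add: c smult_l_distr)
  next
    case 6 with assms show ?thesis by (simp add: c smult_r_distr)
  next
    case 7 with assms show ?thesis by (simp add: c smult_assoc)
  next
    case 8 with assms show ?thesis by (simp add: c smult_one)
  next
    case 9 with assms show ?thesis by (simp add: c mult_l_distr)
  next
    case 10 with assms show ?thesis by (simp add: c mult_r_distr)
  next
    case 11 with assms show ?thesis by (simp add: c smult_mult_l)
  next
    case 12 with assms show ?thesis by (simp add: c smult_mult_r)
  next
    case 13 with assms show ?thesis by (simp add: c unit_l)
  next
    case 14 with assms show ?thesis by (simp add: c unit_r)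
  qed
qed

lemma eval_cong:
  assumes "(s, t) \<in> expr_cong R (exprs K C X) E"
    and g: "\<gamma> \<in> X \<rightarrow> carrier A"
    and r: "\<And>s t. (s, t) \<in> E \<Longrightarrow> s \<in> exprs K C X \<Longrightarrow> t \<in> exprs K C X \<Longrightarrow>
      expr_eval A \<gamma> s = expr_eval A \<gamma> t"
  shows "expr_eval A \<gamma> s = expr_eval A \<gamma> t"
  using assms(1) by (induction rule: expr_cong.induct) (auto intro: eval_algebra_axiom[OF _ _ _ g] r)

text \<open>Congruent expressions have equal values, so evaluation maps a class to a singleton and
  \<open>the_elem\<close> in \<open>extend_hom\<close> is meaningful.\<close>

lemma extend_hom_class:
  assumes "e \<in> exprs K C X"
    and "\<gamma> \<in> X \<rightarrow> carrier A"
    and "\<And>s t. (s, t) \<in> E \<Longrightarrow> s \<in> exprs K C X \<Longrightarrow> t \<in> exprs K C X \<Longrightarrow>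
      expr_eval A \<gamma> s = expr_eval A \<gamma> t"
  shows "extend_hom A \<gamma> (expr_class R (exprs K C X) E e) = expr_eval A \<gamma> e"
proof -
  have "expr_eval A \<gamma> t = expr_eval A \<gamma> e" if "t \<in> expr_class R (exprs K C X) E e" for t
    using eval_cong[OF _ assms(2,3), of e t E] that by (simp add: expr_class_def)
  then have "expr_eval A \<gamma> ` expr_class R (exprs K C X) E e = {expr_eval A \<gamma> e}"
    using expr_class_refl[OF assms(1), of R E] by blast
  then show ?thesis by (simp add: extend_hom_def)
qed

end

text \<open>Numbered like the clauses of \<open>algebra_axiom\<close>.\<close>

lemmas expr_class_axioms = algebra_axiom.intros[THEN expr_class_axiomI]

lemma presented_abelian_group: "abelian_group (presented R (exprs K C X) E)"
proof (rule abelian_groupI; (unfold carrier_presented presented_zero)?)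
  let ?T = "exprs K C X"
  let ?c = "expr_class R ?T E"
  let ?A = "presented R ?T E"
  have m: "?c e \<in> {?c e |e. e \<in> ?T}" if "e \<in> ?T" for e using that by blast
  show "?c Zero \<in> {?c e |e. e \<in> ?T}" by (rule m) simp
  fix x assume "x \<in> {?c e |e. e \<in> ?T}"
  then obtain e where e: "x = ?c e" "e \<in> ?T" by blast
  show "?c Zero \<oplus>\<^bsub>?A\<^esub> x = x"
    using e by (simp add: presented_add expr_class_axioms(3))
  show "\<exists>y\<in>{?c e |e. e \<in> ?T}. y \<oplus>\<^bsub>?A\<^esub> x = ?c Zero"
  proof (rule bexI)
    show "?c (Neg e) \<oplus>\<^bsub>?A\<^esub> x = ?c Zero"
      using e by (simp add: presented_add expr_class_axioms(4))
    show "?c (Neg e) \<in> {?c e |e. e \<in> ?T}" using e by (intro m) simp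
  qed
  fix y assume "y \<in> {?c e |e. e \<in> ?T}"
  then obtain e' where e': "y = ?c e'" "e' \<in> ?T" by blast
  show "x \<oplus>\<^bsub>?A\<^esub> y \<in> {?c e |e. e \<in> ?T}"
    unfolding e(1) e'(1) using e(2) e'(2) by (subst presented_add) (simp, rule m, simp)
  show "x \<oplus>\<^bsub>?A\<^esub> y = y \<oplus>\<^bsub>?A\<^esub> x"
    using e e' by (simp add: presented_add expr_class_axioms(2)[of _ _ ?T])
  fix z assume "z \<in> {?c e |e. e \<in> ?T}"
  then obtain e'' where e'': "z = ?c e''" "e'' \<in> ?T" by blast
  show "x \<oplus>\<^bsub>?A\<^esub> y \<oplus>\<^bsub>?A\<^esub> z = x \<oplus>\<^bsub>?A\<^esub> (y \<oplus>\<^bsub>?A\<^esub> z)"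
    using e e' e'' by (simp add: presented_add expr_class_axioms(1))
qed

lemma presented_minus:
  assumes "s \<in> exprs K C X"
  shows "\<ominus>\<^bsub>presented R (exprs K C X) E\<^esub> expr_class R (exprs K C X) E s
    = expr_class R (exprs K C X) E (Neg s)"
proof -
  interpret abelian_group "presented R (exprs K C X) E" by (rule presented_abelian_group)
  have "expr_class R (exprs K C X) E (Neg s) \<oplus>\<^bsub>presented R (exprs K C X) E\<^esub> expr_class R (exprs K C X) E s
     = \<zero>\<^bsub>presented R (exprs K C X) E\<^esub>"
    using assms by (simp add: presented_zero presented_add expr_class_axioms(4))
  then show ?thesis using assms
    by (intro minus_equality) (auto intro: expr_class_in_presented)
qed

text \<open>Presented objects are themselves targets of evaluation: the differentials take values in
  exterior powers, and Lie expressions are evaluated in the tensor algebra.\<close>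

lemma presented_model: "expr_model K C R (presented R (exprs K C X) E)"
proof -
  interpret abelian_group "presented R (exprs K C X) E" by (rule presented_abelian_group)
  have m: "expr_class R (exprs K C X) E e \<in> {expr_class R (exprs K C X) E e |e. e \<in> exprs K C X}"
    if "e \<in> exprs K C X" for e using that by blast
  show ?thesis
  proof (unfold_locales, unfold carrier_presented presented_one, goal_cases)
    case (1 c x)
    then obtain s where "x = expr_class R (exprs K C X) E s" "s \<in> exprs K C X" by blast
    then show ?case using 1(1) by (subst \<open>x = _\<close>, subst presented_smult) (simp, rule m, simp)
  next
    case (6 x y)
    then obtain s t where "x = expr_class R (exprs K C X) E s" "s \<in> exprs K C X"
      "y = expr_class R (exprs K C X) E t" "t \<in> exprs K C X" by blast
    then show ?case using 6(1)
      by (subst \<open>x = _\<close>, subst \<open>y = _\<close>, subst presented_mult) (simp, rule m, simp)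
  next
    case 11 then show ?case by (intro m) simp
  next
    case 2 then show ?case by (clarsimp simp: presented_add presented_smult expr_class_axioms(5))
  next
    case 3 then show ?case by (clarsimp simp: presented_add presented_smult expr_class_axioms(6))
  next
    case 4 then show ?case by (clarsimp simp: presented_add presented_smult expr_class_axioms(7))
  next
    case 5 then show ?case by (clarsimp simp: presented_add presented_smult expr_class_axioms(8))
  next
    case 7 then show ?case by (clarsimp simp: presented_add presented_mult expr_class_axioms(9))
  next
    case 8 then show ?case by (clarsimp simp: presented_add presented_mult expr_class_axioms(10))
  next
    case 9 then show ?case by (clarsimp simp: presented_smult presented_mult expr_class_axioms(11))
  next
    case 10 then show ?case by (clarsimp simp: presented_smult presented_mult expr_class_axioms(12))
  next
    case 12 then show ?case by (clarsimp simp: presented_mult expr_class_axioms(13))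
  next
    case 13 then show ?case by (clarsimp simp: presented_mult expr_class_axioms(14))
  qed
qed

section \<open>Tensor products and induced modules\<close>

abbreviation add_hom :: "('c, 'b, 'm) module_scheme \<Rightarrow> ('d, 'e, 'n) module_scheme \<Rightarrow> ('b \<Rightarrow> 'e) set"
  where "add_hom P Q \<equiv> hom (add_monoid P) (add_monoid Q)"

lemma add_hom_closed: "h \<in> add_hom P Q \<Longrightarrow> x \<in> carrier P \<Longrightarrow> h x \<in> carrier Q"
  by (auto simp: hom_def)

lemma add_hom_add:
  "h \<in> add_hom P Q \<Longrightarrow> x \<in> carrier P \<Longrightarrow> y \<in> carrier P \<Longrightarrow>
    h (x \<oplus>\<^bsub>P\<^esub> y) = h x \<oplus>\<^bsub>Q\<^esub> h y"
  by (auto simp: hom_def)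

lemma add_hom_zero: "h \<in> add_hom P Q \<Longrightarrow> abelian_group P \<Longrightarrow> abelian_group Q \<Longrightarrow> h \<zero>\<^bsub>P\<^esub> = \<zero>\<^bsub>Q\<^esub>"
  using hom_one[of h "add_monoid P" "add_monoid Q"] by (simp add: abelian_group.a_group)

lemma add_hom_minus:
  assumes "h \<in> add_hom P Q" "abelian_group P" "abelian_group Q" "x \<in> carrier P"
  shows "h (\<ominus>\<^bsub>P\<^esub> x) = \<ominus>\<^bsub>Q\<^esub> h x"
  using group_hom.hom_inv[of "add_monoid P" "add_monoid Q" h x] assms
  by (simp add: abelian_group.a_group group_hom_def group_hom_axioms_def a_inv_def)

lemma add_homI:
  assumes "\<And>x. x \<in> carrier P \<Longrightarrow> h x \<in> carrier Q"
    and "\<And>x y. x \<in> carrier P \<Longrightarrow> y \<in> carrier P \<Longrightarrow> h (x \<oplus>\<^bsub>P\<^esub> y) = h x \<oplus>\<^bsub>Q\<^esub> h y"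
  shows "h \<in> add_hom P Q"
  using assms by (auto simp: hom_def)

lemma right_module_homD:
  assumes "h \<in> right_module_hom R P Q"
  shows "h \<in> add_hom P Q"
    and "r \<in> carrier R \<Longrightarrow> x \<in> carrier P \<Longrightarrow> h (r \<odot>\<^bsub>P\<^esub> x) = r \<odot>\<^bsub>Q\<^esub> h x"
  using assms by (auto simp: right_module_hom_def)

lemma right_module_homI:
  assumes "h \<in> add_hom P Q"
    and "\<And>r x. r \<in> carrier R \<Longrightarrow> x \<in> carrier P \<Longrightarrow> h (r \<odot>\<^bsub>P\<^esub> x) = r \<odot>\<^bsub>Q\<^esub> h x"
  shows "h \<in> right_module_hom R P Q"
  using assms by (auto simp: right_module_hom_def)

lemmas right_module_hom_closed = add_hom_closed[OF right_module_homD(1)]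
  and right_module_hom_add = add_hom_add[OF right_module_homD(1)]
  and right_module_hom_zero = add_hom_zero[OF right_module_homD(1)]
  and right_module_hom_minus = add_hom_minus[OF right_module_homD(1)]

lemma right_module_hom_comp:
  assumes "f \<in> right_module_hom R P Q" "g \<in> right_module_hom R Q L"
  shows "(\<lambda>x. g (f x)) \<in> right_module_hom R P L"
  using assms
  by (intro right_module_homI add_homI)
    (simp_all add: right_module_hom_closed right_module_hom_add right_module_homD(2))

lemma right_module_abelian: "right_module R P \<Longrightarrow> abelian_group P"
  by (simp add: right_module_def)

lemma right_module_hom_diff:
  assumes "right_module R Q" "f \<in> right_module_hom R P Q" "g \<in> right_module_hom R P Q"
  shows "(\<lambda>x. f x \<ominus>\<^bsub>Q\<^esub> g x) \<in> right_module_hom R P Q"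
proof -
  interpret Q: right_module R Q by fact
  have neg: "r \<odot>\<^bsub>Q\<^esub> (\<ominus>\<^bsub>Q\<^esub> x) = \<ominus>\<^bsub>Q\<^esub> (r \<odot>\<^bsub>Q\<^esub> x)" if "r \<in> carrier R" "x \<in> carrier Q" for r x
    by (rule add_hom_minus) (use that in \<open>auto intro!: add_homI Q.ract_closed Q.ract_add Q.P.abelian_group_axioms\<close>)
  show ?thesis
    using assms(2,3)
    by (intro right_module_homI add_homI)
      (simp_all add: right_module_hom_closed right_module_hom_add right_module_homD(2)
        a_minus_def Q.ract_add neg Q.P.minus_add Q.P.a_ac)
qed

lemma pure_tensor_alt: "pure_tensor S A B a b = expr_class S (tensor_exprs A B) (tensor_rel S A B) (Gen (a, b))"
  by (simp add: pure_tensor_def expr_class_def)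

lemma tensor_product_abelian: "abelian_group (tensor_product S A B)"
  unfolding tensor_product_def tensor_exprs_def by (rule presented_abelian_group)

lemma pure_tensor_closed:
  "a \<in> carrier A \<Longrightarrow> b \<in> carrier B \<Longrightarrow> pure_tensor S A B a b \<in> carrier (tensor_product S A B)"
  unfolding tensor_product_def pure_tensor_alt
  by (rule expr_class_in_presented) (simp add: tensor_exprs_def)

lemma pure_tensor_add_l:
  assumes "a \<in> carrier A" "a' \<in> carrier A" "a \<oplus>\<^bsub>A\<^esub> a' \<in> carrier A" "b \<in> carrier B"
  shows "pure_tensor S A B (a \<oplus>\<^bsub>A\<^esub> a') b
    = pure_tensor S A B a b \<oplus>\<^bsub>tensor_product S A B\<^esub> pure_tensor S A B a' b"
proof -
  have "(Gen (a \<oplus>\<^bsub>A\<^esub> a', b), Add (Gen (a, b)) (Gen (a', b))) \<in> tensor_rel S A B"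
    using assms by (fastforce simp: tensor_rel_def)
  then show ?thesis unfolding pure_tensor_alt tensor_product_def using assms
    by (simp add: tensor_exprs_def presented_add expr_class_relI)
qed

lemma pure_tensor_add_r:
  assumes "a \<in> carrier A" "b \<in> carrier B" "b' \<in> carrier B" "b \<oplus>\<^bsub>B\<^esub> b' \<in> carrier B"
  shows "pure_tensor S A B a (b \<oplus>\<^bsub>B\<^esub> b')
    = pure_tensor S A B a b \<oplus>\<^bsub>tensor_product S A B\<^esub> pure_tensor S A B a b'"
proof -
  have "(Gen (a, b \<oplus>\<^bsub>B\<^esub> b'), Add (Gen (a, b)) (Gen (a, b'))) \<in> tensor_rel S A B"
    using assms by (fastforce simp: tensor_rel_def)
  then show ?thesis unfolding pure_tensor_alt tensor_product_def using assms
    by (simp add: tensor_exprs_def presented_add expr_class_relI)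
qed

lemma pure_tensor_balanced:
  assumes "s \<in> carrier S" "a \<in> carrier A" "b \<in> carrier B"
    and "s \<odot>\<^bsub>A\<^esub> a \<in> carrier A" "s \<odot>\<^bsub>B\<^esub> b \<in> carrier B"
  shows "pure_tensor S A B (s \<odot>\<^bsub>A\<^esub> a) b = pure_tensor S A B a (s \<odot>\<^bsub>B\<^esub> b)"
proof -
  have "(Gen (s \<odot>\<^bsub>A\<^esub> a, b), Gen (a, s \<odot>\<^bsub>B\<^esub> b)) \<in> tensor_rel S A B"
    using assms by (fastforce simp: tensor_rel_def)
  then show ?thesis unfolding pure_tensor_alt using assms
    by (simp add: tensor_exprs_def expr_class_relI)
qed

text \<open>Tensor products are built from expressions without scalars, so negatives need a case of
  their own: they are not multiples by minus one.\<close>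

lemma tensor_product_induct [consumes 1, case_names zero pure add minus]:
  assumes "x \<in> carrier (tensor_product S A B)"
    and "P \<zero>\<^bsub>tensor_product S A B\<^esub>"
    and "\<And>a b. a \<in> carrier A \<Longrightarrow> b \<in> carrier B \<Longrightarrow> P (pure_tensor S A B a b)"
    and "\<And>x y. x \<in> carrier (tensor_product S A B) \<Longrightarrow> y \<in> carrier (tensor_product S A B) \<Longrightarrow>
      P x \<Longrightarrow> P y \<Longrightarrow> P (x \<oplus>\<^bsub>tensor_product S A B\<^esub> y)"
    and "\<And>x. x \<in> carrier (tensor_product S A B) \<Longrightarrow> P x \<Longrightarrow> P (\<ominus>\<^bsub>tensor_product S A B\<^esub> x)"
  shows "P x"
proof -
  let ?T = "exprs Linear {} (carrier A \<times> carrier B)"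
  let ?c = "expr_class S ?T (tensor_rel S A B)"
  have T: "tensor_product S A B = presented S ?T (tensor_rel S A B)"
    by (simp add: tensor_product_def tensor_exprs_def)
  obtain e where e: "e \<in> ?T" "x = ?c e" using assms(1) unfolding T carrier_presented by blast
  have "P (?c e)" using e(1)
  proof (induction rule: exprs.induct)
    case (1 x)
    then show ?case using assms(3)[of "fst x" "snd x"] by (auto simp: pure_tensor_alt tensor_exprs_def)
  next
    case 2 then show ?case using assms(2) by (simp add: T presented_zero)
  next
    case (3 s t)
    then show ?case using assms(4)[of "?c s" "?c t"] by (simp add: T presented_add expr_class_in_presented)
  next
    case (4 s)
    then show ?case using assms(5)[of "?c s"] by (simp add: T presented_minus expr_class_in_presented)
  qed auto
  then show ?thesis using e by simp
qed

text \<open>The universal property for balanced maps. \<open>A\<close> and \<open>B\<close> are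
  arbitrary records, and a relation is imposed only if both of its sides are expressions over their
  carriers; closure of sums and multiples is therefore available to whoever checks \<open>l\<close>,
  \<open>r\<close> and \<open>m\<close>.\<close>

lemma tensor_extend:
  fixes G :: "('s, 'g, 'm) module_scheme" and S :: "('s, 'r) ring_scheme"
  assumes G: "abelian_group G"
    and f: "\<And>a b. a \<in> carrier A \<Longrightarrow> b \<in> carrier B \<Longrightarrow> f (a, b) \<in> carrier G"
    and l: "\<And>a a' b. a \<in> carrier A \<Longrightarrow> a' \<in> carrier A \<Longrightarrow> a \<oplus>\<^bsub>A\<^esub> a' \<in> carrier A \<Longrightarrow> b \<in> carrier B \<Longrightarrow>
      f (a \<oplus>\<^bsub>A\<^esub> a', b) = f (a, b) \<oplus>\<^bsub>G\<^esub> f (a', b)"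
    and r: "\<And>a b b'. a \<in> carrier A \<Longrightarrow> b \<in> carrier B \<Longrightarrow> b' \<in> carrier B \<Longrightarrow> b \<oplus>\<^bsub>B\<^esub> b' \<in> carrier B \<Longrightarrow>
      f (a, b \<oplus>\<^bsub>B\<^esub> b') = f (a, b) \<oplus>\<^bsub>G\<^esub> f (a, b')"
    and m: "\<And>s a b. s \<in> carrier S \<Longrightarrow> a \<in> carrier A \<Longrightarrow> b \<in> carrier B \<Longrightarrow> s \<odot>\<^bsub>A\<^esub> a \<in> carrier A \<Longrightarrow>
      s \<odot>\<^bsub>B\<^esub> b \<in> carrier B \<Longrightarrow> f (s \<odot>\<^bsub>A\<^esub> a, b) = f (a, s \<odot>\<^bsub>B\<^esub> b)"
  shows "extend_hom G f \<in> add_hom (tensor_product S A B) G"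
    and "a \<in> carrier A \<Longrightarrow> b \<in> carrier B \<Longrightarrow> extend_hom G f (pure_tensor S A B a b) = f (a, b)"
proof -
  let ?X = "carrier A \<times> carrier B"
  let ?T = "exprs Linear {} ?X :: ('s, _) expr set"
  interpret G: abelian_group G by fact
  \<comment> \<open>With the empty set of scalars all scalar laws for \<open>G\<close> hold
    vacuously.\<close>
  interpret M: expr_model Linear "{}" S G by unfold_locales auto
  have g: "f \<in> ?X \<rightarrow> carrier G" using f by auto
  have rel: "expr_eval G f s = expr_eval G f t"
    if "(s, t) \<in> tensor_rel S A B" "s \<in> ?T" "t \<in> ?T" for s t
    using that unfolding tensor_rel_def by (auto intro!: l r m)
  have ev: "extend_hom G f (expr_class S ?T (tensor_rel S A B) e) = expr_eval G f e" if "e \<in> ?T" for e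
    by (rule M.extend_hom_class[OF that g rel])
  have T: "tensor_product S A B = presented S ?T (tensor_rel S A B)"
    by (simp add: tensor_product_def tensor_exprs_def)
  show "extend_hom G f \<in> add_hom (tensor_product S A B) G"
  proof (rule add_homI)
    fix x assume "x \<in> carrier (tensor_product S A B)"
    then obtain e where e: "x = expr_class S ?T (tensor_rel S A B) e" "e \<in> ?T"
      unfolding T carrier_presented by blast
    show "extend_hom G f x \<in> carrier G" using e by (simp add: ev M.eval_closed[OF _ g])
    fix y assume "y \<in> carrier (tensor_product S A B)"
    then obtain e' where e': "y = expr_class S ?T (tensor_rel S A B) e'" "e' \<in> ?T"
      unfolding T carrier_presented by blast
    show "extend_hom G f (x \<oplus>\<^bsub>tensor_product S A B\<^esub> y) = extend_hom G f x \<oplus>\<^bsub>G\<^esub> extend_hom G f y"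
      using e e' by (simp add: T ev presented_add)
  qed
  show "extend_hom G f (pure_tensor S A B a b) = f (a, b)" if "a \<in> carrier A" "b \<in> carrier B"
    unfolding pure_tensor_alt tensor_exprs_def using ev[of "Gen (a, b)"] that by simp
qed

lemma tensor_hom_eq:
  assumes "abelian_group G" "f \<in> add_hom (tensor_product S A B) G" "g \<in> add_hom (tensor_product S A B) G"
    and "\<And>a b. a \<in> carrier A \<Longrightarrow> b \<in> carrier B \<Longrightarrow> f (pure_tensor S A B a b) = g (pure_tensor S A B a b)"
    and "x \<in> carrier (tensor_product S A B)"
  shows "f x = g x"
  using assms(5)
proof (induction rule: tensor_product_induct)
  case zero then show ?case by (simp add: add_hom_zero[OF assms(2)] add_hom_zero[OF assms(3)] tensor_product_abelian assms(1))
next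
  case (pure a b) then show ?case by (rule assms(4))
next
  case (add x y) then show ?case by (simp add: add_hom_add[OF assms(2)] add_hom_add[OF assms(3)])
next
  case (minus x)
  then show ?case
    by (simp add: add_hom_minus[OF assms(2)] add_hom_minus[OF assms(3)] tensor_product_abelian assms(1))
qed

lemma regular_algebra_simps [simp]:
  "carrier (regular_algebra R) = carrier R" "add (regular_algebra R) = add R"
  "zero (regular_algebra R) = zero R" "mult (regular_algebra R) = mult R"
  "one (regular_algebra R) = one R" "smult (regular_algebra R) = mult R"
  by (simp_all add: regular_algebra_def)

section \<open>Induced modules and their universal property\<close>

locale induced = right_module "R\<lparr>carrier := S\<rparr>" A + base: ring R
  for R :: "('r, 'k) ring_scheme" and S A +
  assumes S_subset: "S \<subseteq> carrier R"
begin

abbreviation "T \<equiv> tensor_product (R\<lparr>carrier := S\<rparr>) A (regular_algebra R)"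
abbreviation "Ind \<equiv> induced_module R S A"
abbreviation "pure \<equiv> pure_tensor (R\<lparr>carrier := S\<rparr>) A (regular_algebra R)"

lemma Ind_simps [simp]:
  "carrier Ind = carrier T" "add Ind = add T" "zero Ind = zero T"
  by (simp_all add: induced_module_def Let_def)

lemma Ind_add_monoid [simp]: "add_monoid Ind = add_monoid T" by simp

text \<open>Right multiplication on the second factor commutes with the left multiplication by
  \<open>S\<close>, hence is balanced and descends to the tensor product.\<close>

lemma act_hom: "r \<in> carrier R \<Longrightarrow> (\<lambda>x. r \<odot>\<^bsub>Ind\<^esub> x) \<in> add_hom T T" (is "_ \<Longrightarrow> ?A")
  and act_pure: "r \<in> carrier R \<Longrightarrow> a \<in> carrier A \<Longrightarrow> x \<in> carrier R \<Longrightarrow> r \<odot>\<^bsub>Ind\<^esub> pure a x = pure a (x \<otimes>\<^bsub>R\<^esub> r)"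
    (is "_ \<Longrightarrow> _ \<Longrightarrow> _ \<Longrightarrow> ?B")
proof -
  assume r: "r \<in> carrier R"
  let ?f = "\<lambda>(a, x). pure a (x \<otimes>\<^bsub>R\<^esub> r)"
  have sm: "smult Ind r = extend_hom T ?f" by (simp add: induced_module_def Let_def)
  have *: "extend_hom T ?f \<in> add_hom T T \<and>
    (a \<in> carrier A \<longrightarrow> x \<in> carrier R \<longrightarrow> extend_hom T ?f (pure a x) = ?f (a, x))" for a x
  proof (intro conjI impI)
    have bal: "pure (s \<odot>\<^bsub>A\<^esub> a) (b \<otimes>\<^bsub>R\<^esub> r) = pure a (s \<otimes>\<^bsub>R\<^esub> b \<otimes>\<^bsub>R\<^esub> r)"
      if "s \<in> S" "a \<in> carrier A" "b \<in> carrier R" for s a b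
      using that r S_subset pure_tensor_balanced[of s "R\<lparr>carrier := S\<rparr>" a A "b \<otimes>\<^bsub>R\<^esub> r" "regular_algebra R"]
      by (auto simp: ract_closed base.m_assoc subsetD)
    note te = tensor_extend[where G=T and f = ?f and S="R\<lparr>carrier := S\<rparr>" and A=A and B="regular_algebra R",
        OF tensor_product_abelian]
    show "extend_hom T ?f \<in> add_hom T T"
      by (rule te(1)) (use r S_subset in \<open>auto simp: pure_tensor_closed pure_tensor_add_l pure_tensor_add_r
          base.l_distr[of _ _ r] bal pure_tensor_add_r[where B="regular_algebra R", simplified]\<close>)
    show "extend_hom T ?f (pure a x) = ?f (a, x)" if "a \<in> carrier A" "x \<in> carrier R"
      by (rule te(2)) (use r that S_subset in \<open>auto simp: pure_tensor_closed pure_tensor_add_l pure_tensor_add_r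
          base.l_distr[of _ _ r] bal pure_tensor_add_r[where B="regular_algebra R", simplified]\<close>)
  qed
  show ?A using * by (simp add: sm)
  show ?B if "a \<in> carrier A" "x \<in> carrier R" using * that by (simp add: sm)
qed

lemma Ind_abelian: "abelian_group Ind"
  using tensor_product_abelian[of "R\<lparr>carrier := S\<rparr>" A "regular_algebra R"]
  by (simp add: abelian_group_def abelian_monoid_def abelian_group_axioms_def)

lemma Ind_hom_eq:
  assumes "abelian_group G" "f \<in> add_hom Ind G" "g \<in> add_hom Ind G"
    and "\<And>a b. a \<in> carrier A \<Longrightarrow> b \<in> carrier R \<Longrightarrow> f (pure a b) = g (pure a b)"
    and "x \<in> carrier Ind"
  shows "f x = g x"
  using assms tensor_hom_eq[of G f "R\<lparr>carrier := S\<rparr>" A "regular_algebra R" g x] by simp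

lemma pure_closed: "a \<in> carrier A \<Longrightarrow> x \<in> carrier R \<Longrightarrow> pure a x \<in> carrier T"
  by (simp add: pure_tensor_closed)

text \<open>The scalar laws other than closure and additivity in the vector are equalities of
  additive maps, and these can be tested on pure tensors.\<close>

lemma Ind_module: "right_module R Ind"
proof -
  interpret I: abelian_group Ind by (rule Ind_abelian)
  have h: "(\<lambda>x. x) \<in> add_hom Ind Ind" by (auto simp: hom_def)
  have sum: "(\<lambda>x. f x \<oplus>\<^bsub>Ind\<^esub> g x) \<in> add_hom Ind Ind" if "f \<in> add_hom Ind Ind" "g \<in> add_hom Ind Ind" for f g
    by (intro add_homI) (simp_all add: add_hom_closed[OF that(1)] add_hom_closed[OF that(2)]
      add_hom_add[OF that(1)] add_hom_add[OF that(2)] I.a_ac del: Ind_simps Ind_add_monoid)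
  have act: "(\<lambda>x. r \<odot>\<^bsub>Ind\<^esub> x) \<in> add_hom Ind Ind" if "r \<in> carrier R" for r
    using act_hom[OF that] by simp
  show ?thesis
  proof (unfold_locales, goal_cases)
    case (1 r x) then show ?case by (rule add_hom_closed[OF act])
  next
    case (2 r s x)
    show ?case
      by (rule Ind_hom_eq[OF Ind_abelian act sum[OF act act] _ 2(3)])
        (use 2 in \<open>simp_all add: act_pure base.r_distr pure_tensor_add_r[where B="regular_algebra R", simplified]\<close>)
  next
    case (3 r x y) then show ?case using add_hom_add[OF act] by blast
  next
    case (4 r s x)
    have c: "(\<lambda>x. s \<odot>\<^bsub>Ind\<^esub> (r \<odot>\<^bsub>Ind\<^esub> x)) \<in> add_hom Ind Ind"
      by (intro add_homI) (simp_all add: add_hom_closed[OF act[OF 4(1)]] add_hom_closed[OF act[OF 4(2)]]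
        add_hom_add[OF act[OF 4(1)]] add_hom_add[OF act[OF 4(2)]] del: Ind_simps Ind_add_monoid)
    show ?case
      by (rule Ind_hom_eq[OF Ind_abelian act c _ 4(3)])
        (use 4 in \<open>simp_all add: act_pure base.m_assoc\<close>)
  next
    case (5 x)
    show ?case
      by (rule Ind_hom_eq[OF Ind_abelian act h _ 5]) (simp_all add: act_pure)
  qed
qed

text \<open>Induction is left adjoint to restriction from \<open>R\<close> to \<open>S\<close>. This
  is the existence half of the adjunction; \<open>right_hom_eq\<close> is the uniqueness
  half.\<close>

lemma Ind_extend:
  fixes P :: "('r, 'p, 'm) module_scheme"
  assumes P: "right_module R P" and f: "f \<in> right_module_hom (R\<lparr>carrier := S\<rparr>) A P"
  obtains F where "F \<in> right_module_hom R Ind P"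
    "\<And>a x. a \<in> carrier A \<Longrightarrow> x \<in> carrier R \<Longrightarrow> F (pure a x) = x \<odot>\<^bsub>P\<^esub> f a"
proof -
  interpret P: right_module R P by fact
  let ?F = "extend_hom P (\<lambda>(a, x). x \<odot>\<^bsub>P\<^esub> f a)"
  note fc = right_module_hom_closed[OF f] and fa = right_module_hom_add[OF f]
    and fs = right_module_homD(2)[OF f]
  note te = tensor_extend[where G=P and f = "\<lambda>(a, x). x \<odot>\<^bsub>P\<^esub> f a" and S="R\<lparr>carrier := S\<rparr>" and A=A and B="regular_algebra R",
        OF P.P.abelian_group_axioms]
  have 1: "?F \<in> add_hom Ind P"
    unfolding Ind_add_monoid
    by (rule te(1)) (use S_subset in \<open>auto simp: fc fa fs P.ract_closed P.ract_add P.ract_add_scalar P.ract_mult[symmetric] subsetD\<close>)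
  have 2: "?F (pure a x) = x \<odot>\<^bsub>P\<^esub> f a" if "a \<in> carrier A" "x \<in> carrier R" for a x
    by (subst te(2)) (use that S_subset in \<open>auto simp: fc fa fs P.ract_closed P.ract_add P.ract_add_scalar P.ract_mult[symmetric] subsetD\<close>)
  interpret I: right_module R Ind by (rule Ind_module)
  have "?F (r \<odot>\<^bsub>Ind\<^esub> x) = r \<odot>\<^bsub>P\<^esub> ?F x" if "r \<in> carrier R" "x \<in> carrier Ind" for r x
  proof (rule Ind_hom_eq[OF P.P.abelian_group_axioms _ _ _ that(2)])
    show "(\<lambda>a. ?F (r \<odot>\<^bsub>Ind\<^esub> a)) \<in> add_hom Ind P"
      using that 1 by (intro add_homI)
       (simp_all add: add_hom_closed[OF 1] add_hom_add[OF 1] I.ract_closed I.ract_add del: Ind_simps Ind_add_monoid)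
    show "(\<lambda>a. r \<odot>\<^bsub>P\<^esub> ?F a) \<in> add_hom Ind P"
      using that 1 by (intro add_homI)
       (simp_all add: add_hom_closed[OF 1] add_hom_add[OF 1] P.ract_closed P.ract_add del: Ind_simps Ind_add_monoid)
  qed (use that in \<open>simp add: act_pure 2 P.ract_mult fc\<close>)
  with 1 2 show ?thesis by (intro that[of ?F] right_module_homI)
qed

text \<open>The tensors a \<otimes> 1 generate the induced module over \<open>R\<close>, because a
  \<otimes> b arises from a \<otimes> 1 by the action of b.\<close>

lemma right_hom_eq:
  assumes "right_module R P" "f \<in> right_module_hom R Ind P" "g \<in> right_module_hom R Ind P"
    and "\<And>a. a \<in> carrier A \<Longrightarrow> f (pure a \<one>\<^bsub>R\<^esub>) = g (pure a \<one>\<^bsub>R\<^esub>)"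
    and "x \<in> carrier Ind"
  shows "f x = g x"
proof (rule Ind_hom_eq[OF right_module_abelian[OF assms(1)] right_module_homD(1)[OF assms(2)] right_module_homD(1)[OF assms(3)] _ assms(5)])
  fix a b assume ab: "a \<in> carrier A" "b \<in> carrier R"
  then have eq: "pure a b = b \<odot>\<^bsub>Ind\<^esub> pure a \<one>\<^bsub>R\<^esub>" by (simp add: act_pure)
  show "f (pure a b) = g (pure a b)"
    unfolding eq using ab assms(4)
    by (simp add: right_module_homD(2)[OF assms(2)] right_module_homD(2)[OF assms(3)] pure_closed)
qed

end

section \<open>Relative projectivity and comparison of resolutions\<close>

text \<open>Supplies the complement of a retract, the augmentation ideal and, as the kernel of the
  identity, the zero module.\<close>

lemma right_module_kernel:
  assumes "right_module R P" "right_module R L" "f \<in> right_module_hom R P L"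
  shows "right_module R (P\<lparr>carrier := {x \<in> carrier P. f x = \<zero>\<^bsub>L\<^esub>}\<rparr>)" (is "right_module R ?K")
proof -
  interpret P: right_module R P by fact
  interpret L: right_module R L by fact
  note f = right_module_hom_closed[OF assms(3)] right_module_hom_add[OF assms(3)]
    right_module_homD(2)[OF assms(3)]
    right_module_hom_minus[OF assms(3) P.P.abelian_group_axioms L.P.abelian_group_axioms]
    right_module_hom_zero[OF assms(3) P.P.abelian_group_axioms L.P.abelian_group_axioms]
  have z: "r \<odot>\<^bsub>L\<^esub> \<zero>\<^bsub>L\<^esub> = \<zero>\<^bsub>L\<^esub>" if "r \<in> carrier R" for r
    using that f(3)[OF that P.P.zero_closed] L.ract_closed[OF that L.P.zero_closed]
      L.ract_add[OF that L.P.zero_closed L.P.zero_closed] L.P.add.l_cancel_one by fastforce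
  have "abelian_group ?K"
  proof (rule abelian_groupI)
    fix x assume "x \<in> carrier ?K"
    then show "\<exists>y\<in>carrier ?K. y \<oplus>\<^bsub>?K\<^esub> x = \<zero>\<^bsub>?K\<^esub>"
      using f by (intro bexI[of _ "\<ominus>\<^bsub>P\<^esub> x"]) (auto simp: P.P.l_neg)
  qed (auto simp: f P.P.a_ac)
  then interpret K: abelian_group ?K .
  show ?thesis
    by unfold_locales
      (simp_all add: f z P.ract_closed P.ract_add_scalar P.ract_add P.ract_mult P.ract_one)
qed

text \<open>A retract is a direct summand: the kernel of \<open>r\<close> is a complement, through
  the decomposition w = h (r w) + (w - h (r w)).\<close>

lemma rel_projectiveI:
  fixes P :: "('r, 'p) module" and A :: "('r, 'a) module"
  assumes P: "right_module R P" and A: "right_module (R\<lparr>carrier := S\<rparr>) A" and S: "S \<subseteq> carrier R"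
    and h: "h \<in> right_module_hom R P (induced_module R S A)"
    and r: "r \<in> right_module_hom R (induced_module R S A) P"
    and rh: "\<And>x. x \<in> carrier P \<Longrightarrow> r (h x) = x"
  shows "rel_projective TYPE('a) R S P"
proof -
  interpret P: right_module R P by fact
  interpret induced R S A
    using A S P by (simp add: induced_def induced_axioms_def right_module_def)
  interpret I: right_module R Ind by (rule Ind_module)
  let ?Q = "{x \<in> carrier Ind. r x = \<zero>\<^bsub>P\<^esub>}"
  note hc = right_module_hom_closed[OF h] and rc = right_module_hom_closed[OF r]
  have inj: "inj_on h (carrier P)" using rh by (metis inj_onI)
  have h0: "h \<zero>\<^bsub>P\<^esub> = \<zero>\<^bsub>Ind\<^esub>"
    by (rule right_module_hom_zero[OF h P.P.abelian_group_axioms I.P.abelian_group_axioms])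
  have r0: "r \<zero>\<^bsub>Ind\<^esub> = \<zero>\<^bsub>P\<^esub>"
    by (rule right_module_hom_zero[OF r I.P.abelian_group_axioms P.P.abelian_group_axioms])
  have z: "\<zero>\<^bsub>Ind\<^esub> \<in> ?Q" using r0 I.P.zero_closed by blast
  have "\<zero>\<^bsub>Ind\<^esub> \<in> h ` carrier P" using imageI[OF P.P.zero_closed, of h] by (simp only: h0)
  then have 1: "h ` carrier P \<inter> ?Q = {\<zero>\<^bsub>Ind\<^esub>}"
  proof (intro equalityI subsetI)
    fix w assume "w \<in> h ` carrier P \<inter> ?Q"
    then obtain p where p: "p \<in> carrier P" "w = h p" "r w = \<zero>\<^bsub>P\<^esub>" by blast
    then have "p = \<zero>\<^bsub>P\<^esub>" using rh by simp
    with p show "w \<in> {\<zero>\<^bsub>Ind\<^esub>}" using h0 by simp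
  qed (use z in simp)
  have 2: "h ` carrier P <+>\<^bsub>Ind\<^esub> ?Q = carrier Ind"
  proof
    show "h ` carrier P <+>\<^bsub>Ind\<^esub> ?Q \<subseteq> carrier Ind"
    proof
      fix w assume "w \<in> h ` carrier P <+>\<^bsub>Ind\<^esub> ?Q"
      then obtain p q where "p \<in> carrier P" "q \<in> carrier Ind" "w = h p \<oplus>\<^bsub>Ind\<^esub> q"
        unfolding set_add_def' by blast
      then show "w \<in> carrier Ind" using hc[of p] I.P.a_closed[of "h p" q] by simp
    qed
    show "carrier Ind \<subseteq> h ` carrier P <+>\<^bsub>Ind\<^esub> ?Q"
    proof
      fix w assume w: "w \<in> carrier Ind"
      let ?q = "\<ominus>\<^bsub>Ind\<^esub> h (r w) \<oplus>\<^bsub>Ind\<^esub> w"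
      have q: "?q \<in> carrier Ind" using w hc rc by (simp del: Ind_simps)
      have "r ?q = \<ominus>\<^bsub>P\<^esub> r w \<oplus>\<^bsub>P\<^esub> r w"
        using w hc rc rh
        by (simp add: right_module_hom_add[OF r] right_module_hom_minus[OF r I.P.abelian_group_axioms P.P.abelian_group_axioms]
            del: Ind_simps)
      then have "?q \<in> ?Q" using q w rc by (simp add: P.P.l_neg del: Ind_simps)
      moreover have "w = h (r w) \<oplus>\<^bsub>Ind\<^esub> ?q"
        using w hc rc by (simp add: I.P.r_neg2 del: Ind_simps)
      ultimately show "w \<in> h ` carrier P <+>\<^bsub>Ind\<^esub> ?Q"
        using rc[OF w] unfolding set_add_def' by blast
    qed
  qed
  have "?Q \<subseteq> carrier Ind" by blast
  with A h inj 1 2 right_module_kernel[OF Ind_module P r]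
  have "\<exists>h Q. right_module (R\<lparr>carrier := S\<rparr>) A \<and> h \<in> right_module_hom R P Ind \<and>
      inj_on h (carrier P) \<and> Q \<subseteq> carrier Ind \<and> right_module R (Ind\<lparr>carrier := Q\<rparr>) \<and>
      h ` carrier P \<inter> Q = {\<zero>\<^bsub>Ind\<^esub>} \<and> h ` carrier P <+>\<^bsub>Ind\<^esub> Q = carrier Ind"
    by (intro exI[of _ h] exI[of _ ?Q]) (intro conjI)
  with P show ?thesis
    unfolding rel_projective_def by (intro conjI exI[of _ A])
qed

text \<open>On an induced module, follow the map by the \<open>S\<close>-linear \<open>s\<close> and
  extend the result \<open>R\<close>-linearly; the projection to a summand passes the lift on. The
  splitting \<open>ds\<close> is asked for on the image of \<open>f\<close> only, because the
  contraction of a complex splits the differential on cycles and not everywhere.\<close>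

lemma rel_projective_lift:
  fixes ty :: "'a itself" and P :: "('r, 'p) module"
  assumes rp: "rel_projective ty R S P" and S: "S \<subseteq> carrier R"
    and B: "right_module R B" and C: "right_module R C"
    and d: "d \<in> right_module_hom R B C" and f: "f \<in> right_module_hom R P C"
    and s: "s \<in> right_module_hom (R\<lparr>carrier := S\<rparr>) C B"
    and ds: "\<And>x. x \<in> carrier P \<Longrightarrow> d (s (f x)) = f x"
  obtains h where "h \<in> right_module_hom R P B" "\<And>x. x \<in> carrier P \<Longrightarrow> d (h x) = f x"
proof -
  obtain A :: "('r, 'a) module" and h Q where P: "right_module R P" and A: "right_module (R\<lparr>carrier := S\<rparr>) A"
    and h: "h \<in> right_module_hom R P (induced_module R S A)" and inj: "inj_on h (carrier P)"
    and Q: "Q \<subseteq> carrier (induced_module R S A)"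
    and QM: "right_module R ((induced_module R S A)\<lparr>carrier := Q\<rparr>)"
    and int: "h ` carrier P \<inter> Q = {\<zero>\<^bsub>induced_module R S A\<^esub>}"
    and sum: "h ` carrier P <+>\<^bsub>induced_module R S A\<^esub> Q = carrier (induced_module R S A)"
    using rp unfolding rel_projective_def by (elim conjE exE) (rule that)
  interpret P: right_module R P by fact
  interpret B: right_module R B by fact
  interpret C: right_module R C by fact
  interpret induced R S A
    using A S P by (simp add: induced_def induced_axioms_def right_module_def)
  interpret I: right_module R Ind by (rule Ind_module)
  interpret Q: right_module R "Ind\<lparr>carrier := Q\<rparr>" by fact
  note hc = right_module_hom_closed[OF h]
  have Qadd: "x \<oplus>\<^bsub>Ind\<^esub> y \<in> Q" if "x \<in> Q" "y \<in> Q" for x y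
    using Q.P.a_closed that by simp
  \<comment> \<open>The negative in the record with carrier \<open>Q\<close> is a priori a different
    operation; uniqueness of negatives in \<open>Ind\<close> identifies the two.\<close>
  have Qminus: "\<ominus>\<^bsub>Ind\<^esub> x \<in> Q" if "x \<in> Q" for x
  proof -
    let ?y = "\<ominus>\<^bsub>Ind\<lparr>carrier := Q\<rparr>\<^esub> x"
    have y: "?y \<in> Q" "?y \<oplus>\<^bsub>Ind\<^esub> x = \<zero>\<^bsub>Ind\<^esub>"
      using Q.P.a_inv_closed[of x] Q.P.l_neg[of x] that by simp_all
    have "\<ominus>\<^bsub>Ind\<^esub> x = ?y"
      using I.P.minus_equality[OF y(2)] that y(1) Q by blast
    then show ?thesis using y(1) by simp
  qed
  have Qact: "r \<odot>\<^bsub>Ind\<^esub> x \<in> Q" if "x \<in> Q" "r \<in> carrier R" for x r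
    using Q.ract_closed that by simp
  \<comment> \<open>The difference of two decompositions of one element lies in both summands, whose
    intersection is zero.\<close>
  have uniq: "p = p'" if p: "p \<in> carrier P" "p' \<in> carrier P" "q \<in> Q" "q' \<in> Q"
    and eq: "h p \<oplus>\<^bsub>Ind\<^esub> q = h p' \<oplus>\<^bsub>Ind\<^esub> q'" for p p' q q'
  proof -
    have qc: "q \<in> carrier Ind" "q' \<in> carrier Ind" using p Q by blast+
    have "h (p \<ominus>\<^bsub>P\<^esub> p') = q' \<oplus>\<^bsub>Ind\<^esub> \<ominus>\<^bsub>Ind\<^esub> q"
    proof -
      have "h (p \<ominus>\<^bsub>P\<^esub> p') = h p \<oplus>\<^bsub>Ind\<^esub> \<ominus>\<^bsub>Ind\<^esub> h p'"
        using p by (simp add: a_minus_def right_module_hom_add[OF h]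
            right_module_hom_minus[OF h P.P.abelian_group_axioms I.P.abelian_group_axioms] del: Ind_simps)
      also have "\<dots> = \<ominus>\<^bsub>Ind\<^esub> h p' \<oplus>\<^bsub>Ind\<^esub> ((h p \<oplus>\<^bsub>Ind\<^esub> q) \<oplus>\<^bsub>Ind\<^esub> \<ominus>\<^bsub>Ind\<^esub> q)"
        using p qc hc I.P.a_comm[of "h p" "\<ominus>\<^bsub>Ind\<^esub> h p'"]
        by (simp add: I.P.a_assoc I.P.r_neg del: Ind_simps)
      also have "\<dots> = q' \<oplus>\<^bsub>Ind\<^esub> \<ominus>\<^bsub>Ind\<^esub> q"
        unfolding eq using p qc hc by (simp add: I.P.a_assoc I.P.r_neg1 del: Ind_simps)
      finally show ?thesis .
    qed
    moreover have "h (p \<ominus>\<^bsub>P\<^esub> p') \<in> h ` carrier P" using p by simp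
    moreover have "q' \<oplus>\<^bsub>Ind\<^esub> \<ominus>\<^bsub>Ind\<^esub> q \<in> Q" using p Qadd Qminus by blast
    ultimately have "h (p \<ominus>\<^bsub>P\<^esub> p') = \<zero>\<^bsub>Ind\<^esub>" using int by (metis IntI singletonD)
    also have "\<dots> = h \<zero>\<^bsub>P\<^esub>"
      using right_module_hom_zero[OF h P.P.abelian_group_axioms I.P.abelian_group_axioms] by simp
    finally have "p \<ominus>\<^bsub>P\<^esub> p' = \<zero>\<^bsub>P\<^esub>" using inj p by (simp add: inj_on_eq_iff)
    moreover have "p = (p \<ominus>\<^bsub>P\<^esub> p') \<oplus>\<^bsub>P\<^esub> p'"
      using p by (simp add: a_minus_def P.P.a_assoc P.P.l_neg)
    ultimately show ?thesis using p by simp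
  qed
  have "\<exists>p. p \<in> carrier P \<and> (\<exists>q\<in>Q. x = h p \<oplus>\<^bsub>Ind\<^esub> q)" if "x \<in> carrier Ind" for x
    using that unfolding sum[symmetric] set_add_def' by blast
  \<comment> \<open>The component in \<open>P\<close> is chosen pointwise; \<open>uniq\<close> is
    what makes the choice a homomorphism.\<close>
  then obtain \<pi> where \<pi>: "\<And>x. x \<in> carrier Ind \<Longrightarrow> \<pi> x \<in> carrier P \<and> (\<exists>q\<in>Q. x = h (\<pi> x) \<oplus>\<^bsub>Ind\<^esub> q)"
    by metis
  have \<pi>_eq: "\<pi> (h p \<oplus>\<^bsub>Ind\<^esub> q) = p" if "p \<in> carrier P" "q \<in> Q" for p q
  proof -
    have "h p \<oplus>\<^bsub>Ind\<^esub> q \<in> carrier Ind" using that Q hc by (auto simp del: Ind_simps)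
    then obtain q' where "q' \<in> Q" "h p \<oplus>\<^bsub>Ind\<^esub> q = h (\<pi> (h p \<oplus>\<^bsub>Ind\<^esub> q)) \<oplus>\<^bsub>Ind\<^esub> q'"
      "\<pi> (h p \<oplus>\<^bsub>Ind\<^esub> q) \<in> carrier P" using \<pi> by blast
    then show ?thesis using uniq that by metis
  qed
  have \<pi>h: "\<pi> (h p) = p" if "p \<in> carrier P" for p
  proof -
    have "\<zero>\<^bsub>Ind\<^esub> \<in> Q" using int by blast
    then show ?thesis using \<pi>_eq[OF that, of "\<zero>\<^bsub>Ind\<^esub>"] that hc by (simp del: Ind_simps)
  qed
  have \<pi>_hom: "\<pi> \<in> right_module_hom R Ind P"
  proof (intro right_module_homI add_homI)
    show "\<pi> x \<in> carrier P" if "x \<in> carrier Ind" for x using \<pi> that by blast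
    show "\<pi> (x \<oplus>\<^bsub>Ind\<^esub> y) = \<pi> x \<oplus>\<^bsub>P\<^esub> \<pi> y" if xy: "x \<in> carrier Ind" "y \<in> carrier Ind" for x y
    proof -
      obtain q where q: "q \<in> Q" "x = h (\<pi> x) \<oplus>\<^bsub>Ind\<^esub> q" using \<pi> xy by blast
      obtain q' where q': "q' \<in> Q" "y = h (\<pi> y) \<oplus>\<^bsub>Ind\<^esub> q'" using \<pi> xy by blast
      have c: "\<pi> x \<in> carrier P" "\<pi> y \<in> carrier P" "q \<in> carrier Ind" "q' \<in> carrier Ind"
        using \<pi> xy q(1) q'(1) Q by blast+
      have "x \<oplus>\<^bsub>Ind\<^esub> y = (h (\<pi> x) \<oplus>\<^bsub>Ind\<^esub> q) \<oplus>\<^bsub>Ind\<^esub> (h (\<pi> y) \<oplus>\<^bsub>Ind\<^esub> q')" using q q' by simp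
      also have "\<dots> = h (\<pi> x \<oplus>\<^bsub>P\<^esub> \<pi> y) \<oplus>\<^bsub>Ind\<^esub> (q \<oplus>\<^bsub>Ind\<^esub> q')"
        using c hc by (simp add: right_module_hom_add[OF h] I.P.a_ac del: Ind_simps)
      finally show ?thesis using \<pi>_eq[of "\<pi> x \<oplus>\<^bsub>P\<^esub> \<pi> y" "q \<oplus>\<^bsub>Ind\<^esub> q'"] c Qadd q(1) q'(1)
        by (simp del: Ind_simps)
    qed
    show "\<pi> (r \<odot>\<^bsub>Ind\<^esub> x) = r \<odot>\<^bsub>P\<^esub> \<pi> x" if xy: "r \<in> carrier R" "x \<in> carrier Ind" for x r
    proof -
      obtain q where q: "q \<in> Q" "x = h (\<pi> x) \<oplus>\<^bsub>Ind\<^esub> q" using \<pi> xy by blast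
      have c: "\<pi> x \<in> carrier P" "q \<in> carrier Ind" using \<pi> xy q(1) Q by blast+
      have "r \<odot>\<^bsub>Ind\<^esub> x = r \<odot>\<^bsub>Ind\<^esub> (h (\<pi> x) \<oplus>\<^bsub>Ind\<^esub> q)" using q by simp
      also have "\<dots> = h (r \<odot>\<^bsub>P\<^esub> \<pi> x) \<oplus>\<^bsub>Ind\<^esub> (r \<odot>\<^bsub>Ind\<^esub> q)"
        using c xy hc by (simp add: right_module_homD(2)[OF h] I.ract_add del: Ind_simps)
      finally show ?thesis using \<pi>_eq[of "r \<odot>\<^bsub>P\<^esub> \<pi> x" "r \<odot>\<^bsub>Ind\<^esub> q"] c Qact q(1) xy P.ract_closed
        by (simp del: Ind_simps)
    qed
  qed
  note f\<pi> = right_module_hom_comp[OF \<pi>_hom f]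
  \<comment> \<open>The lift is prescribed on the elements a \<otimes> 1 alone, where linearity over
    \<open>S\<close> suffices; this is all that \<open>s\<close> has.\<close>
  let ?k = "\<lambda>a. s (f (\<pi> (pure a \<one>\<^bsub>R\<^esub>)))"
  have "(\<lambda>a. pure a \<one>\<^bsub>R\<^esub>) \<in> right_module_hom (R\<lparr>carrier := S\<rparr>) A Ind"
  proof (intro right_module_homI add_homI)
    fix r x assume "r \<in> carrier (R\<lparr>carrier := S\<rparr>)" "x \<in> carrier A"
    then show "pure (r \<odot>\<^bsub>A\<^esub> x) \<one>\<^bsub>R\<^esub> = r \<odot>\<^bsub>Ind\<^esub> pure x \<one>\<^bsub>R\<^esub>"
      using S ract_closed[of r x] pure_tensor_balanced[of r "R\<lparr>carrier := S\<rparr>" x A "\<one>\<^bsub>R\<^esub>" "regular_algebra R"]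
      by (auto simp: act_pure subsetD)
  qed (simp_all add: pure_closed pure_tensor_add_l)
  moreover have "(\<lambda>x. f (\<pi> x)) \<in> right_module_hom (R\<lparr>carrier := S\<rparr>) Ind C"
    using f\<pi> S by (auto simp: right_module_hom_def)
  ultimately have k: "?k \<in> right_module_hom (R\<lparr>carrier := S\<rparr>) A B"
    by (rule right_module_hom_comp[OF right_module_hom_comp s])
  obtain F where F: "F \<in> right_module_hom R Ind B"
    "\<And>a x. a \<in> carrier A \<Longrightarrow> x \<in> carrier R \<Longrightarrow> F (pure a x) = x \<odot>\<^bsub>B\<^esub> ?k a"
    using Ind_extend[OF B k] by blast
  have dF: "d (F x) = f (\<pi> x)" if "x \<in> carrier Ind" for x
  proof (rule right_hom_eq[OF C right_module_hom_comp[OF F(1) d] f\<pi> _ that])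
    fix a assume a: "a \<in> carrier A"
    then have "\<pi> (pure a \<one>\<^bsub>R\<^esub>) \<in> carrier P" using \<pi> by (simp add: pure_closed)
    then show "d (F (pure a \<one>\<^bsub>R\<^esub>)) = f (\<pi> (pure a \<one>\<^bsub>R\<^esub>))"
      using a F(2) right_module_hom_closed[OF k a] by (simp add: B.ract_one ds)
  qed
  show ?thesis
    by (rule that[OF right_module_hom_comp[OF h F(1)]]) (simp add: dF \<pi>h hc del: Ind_simps)
qed

section \<open>Comparison of resolutions\<close>

lemma resolutionD:
  assumes "rel_projective_resolution ty R S M P d e"
  shows "rel_projective ty R S (P n)"
    and "d n \<in> right_module_hom R (P (Suc n)) (P n)"
    and "e \<in> right_module_hom R (P 0) M"
    and "x \<in> carrier (P (Suc (Suc n))) \<Longrightarrow> d n (d (Suc n) x) = \<zero>\<^bsub>P n\<^esub>"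
    and "x \<in> carrier (P (Suc 0)) \<Longrightarrow> e (d 0 x) = \<zero>\<^bsub>M\<^esub>"
  using assms by (simp_all add: rel_projective_resolution_def)

lemma resolution_contraction:
  assumes "rel_projective_resolution ty R S M P d e"
  obtains \<sigma> s where "\<sigma> \<in> right_module_hom (R\<lparr>carrier := S\<rparr>) M (P 0)"
    "\<And>n. s n \<in> right_module_hom (R\<lparr>carrier := S\<rparr>) (P n) (P (Suc n))"
    "\<And>y. y \<in> carrier M \<Longrightarrow> e (\<sigma> y) = y"
    "\<And>x. x \<in> carrier (P 0) \<Longrightarrow> d 0 (s 0 x) \<oplus>\<^bsub>P 0\<^esub> \<sigma> (e x) = x"
    "\<And>n x. x \<in> carrier (P (Suc n)) \<Longrightarrow>
       d (Suc n) (s (Suc n) x) \<oplus>\<^bsub>P (Suc n)\<^esub> s n (d n x) = x"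
  using assms unfolding rel_projective_resolution_def
  by (elim conjE exE, goal_cases) (metis (no_types, lifting))

lemma rel_projective_right_module: "rel_projective ty R S P \<Longrightarrow> right_module R P"
  by (simp add: rel_projective_def)

lemma right_module_hom_id_diff:
  assumes "right_module R P" "f \<in> right_module_hom R P P"
  shows "(\<lambda>x. x \<ominus>\<^bsub>P\<^esub> f x) \<in> right_module_hom R P P"
proof -
  have "(\<lambda>x. x) \<in> right_module_hom R P P" by (auto simp: right_module_hom_def hom_def)
  then show ?thesis using right_module_hom_diff assms by blast
qed

text \<open>
  The identity of \<open>P\<close> is homotopic to a map that factors through the resolution \<open>B1 \<rightarrow> B0\<close>, which
  is zero in degree two.
\<close>

lemma resolution_homotopy:
  fixes P :: "nat \<Rightarrow> ('r, 'p) module" and B0 B1 :: "('r, 'b) module"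
  assumes res: "rel_projective_resolution ty R S M P d e"
    and M: "right_module R M" and S: "S \<subseteq> carrier R"
    and B0: "rel_projective tb R S B0" and B1: "rel_projective tb R S B1"
    and \<delta>: "\<delta> \<in> right_module_hom R B1 B0" and \<epsilon>: "\<epsilon> \<in> right_module_hom R B0 M"
    and \<epsilon>\<delta>: "\<And>x. x \<in> carrier B1 \<Longrightarrow> \<epsilon> (\<delta> x) = \<zero>\<^bsub>M\<^esub>"
    and \<tau>: "\<tau> \<in> right_module_hom (R\<lparr>carrier := S\<rparr>) M B0"
    and t: "t \<in> right_module_hom (R\<lparr>carrier := S\<rparr>) B0 B1"
    and \<epsilon>\<tau>: "\<And>y. y \<in> carrier M \<Longrightarrow> \<epsilon> (\<tau> y) = y"
    and \<delta>t: "\<And>x. x \<in> carrier B0 \<Longrightarrow> \<delta> (t x) \<oplus>\<^bsub>B0\<^esub> \<tau> (\<epsilon> x) = x"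
    and t\<delta>: "\<And>x. x \<in> carrier B1 \<Longrightarrow> t (\<delta> x) = x"
  obtains h1 h2 where "h1 \<in> right_module_hom R (P 1) (P 2)" "h2 \<in> right_module_hom R (P 2) (P 3)"
    "\<And>x. x \<in> carrier (P 2) \<Longrightarrow> d 2 (h2 x) \<oplus>\<^bsub>P 2\<^esub> h1 (d 1 x) = x"
proof -
  note rP = resolutionD(1)[OF res] and d = resolutionD(2)[OF res] and e = resolutionD(3)[OF res]
    and dd = resolutionD(4)[OF res] and ed = resolutionD(5)[OF res]
  obtain \<sigma> s where \<sigma>: "\<sigma> \<in> right_module_hom (R\<lparr>carrier := S\<rparr>) M (P 0)"
    and s: "\<And>n. s n \<in> right_module_hom (R\<lparr>carrier := S\<rparr>) (P n) (P (Suc n))"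
    and e\<sigma>: "\<And>y. y \<in> carrier M \<Longrightarrow> e (\<sigma> y) = y"
    and ds0: "\<And>x. x \<in> carrier (P 0) \<Longrightarrow> d 0 (s 0 x) \<oplus>\<^bsub>P 0\<^esub> \<sigma> (e x) = x"
    and ds: "\<And>n x. x \<in> carrier (P (Suc n)) \<Longrightarrow>
       d (Suc n) (s (Suc n) x) \<oplus>\<^bsub>P (Suc n)\<^esub> s n (d n x) = x"
    using resolution_contraction[OF res] by blast
  note Pm = rel_projective_right_module[OF rP]
  note B0m = rel_projective_right_module[OF B0] and B1m = rel_projective_right_module[OF B1]
  note Pa = right_module_abelian[OF Pm] and B0a = right_module_abelian[OF B0m]
    and B1a = right_module_abelian[OF B1m] and Ma = right_module_abelian[OF M]
  \<comment> \<open>On cycles the contraction is a section of the differential, which is the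
    splitting that \<open>rel_projective_lift\<close> asks for.\<close>
  have ds1: "d (Suc n) (s (Suc n) x) = x" if "x \<in> carrier (P (Suc n))" "d n x = \<zero>\<^bsub>P n\<^esub>" for n x
  proof -
    interpret p: abelian_group "P (Suc n)" by (rule Pa)
    show ?thesis using ds[OF that(1)] that right_module_hom_zero[OF s Pa Pa]
        right_module_hom_closed[OF d right_module_hom_closed[OF s that(1)]] by simp
  qed
  have ds2: "d 0 (s 0 x) = x" if "x \<in> carrier (P 0)" "e x = \<zero>\<^bsub>M\<^esub>" for x
  proof -
    interpret p: abelian_group "P 0" by (rule Pa)
    show ?thesis using ds0[OF that(1)] that right_module_hom_zero[OF \<sigma> Ma Pa]
        right_module_hom_closed[OF d right_module_hom_closed[OF s that(1)]] by simp
  qed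
  have \<delta>t1: "\<delta> (t x) = x" if "x \<in> carrier B0" "\<epsilon> x = \<zero>\<^bsub>M\<^esub>" for x
  proof -
    interpret p: abelian_group B0 by (rule B0a)
    show ?thesis using \<delta>t[OF that(1)] that right_module_hom_zero[OF \<tau> Ma B0a]
        right_module_hom_closed[OF \<delta> right_module_hom_closed[OF t that(1)]] by simp
  qed
  have ec: "e x \<in> carrier M" if "x \<in> carrier (P 0)" for x by (rule right_module_hom_closed[OF e that])
  have dc: "d n x \<in> carrier (P n)" if "x \<in> carrier (P (Suc n))" for n x by (rule right_module_hom_closed[OF d that])
  have \<epsilon>c: "\<epsilon> x \<in> carrier M" if "x \<in> carrier B0" for x by (rule right_module_hom_closed[OF \<epsilon> that])
  have \<delta>c: "\<delta> x \<in> carrier B0" if "x \<in> carrier B1" for x by (rule right_module_hom_closed[OF \<delta> that])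
  \<comment> \<open>\<open>f0\<close>, \<open>f1\<close> lead from \<open>P\<close> to the small
    resolution and \<open>g0\<close>, \<open>g1\<close> back, both over the identity of
    \<open>M\<close>; \<open>h0\<close>, \<open>h1\<close>, \<open>h2\<close> form the
    homotopy.\<close>
  obtain f0 where f0: "f0 \<in> right_module_hom R (P 0) B0" "\<And>x. x \<in> carrier (P 0) \<Longrightarrow> \<epsilon> (f0 x) = e x"
    using rel_projective_lift[OF rP S B0m M \<epsilon> e \<tau> \<epsilon>\<tau>[OF ec]] by blast
  note f0c = right_module_hom_closed[OF f0(1)]
  have f0d: "(\<lambda>x. f0 (d 0 x)) \<in> right_module_hom R (P (Suc 0)) B0"
    by (rule right_module_hom_comp[OF d f0(1)])
  have \<epsilon>f0d: "\<epsilon> (f0 (d 0 x)) = \<zero>\<^bsub>M\<^esub>" if "x \<in> carrier (P (Suc 0))" for x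
    using that by (simp add: f0(2) dc ed)
  obtain f1 where f1: "f1 \<in> right_module_hom R (P (Suc 0)) B1"
    "\<And>x. x \<in> carrier (P (Suc 0)) \<Longrightarrow> \<delta> (f1 x) = f0 (d 0 x)"
    using rel_projective_lift[OF rP S B1m B0m \<delta> f0d t \<delta>t1[OF f0c[OF dc] \<epsilon>f0d]] by blast
  note f1c = right_module_hom_closed[OF f1(1)]
  \<comment> \<open>The small resolution ends in degree one because \<delta> is injective, with left
    inverse \<open>t\<close>. So \<open>f1\<close> kills boundaries, and there is no
    \<open>f2\<close> to construct.\<close>
  have f1d: "f1 (d (Suc 0) x) = \<zero>\<^bsub>B1\<^esub>" if x: "x \<in> carrier (P (Suc (Suc 0)))" for x
  proof -
    have "f1 (d (Suc 0) x) = t (\<delta> (f1 (d (Suc 0) x)))" using x by (simp add: t\<delta> f1c dc)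
    also have "\<dots> = t (f0 \<zero>\<^bsub>P 0\<^esub>)" using x by (simp add: f1(2) dc dd)
    also have "\<dots> = \<zero>\<^bsub>B1\<^esub>"
      using right_module_hom_zero[OF f0(1) Pa B0a] right_module_hom_zero[OF t B0a B1a] by simp
    finally show ?thesis .
  qed
  obtain g0 where g0: "g0 \<in> right_module_hom R B0 (P 0)" "\<And>x. x \<in> carrier B0 \<Longrightarrow> e (g0 x) = \<epsilon> x"
    using rel_projective_lift[OF B0 S Pm M e \<epsilon> \<sigma> e\<sigma>[OF \<epsilon>c]] by blast
  note g0c = right_module_hom_closed[OF g0(1)]
  have g0\<delta>: "(\<lambda>x. g0 (\<delta> x)) \<in> right_module_hom R B1 (P 0)"
    by (rule right_module_hom_comp[OF \<delta> g0(1)])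
  have eg0\<delta>: "e (g0 (\<delta> x)) = \<zero>\<^bsub>M\<^esub>" if "x \<in> carrier B1" for x
    using that by (simp add: g0(2) \<delta>c \<epsilon>\<delta>)
  obtain g1 where g1: "g1 \<in> right_module_hom R B1 (P (Suc 0))"
    "\<And>x. x \<in> carrier B1 \<Longrightarrow> d 0 (g1 x) = g0 (\<delta> x)"
    using rel_projective_lift[OF B1 S Pm Pm d g0\<delta> s ds2[OF g0c[OF \<delta>c] eg0\<delta>]] by blast
  note g1c = right_module_hom_closed[OF g1(1)]
  interpret p0: right_module R "P 0" by (rule Pm)
  interpret p1: right_module R "P (Suc 0)" by (rule Pm)
  interpret p2: right_module R "P (Suc (Suc 0))" by (rule Pm)
  have p1_zero: "\<ominus>\<^bsub>P (Suc 0)\<^esub> \<zero>\<^bsub>P (Suc 0)\<^esub> = \<zero>\<^bsub>P (Suc 0)\<^esub>"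
    by (rule p1.P.minus_equality) simp_all
  interpret m: right_module R M by (rule M)
  let ?u0 = "\<lambda>x. x \<ominus>\<^bsub>P 0\<^esub> g0 (f0 x)"
  have u0: "?u0 \<in> right_module_hom R (P 0) (P 0)"
    by (rule right_module_hom_id_diff[OF Pm right_module_hom_comp[OF f0(1) g0(1)]])
  have eu0: "e (?u0 x) = \<zero>\<^bsub>M\<^esub>" if "x \<in> carrier (P 0)" for x
    using that by (simp add: a_minus_def right_module_hom_add[OF e] right_module_hom_minus[OF e Pa Ma]
        g0c f0c g0(2) f0(2) ec m.P.r_neg)
  obtain h0 where h0: "h0 \<in> right_module_hom R (P 0) (P (Suc 0))"
    "\<And>x. x \<in> carrier (P 0) \<Longrightarrow> d 0 (h0 x) = ?u0 x"
    using rel_projective_lift[OF rP S Pm Pm d u0 s ds2[OF right_module_hom_closed[OF u0] eu0]] by blast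
  note h0c = right_module_hom_closed[OF h0(1)]
  \<comment> \<open>The failure of \<open>h0\<close> to be a homotopy in degree one. It takes values
    in the cycles, so it lifts to degree two.\<close>
  let ?u1 = "\<lambda>x. (x \<ominus>\<^bsub>P (Suc 0)\<^esub> g1 (f1 x)) \<ominus>\<^bsub>P (Suc 0)\<^esub> h0 (d 0 x)"
  have u1: "?u1 \<in> right_module_hom R (P (Suc 0)) (P (Suc 0))"
    by (rule right_module_hom_diff[OF Pm right_module_hom_id_diff[OF Pm right_module_hom_comp[OF f1(1) g1(1)]]
          right_module_hom_comp[OF d h0(1)]])
  have du1: "d 0 (?u1 x) = \<zero>\<^bsub>P 0\<^esub>" if x: "x \<in> carrier (P (Suc 0))" for x
  proof -
    have "d 0 (?u1 x) = d 0 x \<ominus>\<^bsub>P 0\<^esub> g0 (f0 (d 0 x)) \<ominus>\<^bsub>P 0\<^esub> (d 0 x \<ominus>\<^bsub>P 0\<^esub> g0 (f0 (d 0 x)))"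
      using x by (simp add: a_minus_def right_module_hom_add[OF d] right_module_hom_minus[OF d Pa Pa]
          g1c f1c g1(2) f1(2) h0c h0(2) dc)
    then show ?thesis using x by (simp add: a_minus_def g0c f0c dc p0.P.r_neg)
  qed
  obtain h1 where h1: "h1 \<in> right_module_hom R (P (Suc 0)) (P (Suc (Suc 0)))"
    "\<And>x. x \<in> carrier (P (Suc 0)) \<Longrightarrow> d (Suc 0) (h1 x) = ?u1 x"
    using rel_projective_lift[OF rP S Pm Pm d u1 s ds1[OF right_module_hom_closed[OF u1] du1]] by blast
  note h1c = right_module_hom_closed[OF h1(1)]
  \<comment> \<open>No round trip through the small resolution is subtracted in this degree;
    \<open>f1d\<close> makes the values cycles nevertheless.\<close>
  let ?u2 = "\<lambda>x. x \<ominus>\<^bsub>P (Suc (Suc 0))\<^esub> h1 (d (Suc 0) x)"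
  have u2: "?u2 \<in> right_module_hom R (P (Suc (Suc 0))) (P (Suc (Suc 0)))"
    by (rule right_module_hom_id_diff[OF Pm right_module_hom_comp[OF d h1(1)]])
  have du2: "d (Suc 0) (?u2 x) = \<zero>\<^bsub>P (Suc 0)\<^esub>" if x: "x \<in> carrier (P (Suc (Suc 0)))" for x
    using x right_module_hom_zero[OF g1(1) B1a Pa] right_module_hom_zero[OF h0(1) Pa Pa]
    by (simp add: a_minus_def right_module_hom_add[OF d] right_module_hom_minus[OF d Pa Pa]
        h1c dc h1(2) f1d dd p1.P.r_neg p1_zero)
  obtain h2 where h2: "h2 \<in> right_module_hom R (P (Suc (Suc 0))) (P (Suc (Suc (Suc 0))))"
    "\<And>x. x \<in> carrier (P (Suc (Suc 0))) \<Longrightarrow> d (Suc (Suc 0)) (h2 x) = ?u2 x"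
    using rel_projective_lift[OF rP S Pm Pm d u2 s ds1[OF right_module_hom_closed[OF u2] du2]] by blast
  have "d (Suc (Suc 0)) (h2 x) \<oplus>\<^bsub>P (Suc (Suc 0))\<^esub> h1 (d (Suc 0) x) = x" if "x \<in> carrier (P (Suc (Suc 0)))" for x
    using that by (simp add: h2(2) a_minus_def p2.P.a_assoc h1c dc p2.P.l_neg)
  then show ?thesis
    using that[of h1 h2] h1(1) h2(1) unfolding numeral_2_eq_2 numeral_3_eq_3 One_nat_def by blast
qed

section \<open>From a homotopy to vanishing homology of the tensored complex\<close>

lemma tensor_map:
  fixes P Q :: "('r, 'p) module" and N :: "('r, 'n, 'm) module_scheme"
  assumes Q: "right_module R Q" and f: "f \<in> right_module_hom R P Q"
  defines "F \<equiv> extend_hom (tensor_product R Q N) (\<lambda>(p, y). pure_tensor R Q N (f p) y)"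
  shows "F \<in> add_hom (tensor_product R P N) (tensor_product R Q N)"
    and "p \<in> carrier P \<Longrightarrow> y \<in> carrier N \<Longrightarrow> F (pure_tensor R P N p y) = pure_tensor R Q N (f p) y"
proof -
  interpret Q: right_module R Q by fact
  note fc = right_module_hom_closed[OF f]
  note te = tensor_extend[where S=R and A=P and B=N, OF tensor_product_abelian]
  have bal: "pure_tensor R Q N (f (s \<odot>\<^bsub>P\<^esub> a)) b = pure_tensor R Q N (f a) (s \<odot>\<^bsub>N\<^esub> b)"
    if "s \<in> carrier R" "a \<in> carrier P" "b \<in> carrier N" "s \<odot>\<^bsub>N\<^esub> b \<in> carrier N" for s a b
    using that by (simp add: right_module_homD(2)[OF f] pure_tensor_balanced fc Q.ract_closed)
  show "F \<in> add_hom (tensor_product R P N) (tensor_product R Q N)"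
    unfolding F_def
    by (rule te(1))
      (simp_all add: fc right_module_hom_add[OF f] pure_tensor_closed pure_tensor_add_l pure_tensor_add_r bal)
  show "F (pure_tensor R P N p y) = pure_tensor R Q N (f p) y" if "p \<in> carrier P" "y \<in> carrier N"
    unfolding F_def
    by (subst te(2))
      (simp_all add: that fc right_module_hom_add[OF f] pure_tensor_closed pure_tensor_add_l pure_tensor_add_r bal)
qed

text \<open>If the boundaries are all the cycles, then every coset of a cycle is the set of all
  cycles, which is also the unit of the quotient.\<close>

lemma homology_trivial:
  assumes C: "abelian_group (C (Suc n))" and D: "abelian_group (C n)"
    and d: "d n \<in> add_hom (C (Suc n)) (C n)"
    and im: "d (Suc n) ` carrier (C (Suc (Suc n))) = cycles C d (Suc n)"
  shows "carrier (homology C d (Suc n)) = {\<one>\<^bsub>homology C d (Suc n)\<^esub>}"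
proof -
  interpret C: abelian_group "C (Suc n)" by (rule C)
  interpret D: abelian_group "C n" by (rule D)
  let ?Z = "cycles C d (Suc n)"
  have Z: "?Z = {x \<in> carrier (C (Suc n)). d n x = \<zero>\<^bsub>C n\<^esub>}"
    by (simp add: a_kernel_def kernel_def)
  note cycles.simps [simp del]
  have coset: "(\<Union>h\<in>?Z. {h \<oplus>\<^bsub>C (Suc n)\<^esub> x}) = ?Z" if x: "x \<in> ?Z" for x
  proof (intro equalityI subsetI)
    fix y assume "y \<in> (\<Union>h\<in>?Z. {h \<oplus>\<^bsub>C (Suc n)\<^esub> x})"
    then show "y \<in> ?Z" using x by (auto simp: Z add_hom_add[OF d])
  next
    fix y assume y: "y \<in> ?Z"
    have "y \<oplus>\<^bsub>C (Suc n)\<^esub> \<ominus>\<^bsub>C (Suc n)\<^esub> x \<in> ?Z"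
      using x y by (simp add: Z add_hom_add[OF d] add_hom_minus[OF d C D])
    moreover have "y = (y \<oplus>\<^bsub>C (Suc n)\<^esub> \<ominus>\<^bsub>C (Suc n)\<^esub> x) \<oplus>\<^bsub>C (Suc n)\<^esub> x"
      using x y by (simp add: Z C.a_assoc C.l_neg)
    ultimately show "y \<in> (\<Union>h\<in>?Z. {h \<oplus>\<^bsub>C (Suc n)\<^esub> x})" by blast
  qed
  have "\<zero>\<^bsub>C (Suc n)\<^esub> \<in> ?Z" by (simp add: Z add_hom_zero[OF d C D])
  then show ?thesis
    unfolding homology_def im A_FactGroup_def FactGroup_def RCOSETS_def r_coset_def
    using coset by auto
qed

text \<open>Tensoring is an additive functor, so it preserves the homotopy identity in the one
  degree where it is given. The identity then exhibits a cycle y as the boundary of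
  \<open>H2 y\<close>.\<close>

lemma tensor_complex_homology_trivial:
  fixes P :: "nat \<Rightarrow> ('r, 'p) module" and N :: "('r, 'n, 'm) module_scheme"
  assumes P: "\<And>n. right_module R (P n)"
    and d: "\<And>n. d n \<in> right_module_hom R (P (Suc n)) (P n)"
    and dd: "\<And>n x. x \<in> carrier (P (Suc (Suc n))) \<Longrightarrow> d n (d (Suc n) x) = \<zero>\<^bsub>P n\<^esub>"
    and h1: "h1 \<in> right_module_hom R (P (Suc n)) (P (Suc (Suc n)))"
    and h2: "h2 \<in> right_module_hom R (P (Suc (Suc n))) (P (Suc (Suc (Suc n))))"
    and hh: "\<And>x. x \<in> carrier (P (Suc (Suc n))) \<Longrightarrow>
      d (Suc (Suc n)) (h2 x) \<oplus>\<^bsub>P (Suc (Suc n))\<^esub> h1 (d (Suc n) x) = x"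
  shows "carrier (tensor_complex_homology R P d N (Suc (Suc n)))
    = {\<one>\<^bsub>tensor_complex_homology R P d N (Suc (Suc n))\<^esub>}"
proof -
  let ?T = "\<lambda>n. tensor_product R (P n) N"
  let ?D = "\<lambda>m. extend_hom (?T m) (\<lambda>(p, y). pure_tensor R (P m) N (d m p) y)"
  note ab = tensor_product_abelian
  have D: "?D m \<in> add_hom (?T (Suc m)) (?T m)" for m by (rule tensor_map(1)[OF P d])
  have D_pure: "?D m (pure_tensor R (P (Suc m)) N p y) = pure_tensor R (P m) N (d m p) y"
    if "p \<in> carrier (P (Suc m))" "y \<in> carrier N" for m p y by (rule tensor_map(2)[OF P d that])
  define H1 where "H1 = extend_hom (?T (Suc (Suc n))) (\<lambda>(p, y). pure_tensor R (P (Suc (Suc n))) N (h1 p) y)"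
  define H2 where "H2 = extend_hom (?T (Suc (Suc (Suc n)))) (\<lambda>(p, y). pure_tensor R (P (Suc (Suc (Suc n)))) N (h2 p) y)"
  have H1: "H1 \<in> add_hom (?T (Suc n)) (?T (Suc (Suc n)))"
    "\<And>p y. p \<in> carrier (P (Suc n)) \<Longrightarrow> y \<in> carrier N \<Longrightarrow>
      H1 (pure_tensor R (P (Suc n)) N p y) = pure_tensor R (P (Suc (Suc n))) N (h1 p) y"
    unfolding H1_def by (rule tensor_map(1)[OF P h1], rule tensor_map(2)[OF P h1])
  have H2: "H2 \<in> add_hom (?T (Suc (Suc n))) (?T (Suc (Suc (Suc n))))"
    "\<And>p y. p \<in> carrier (P (Suc (Suc n))) \<Longrightarrow> y \<in> carrier N \<Longrightarrow>
      H2 (pure_tensor R (P (Suc (Suc n))) N p y) = pure_tensor R (P (Suc (Suc (Suc n)))) N (h2 p) y"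
    unfolding H2_def by (rule tensor_map(1)[OF P h2], rule tensor_map(2)[OF P h2])
  \<comment> \<open>Additivity in the first slot makes this element equal to its own double.\<close>
  have zero: "pure_tensor R (P m) N \<zero>\<^bsub>P m\<^esub> y = \<zero>\<^bsub>?T m\<^esub>" if "y \<in> carrier N" for m y
  proof -
    interpret p: right_module R "P m" by (rule P)
    interpret t: abelian_group "?T m" by (rule ab)
    have "pure_tensor R (P m) N \<zero>\<^bsub>P m\<^esub> y \<oplus>\<^bsub>?T m\<^esub> pure_tensor R (P m) N \<zero>\<^bsub>P m\<^esub> y
      = pure_tensor R (P m) N \<zero>\<^bsub>P m\<^esub> y"
      using that by (simp flip: pure_tensor_add_l)
    then show ?thesis using that t.add.l_cancel_one' by (simp add: pure_tensor_closed)
  qed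
  have DD: "?D (Suc n) (?D (Suc (Suc n)) x) = \<zero>\<^bsub>?T (Suc n)\<^esub>" if "x \<in> carrier (?T (Suc (Suc (Suc n))))" for x
    using that
  proof (induction rule: tensor_product_induct)
    case zero then show ?case by (simp add: add_hom_zero[OF D ab ab])
  next
    case (pure a b) then show ?case
      by (simp add: D_pure right_module_hom_closed[OF d] dd zero)
  next
    case (add x y)
    interpret t: abelian_group "?T (Suc n)" by (rule ab)
    from add show ?case by (simp add: add_hom_add[OF D] add_hom_closed[OF D])
  next
    case (minus x)
    interpret t: abelian_group "?T (Suc n)" by (rule ab)
    from minus show ?case by (simp add: add_hom_minus[OF D ab ab] add_hom_closed[OF D])
  qed
  have HH: "?D (Suc (Suc n)) (H2 x) \<oplus>\<^bsub>?T (Suc (Suc n))\<^esub> H1 (?D (Suc n) x) = x"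
    if "x \<in> carrier (?T (Suc (Suc n)))" for x
    using that
  proof (induction rule: tensor_product_induct)
    case zero
    interpret t: abelian_group "?T (Suc (Suc n))" by (rule ab)
    show ?case by (simp add: add_hom_zero[OF D ab ab] add_hom_zero[OF H1(1) ab ab] add_hom_zero[OF H2(1) ab ab])
  next
    case (pure a b)
    interpret p: right_module R "P (Suc (Suc n))" by (rule P)
    note c = right_module_hom_closed[OF d] right_module_hom_closed[OF h1] right_module_hom_closed[OF h2]
    from pure show ?case by (simp add: D_pure H1(2) H2(2) c hh flip: pure_tensor_add_l)
  next
    case (add x y)
    interpret t: abelian_group "?T (Suc (Suc n))" by (rule ab)
    note c = add_hom_closed[OF D] add_hom_closed[OF H1(1)] add_hom_closed[OF H2(1)]
    let ?a = "?D (Suc (Suc n)) (H2 x)" and ?b = "H1 (?D (Suc n) x)"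
    let ?a' = "?D (Suc (Suc n)) (H2 y)" and ?b' = "H1 (?D (Suc n) y)"
    have cl: "?a \<in> carrier (?T (Suc (Suc n)))" "?b \<in> carrier (?T (Suc (Suc n)))"
      "?a' \<in> carrier (?T (Suc (Suc n)))" "?b' \<in> carrier (?T (Suc (Suc n)))" using add c by simp_all
    have "?a \<oplus>\<^bsub>?T (Suc (Suc n))\<^esub> ?a' \<oplus>\<^bsub>?T (Suc (Suc n))\<^esub> (?b \<oplus>\<^bsub>?T (Suc (Suc n))\<^esub> ?b')
      = (?a \<oplus>\<^bsub>?T (Suc (Suc n))\<^esub> ?b) \<oplus>\<^bsub>?T (Suc (Suc n))\<^esub> (?a' \<oplus>\<^bsub>?T (Suc (Suc n))\<^esub> ?b')"
      using cl by (simp add: t.a_ac)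
    with add show ?case
      by (simp add: add_hom_add[OF D] add_hom_add[OF H1(1)] add_hom_add[OF H2(1)] c)
  next
    case (minus x)
    interpret t: abelian_group "?T (Suc (Suc n))" by (rule ab)
    note c = add_hom_closed[OF D] add_hom_closed[OF H1(1)] add_hom_closed[OF H2(1)]
    from minus show ?case
      by (simp add: add_hom_minus[OF D ab ab] add_hom_minus[OF H1(1) ab ab] add_hom_minus[OF H2(1) ab ab] c
         flip: t.minus_add)
  qed
  have "?D (Suc (Suc n)) ` carrier (?T (Suc (Suc (Suc n)))) = cycles ?T ?D (Suc (Suc n))"
  proof (intro equalityI subsetI)
    fix y assume "y \<in> ?D (Suc (Suc n)) ` carrier (?T (Suc (Suc (Suc n))))"
    then show "y \<in> cycles ?T ?D (Suc (Suc n))"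
      using DD add_hom_closed[OF D] by (auto simp: a_kernel_def kernel_def)
  next
    fix y assume "y \<in> cycles ?T ?D (Suc (Suc n))"
    then have y: "y \<in> carrier (?T (Suc (Suc n)))" "?D (Suc n) y = \<zero>\<^bsub>?T (Suc n)\<^esub>"
      by (auto simp: a_kernel_def kernel_def)
    interpret t: abelian_group "?T (Suc (Suc n))" by (rule ab)
    have "?D (Suc (Suc n)) (H2 y) = y"
      using HH[OF y(1)] y add_hom_zero[OF H1(1) ab ab] add_hom_closed[OF D add_hom_closed[OF H2(1) y(1)]] by simp
    then show "y \<in> ?D (Suc (Suc n)) ` carrier (?T (Suc (Suc (Suc n))))"
      using add_hom_closed[OF H2(1) y(1)] by (metis image_eqI)
  qed
  then show ?thesis unfolding tensor_complex_homology_def by (rule homology_trivial[where C = ?T and d = ?D and n = "Suc n", OF ab ab D])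
qed

section \<open>Associative algebras and their commutators\<close>

lemma (in expr_model) smult_minus:
  assumes "c \<in> C" "x \<in> carrier A"
  shows "c \<odot>\<^bsub>A\<^esub> (\<ominus> x) = \<ominus> (c \<odot>\<^bsub>A\<^esub> x)"
proof (rule add_hom_minus[OF _ abelian_group_axioms abelian_group_axioms assms(2)])
  show "(\<lambda>x. c \<odot>\<^bsub>A\<^esub> x) \<in> add_hom A A"
    by (rule add_homI) (simp_all add: assms(1) smult_closed smult_r_distr)
qed

text \<open>\<open>expr_model\<close> has no axiom about the scalars by themselves, so what is used
  of their zero appears as a premise.\<close>

lemma (in expr_model) smult_zero:
  assumes "\<zero>\<^bsub>R\<^esub> \<in> C" "\<zero>\<^bsub>R\<^esub> \<oplus>\<^bsub>R\<^esub> \<zero>\<^bsub>R\<^esub> = \<zero>\<^bsub>R\<^esub>" "x \<in> carrier A"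
  shows "\<zero>\<^bsub>R\<^esub> \<odot>\<^bsub>A\<^esub> x = \<zero>"
proof -
  have "\<zero>\<^bsub>R\<^esub> \<odot>\<^bsub>A\<^esub> x = \<zero>\<^bsub>R\<^esub> \<odot>\<^bsub>A\<^esub> x \<oplus> \<zero>\<^bsub>R\<^esub> \<odot>\<^bsub>A\<^esub> x"
    using smult_l_distr[of "\<zero>\<^bsub>R\<^esub>" "\<zero>\<^bsub>R\<^esub>" x] assms by simp
  then show ?thesis using smult_closed[OF assms(1,3)] by (simp only: add.l_cancel_one')
qed

locale unital_algebra = base: cring R + expr_model Unital "carrier R" R A + ring A
  for R :: "('c, 'r) ring_scheme" and A :: "('c, 'b) module" (structure)
begin

lemma smult_mult_one_l: "c \<in> carrier R \<Longrightarrow> x \<in> carrier A \<Longrightarrow> (c \<odot>\<^bsub>A\<^esub> \<one>) \<otimes> x = c \<odot>\<^bsub>A\<^esub> x"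
  by (simp add: smult_mult_l)

lemma smult_mult_one_r: "c \<in> carrier R \<Longrightarrow> x \<in> carrier A \<Longrightarrow> x \<otimes> (c \<odot>\<^bsub>A\<^esub> \<one>) = c \<odot>\<^bsub>A\<^esub> x"
  by (simp add: smult_mult_r)

lemma smult_one_central:
  "c \<in> carrier R \<Longrightarrow> x \<in> carrier A \<Longrightarrow> (c \<odot>\<^bsub>A\<^esub> \<one>) \<otimes> x = x \<otimes> (c \<odot>\<^bsub>A\<^esub> \<one>)"
  by (simp add: smult_mult_one_l smult_mult_one_r)

lemma smult_one_mult:
  "c \<in> carrier R \<Longrightarrow> d \<in> carrier R \<Longrightarrow> (c \<otimes>\<^bsub>R\<^esub> d) \<odot>\<^bsub>A\<^esub> \<one> = (c \<odot>\<^bsub>A\<^esub> \<one>) \<otimes> (d \<odot>\<^bsub>A\<^esub> \<one>)"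
  by (simp add: smult_mult_one_l smult_closed smult_assoc)

lemma commutator_algebra_simps [simp]:
  "carrier (commutator_algebra A) = carrier A" "add (commutator_algebra A) = add A"
  "zero (commutator_algebra A) = zero A" "smult (commutator_algebra A) = smult A"
  "x \<otimes>\<^bsub>commutator_algebra A\<^esub> y = (x \<otimes> y) \<ominus> (y \<otimes> x)"
  by (simp_all add: commutator_algebra_def)

lemma commutator_abelian: "abelian_group (commutator_algebra A)"
  using abelian_group_axioms by (simp add: abelian_group_def abelian_monoid_def abelian_group_axioms_def)

lemma commutator_minus [simp]: "\<ominus>\<^bsub>commutator_algebra A\<^esub> x = \<ominus> x"
  by (simp add: a_inv_def)

lemma commutator_model: "expr_model Multiplicative (carrier R) R (commutator_algebra A)"
proof -
  interpret c: abelian_group "commutator_algebra A" by (rule commutator_abelian)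
  show ?thesis
    by unfold_locales
      (simp_all add: smult_closed smult_l_distr smult_r_distr smult_assoc smult_one a_minus_def
        l_distr r_distr minus_add smult_mult_l smult_mult_r smult_minus a_ac)
qed

lemma jacobi:
  assumes "x \<in> carrier A" "y \<in> carrier A" "z \<in> carrier A"
  shows "x \<otimes> (y \<otimes> z \<ominus> z \<otimes> y) \<ominus> (y \<otimes> z \<ominus> z \<otimes> y) \<otimes> x \<oplus>
    (y \<otimes> (z \<otimes> x \<ominus> x \<otimes> z) \<ominus> (z \<otimes> x \<ominus> x \<otimes> z) \<otimes> y \<oplus>
     (z \<otimes> (x \<otimes> y \<ominus> y \<otimes> x) \<ominus> (x \<otimes> y \<ominus> y \<otimes> x) \<otimes> z)) = \<zero>"
proof -
  \<comment> \<open>The six orders of a triple product each occur once with either sign. Naming them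
    reduces the identity to a cancellation in the additive group.\<close>
  define a b c d e f where "a = x \<otimes> (y \<otimes> z)" "b = x \<otimes> (z \<otimes> y)" "c = y \<otimes> (z \<otimes> x)"
    "d = y \<otimes> (x \<otimes> z)" "e = z \<otimes> (x \<otimes> y)" "f = z \<otimes> (y \<otimes> x)"
  note defs = this
  have cl: "a \<in> carrier A" "b \<in> carrier A" "c \<in> carrier A" "d \<in> carrier A" "e \<in> carrier A" "f \<in> carrier A"
    using assms by (simp_all add: defs)
  have "a \<oplus> \<ominus> b \<oplus> (\<ominus> c \<oplus> f) \<oplus> (c \<oplus> \<ominus> d \<oplus> (\<ominus> e \<oplus> b) \<oplus> (e \<oplus> \<ominus> f \<oplus> (\<ominus> a \<oplus> d))) = \<zero>"
  proof -
    have "a \<oplus> \<ominus> b \<oplus> (\<ominus> c \<oplus> f) \<oplus> (c \<oplus> \<ominus> d \<oplus> (\<ominus> e \<oplus> b) \<oplus> (e \<oplus> \<ominus> f \<oplus> (\<ominus> a \<oplus> d)))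
      = (a \<oplus> \<ominus> a) \<oplus> ((b \<oplus> \<ominus> b) \<oplus> ((c \<oplus> \<ominus> c) \<oplus> ((d \<oplus> \<ominus> d) \<oplus> ((e \<oplus> \<ominus> e) \<oplus> (f \<oplus> \<ominus> f)))))"
      using cl by (simp only: a_assoc a_lcomm a_comm a_inv_closed a_closed)
    then show ?thesis using cl by (simp add: r_neg)
  qed
  then show ?thesis
    using assms cl by (simp add: a_minus_def r_distr l_distr minus_add r_minus l_minus m_assoc flip: defs)
qed

lemma commutator_lie_rel:
  assumes "(s, t) \<in> lie_rel" "s \<in> exprs Multiplicative (carrier R) X" "t \<in> exprs Multiplicative (carrier R) X"
    and g: "\<gamma> \<in> X \<rightarrow> carrier A"
  shows "expr_eval (commutator_algebra A) \<gamma> s = expr_eval (commutator_algebra A) \<gamma> t"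
proof -
  interpret c: expr_model Multiplicative "carrier R" R "commutator_algebra A" by (rule commutator_model)
  have cl: "expr_eval (commutator_algebra A) \<gamma> e \<in> carrier A" if "e \<in> exprs Multiplicative (carrier R) X" for e
    using c.eval_closed[OF that, of \<gamma>] g by simp
  show ?thesis
    using assms(1-3) unfolding lie_rel_def
    by (auto simp: cl jacobi)
qed

end

lemma presented_unital_algebra:
  assumes R: "cring R" and E: "assoc_rel \<subseteq> E"
  shows "unital_algebra R (presented R (exprs Unital (carrier R) X) E)"
proof -
  let ?T = "exprs Unital (carrier R) X"
  let ?P = "presented R ?T E"
  interpret m: expr_model Unital "carrier R" R ?P by (rule presented_model)
  have "monoid ?P"
  proof (rule monoidI)
    fix x y z assume "x \<in> carrier ?P" "y \<in> carrier ?P" "z \<in> carrier ?P"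
    then obtain s t u where "x = expr_class R ?T E s" "y = expr_class R ?T E t" "z = expr_class R ?T E u"
      "s \<in> ?T" "t \<in> ?T" "u \<in> ?T" unfolding carrier_presented by blast
    moreover have "(Mul (Mul s t) u, Mul s (Mul t u)) \<in> E" using E by (auto simp: assoc_rel_def)
    ultimately show "x \<otimes>\<^bsub>?P\<^esub> y \<otimes>\<^bsub>?P\<^esub> z = x \<otimes>\<^bsub>?P\<^esub> (y \<otimes>\<^bsub>?P\<^esub> z)"
      by (simp add: presented_mult expr_class_relI)
  qed (simp_all add: m.mult_closed m.unit_closed m.unit_l m.unit_r)
  then have "ring ?P"
    by (intro ringI) (simp_all add: m.mult_l_distr m.mult_r_distr m.abelian_group_axioms)
  with R show ?thesis by (simp add: unital_algebra_def m.expr_model_axioms)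
qed

section \<open>The universal property of presented objects\<close>

context expr_model
begin

text \<open>The premises of \<open>extend_hom_class\<close> as one predicate, so that a union of
  sets of relations can be treated piece by piece with \<open>compatible_Un\<close>.\<close>

definition compatible :: "('x \<Rightarrow> 'b) \<Rightarrow> 'x set \<Rightarrow> ('c, 'x) expr rel \<Rightarrow> bool" where
  "compatible \<gamma> X E \<longleftrightarrow> \<gamma> \<in> X \<rightarrow> carrier A \<and>
     (\<forall>s t. (s, t) \<in> E \<longrightarrow> s \<in> exprs K C X \<longrightarrow> t \<in> exprs K C X \<longrightarrow> expr_eval A \<gamma> s = expr_eval A \<gamma> t)"

lemma compatible_eval: "compatible \<gamma> X E \<Longrightarrow> e \<in> exprs K C X \<Longrightarrow>
    extend_hom A \<gamma> (expr_class R (exprs K C X) E e) = expr_eval A \<gamma> e"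
  unfolding compatible_def by (rule extend_hom_class) auto

lemma compatible_Un: "compatible \<gamma> X (E \<union> E') \<longleftrightarrow> compatible \<gamma> X E \<and> compatible \<gamma> X E'"
  by (auto simp: compatible_def)

lemma compatibleI:
  assumes "\<And>x. x \<in> X \<Longrightarrow> \<gamma> x \<in> carrier A"
    and "\<And>s t. (s, t) \<in> E \<Longrightarrow> s \<in> exprs K C X \<Longrightarrow> t \<in> exprs K C X \<Longrightarrow> expr_eval A \<gamma> s = expr_eval A \<gamma> t"
  shows "compatible \<gamma> X E"
  using assms by (auto simp: compatible_def)

lemma compatible_linear_rel:
  assumes "\<And>x. x \<in> carrier M \<Longrightarrow> \<gamma> x \<in> carrier A"
    and "\<And>x y. x \<in> carrier M \<Longrightarrow> y \<in> carrier M \<Longrightarrow> x \<oplus>\<^bsub>M\<^esub> y \<in> carrier M \<Longrightarrow> \<gamma> (x \<oplus>\<^bsub>M\<^esub> y) = \<gamma> x \<oplus> \<gamma> y"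
    and "\<And>c x. c \<in> C \<Longrightarrow> x \<in> carrier M \<Longrightarrow> c \<odot>\<^bsub>M\<^esub> x \<in> carrier M \<Longrightarrow> \<gamma> (c \<odot>\<^bsub>M\<^esub> x) = c \<odot>\<^bsub>A\<^esub> \<gamma> x"
  shows "compatible \<gamma> (carrier M) (linear_rel R M)"
  using assms by (intro compatibleI) (auto simp: linear_rel_def)

context
  fixes X E \<gamma> P F
  assumes r: "compatible \<gamma> X E"
  defines "P \<equiv> presented R (exprs K C X) E"
    and "F \<equiv> extend_hom A \<gamma>"
begin

lemma ext_gen: "x \<in> X \<Longrightarrow> F (expr_class R (exprs K C X) E (Gen x)) = \<gamma> x"
  unfolding F_def by (subst compatible_eval[OF r]) auto

lemma ext_closed: "x \<in> carrier P \<Longrightarrow> F x \<in> carrier A"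
proof -
  have g: "\<gamma> \<in> X \<rightarrow> carrier A" using r by (simp add: compatible_def)
  show "x \<in> carrier P \<Longrightarrow> F x \<in> carrier A"
    unfolding F_def P_def carrier_presented using eval_closed[OF _ g] compatible_eval[OF r] by auto
qed

lemma ext_add: "x \<in> carrier P \<Longrightarrow> y \<in> carrier P \<Longrightarrow> F (x \<oplus>\<^bsub>P\<^esub> y) = F x \<oplus> F y"
  unfolding F_def P_def carrier_presented by (clarsimp simp: presented_add compatible_eval[OF r])

lemma ext_zero: "F \<zero>\<^bsub>P\<^esub> = \<zero>"
  unfolding F_def P_def presented_zero by (simp add: compatible_eval[OF r])

lemma ext_minus: "x \<in> carrier P \<Longrightarrow> F (\<ominus>\<^bsub>P\<^esub> x) = \<ominus> F x"
  unfolding F_def P_def carrier_presented by (clarsimp simp: presented_minus compatible_eval[OF r])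

lemma ext_smult: "c \<in> C \<Longrightarrow> x \<in> carrier P \<Longrightarrow> F (c \<odot>\<^bsub>P\<^esub> x) = c \<odot>\<^bsub>A\<^esub> F x"
  unfolding F_def P_def carrier_presented by (clarsimp simp: presented_smult compatible_eval[OF r])

lemma ext_mult: "K \<noteq> Linear \<Longrightarrow> x \<in> carrier P \<Longrightarrow> y \<in> carrier P \<Longrightarrow> F (x \<otimes>\<^bsub>P\<^esub> y) = F x \<otimes> F y"
  unfolding F_def P_def carrier_presented by (clarsimp simp: presented_mult compatible_eval[OF r])

lemma ext_one: "K = Unital \<Longrightarrow> F \<one>\<^bsub>P\<^esub> = \<one>"
  unfolding F_def P_def presented_one by (subst compatible_eval[OF r]) simp_all

end

end

lemma (in unital_algebra) compatible_assoc_rel: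
  assumes "\<gamma> \<in> X \<rightarrow> carrier A"
  shows "compatible \<gamma> X assoc_rel"
  using assms by (intro compatibleI) (auto simp: assoc_rel_def m_assoc eval_closed)

section \<open>The free Lie image and its enveloping algebra\<close>

type_synonym ('c, 'b) U_elem = "('c, ('c, 'b) expr set) expr set"

locale free_lie = R: cring R
  for R :: "('c, 'r) ring_scheme" and M :: "('c, 'b, 'm) module_scheme"
begin

abbreviation "TA \<equiv> tensor_algebra R M"
abbreviation "\<mu> \<equiv> tensor_gen R M"
abbreviation "\<gg> \<equiv> free_lie_image R M"
abbreviation "U \<equiv> enveloping_algebra R \<gg>"

definition T_rel where "T_rel = linear_rel R M \<union> assoc_rel"

lemma TA_eq: "TA = presented R (exprs Unital (carrier R) (carrier M)) T_rel"
  by (simp add: tensor_algebra_def T_rel_def)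

lemma \<mu>_eq: "\<mu> m = expr_class R (exprs Unital (carrier R) (carrier M)) T_rel (Gen m)"
  by (simp add: tensor_gen_def expr_class_def T_rel_def)

sublocale TA: unital_algebra R TA
  unfolding TA_eq by (rule presented_unital_algebra) (auto simp: R.is_cring T_rel_def)

lemma \<mu>_closed: "m \<in> carrier M \<Longrightarrow> \<mu> m \<in> carrier TA"
  unfolding TA_eq \<mu>_eq by (rule expr_class_in_presented) simp

lemma \<mu>_add:
  assumes "x \<in> carrier M" "y \<in> carrier M" "x \<oplus>\<^bsub>M\<^esub> y \<in> carrier M"
  shows "\<mu> (x \<oplus>\<^bsub>M\<^esub> y) = \<mu> x \<oplus>\<^bsub>TA\<^esub> \<mu> y"
proof -
  have "(Gen (x \<oplus>\<^bsub>M\<^esub> y), Add (Gen x) (Gen y)) \<in> T_rel"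
    using assms by (auto simp: T_rel_def linear_rel_def)
  then show ?thesis using assms unfolding \<mu>_eq TA_eq
    by (simp add: presented_add expr_class_relI)
qed

lemma \<mu>_smult:
  assumes "c \<in> carrier R" "x \<in> carrier M" "c \<odot>\<^bsub>M\<^esub> x \<in> carrier M"
  shows "\<mu> (c \<odot>\<^bsub>M\<^esub> x) = c \<odot>\<^bsub>TA\<^esub> \<mu> x"
proof -
  have "(Gen (c \<odot>\<^bsub>M\<^esub> x), Scale c (Gen x)) \<in> T_rel"
    using assms unfolding T_rel_def linear_rel_def by blast
  then show ?thesis using assms unfolding \<mu>_eq TA_eq
    by (simp add: presented_smult expr_class_relI)
qed

abbreviation "L \<equiv> commutator_algebra TA"

sublocale L: expr_model Multiplicative "carrier R" R L
  by (rule TA.commutator_model)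

text \<open>Replaces the detour through classes in the free Lie algebra by bracket expressions
  evaluated in \<open>TA\<close>. Closure properties and the rule \<open>\<gg>_induct\<close> are
  read off from the shape of these expressions.\<close>

lemma carrier_\<gg>: "carrier \<gg> = {expr_eval L \<mu> e | e. e \<in> exprs Multiplicative (carrier R) (carrier M)}"
proof -
  have "L.compatible \<mu> (carrier M) (linear_rel R M \<union> lie_rel)"
    unfolding L.compatible_Un
    using L.compatible_linear_rel[of M \<mu>] \<mu>_closed \<mu>_add \<mu>_smult TA.commutator_lie_rel[of _ _ "carrier M" \<mu>]
    by (auto intro!: L.compatibleI)
  then show ?thesis
    unfolding free_lie_image_def free_lie_to_tensor_def free_lie_algebra_def carrier_presented
    by (force simp: L.compatible_eval)
qed

lemma \<gg>_simps [simp]: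
  "add \<gg> = add TA" "zero \<gg> = zero TA" "smult \<gg> = smult TA" "mult \<gg> = mult L"
  by (simp_all add: free_lie_image_def)

lemma \<gg>_subset: "carrier \<gg> \<subseteq> carrier TA"
proof -
  have "\<mu> \<in> carrier M \<rightarrow> carrier L" using \<mu>_closed by simp
  from L.eval_closed[OF _ this] show ?thesis unfolding carrier_\<gg> by auto
qed

lemma \<gg>_gen: "m \<in> carrier M \<Longrightarrow> \<mu> m \<in> carrier \<gg>"
  unfolding carrier_\<gg> by (auto intro!: exI[of _ "Gen m"])

lemma \<gg>_zero: "\<zero>\<^bsub>TA\<^esub> \<in> carrier \<gg>"
  unfolding carrier_\<gg> by (auto intro!: exI[of _ Zero])

lemma \<gg>_add: "x \<in> carrier \<gg> \<Longrightarrow> y \<in> carrier \<gg> \<Longrightarrow> x \<oplus>\<^bsub>TA\<^esub> y \<in> carrier \<gg>"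
  unfolding carrier_\<gg> by clarsimp (metis exprs_simps(3) expr_eval.simps(3) TA.commutator_algebra_simps(2))

lemma \<gg>_minus: "x \<in> carrier \<gg> \<Longrightarrow> \<ominus>\<^bsub>TA\<^esub> x \<in> carrier \<gg>"
  unfolding carrier_\<gg> by clarsimp (metis exprs_simps(4) expr_eval.simps(4) TA.commutator_minus)

lemma \<gg>_smult: "c \<in> carrier R \<Longrightarrow> x \<in> carrier \<gg> \<Longrightarrow> c \<odot>\<^bsub>TA\<^esub> x \<in> carrier \<gg>"
  unfolding carrier_\<gg> by clarsimp (metis exprs_simps(5) expr_eval.simps(5) TA.commutator_algebra_simps(4))

lemma \<gg>_bracket: "x \<in> carrier \<gg> \<Longrightarrow> y \<in> carrier \<gg> \<Longrightarrow> x \<otimes>\<^bsub>L\<^esub> y \<in> carrier \<gg>"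
  unfolding carrier_\<gg> by (clarsimp simp del: TA.commutator_algebra_simps)
    (metis exprs_simps(6) expr_eval.simps(6) kind.distinct(1))

lemma \<gg>_abelian: "abelian_group \<gg>"
proof (rule abelian_groupI)
  fix x assume "x \<in> carrier \<gg>"
  then show "\<exists>y\<in>carrier \<gg>. y \<oplus>\<^bsub>\<gg>\<^esub> x = \<zero>\<^bsub>\<gg>\<^esub>"
    using \<gg>_subset by (intro bexI[of _ "\<ominus>\<^bsub>TA\<^esub> x"]) (auto simp: TA.l_neg \<gg>_minus)
qed (use \<gg>_subset in \<open>auto simp: \<gg>_add \<gg>_zero TA.a_ac subsetD\<close>)

lemma \<gg>_induct [consumes 1, case_names gen zero add minus smult bracket]:
  assumes "x \<in> carrier \<gg>"
    and "\<And>m. m \<in> carrier M \<Longrightarrow> P (\<mu> m)"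
    and "P \<zero>\<^bsub>TA\<^esub>"
    and "\<And>x y. x \<in> carrier \<gg> \<Longrightarrow> y \<in> carrier \<gg> \<Longrightarrow> P x \<Longrightarrow> P y \<Longrightarrow> P (x \<oplus>\<^bsub>TA\<^esub> y)"
    and "\<And>x. x \<in> carrier \<gg> \<Longrightarrow> P x \<Longrightarrow> P (\<ominus>\<^bsub>TA\<^esub> x)"
    and "\<And>c x. c \<in> carrier R \<Longrightarrow> x \<in> carrier \<gg> \<Longrightarrow> P x \<Longrightarrow> P (c \<odot>\<^bsub>TA\<^esub> x)"
    and "\<And>x y. x \<in> carrier \<gg> \<Longrightarrow> y \<in> carrier \<gg> \<Longrightarrow> P x \<Longrightarrow> P y \<Longrightarrow> P (x \<otimes>\<^bsub>L\<^esub> y)"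
  shows "P x"
proof -
  obtain e where e: "e \<in> exprs Multiplicative (carrier R) (carrier M)" "x = expr_eval L \<mu> e"
    using assms(1) unfolding carrier_\<gg> by blast
  have in_g: "expr_eval L \<mu> e \<in> carrier \<gg>" if "e \<in> exprs Multiplicative (carrier R) (carrier M)" for e
    using that unfolding carrier_\<gg> by blast
  have "P (expr_eval L \<mu> e)" using e(1)
  proof (induction rule: exprs.induct)
    case (6 s t)
    then show ?case using assms(7)[OF in_g in_g, of s t] by simp
  qed (use assms in_g in auto)
  then show ?thesis using e(2) by simp
qed

section \<open>The enveloping algebra\<close>

definition U_rel where
  "U_rel = linear_rel R \<gg> \<union> assoc_rel \<union>
      {(Add (Mul (Gen x) (Gen y)) (Neg (Mul (Gen y) (Gen x))), Gen (x \<otimes>\<^bsub>\<gg>\<^esub> y)) | x y.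
         x \<in> carrier \<gg> \<and> y \<in> carrier \<gg>}"

abbreviation "U_exprs \<equiv> exprs Unital (carrier R) (carrier \<gg>)"

lemma U_eq: "U = presented R U_exprs U_rel"
  by (simp add: enveloping_algebra_def U_rel_def)

sublocale U: unital_algebra R U
  unfolding U_eq by (rule presented_unital_algebra) (auto simp: R.is_cring U_rel_def)

definition \<iota> where "\<iota> x = expr_class R U_exprs U_rel (Gen x)"

lemma \<iota>_closed: "x \<in> carrier \<gg> \<Longrightarrow> \<iota> x \<in> carrier U"
  unfolding U_eq \<iota>_def by (rule expr_class_in_presented) simp

lemma \<iota>_add:
  assumes "x \<in> carrier \<gg>" "y \<in> carrier \<gg>"
  shows "\<iota> (x \<oplus>\<^bsub>TA\<^esub> y) = \<iota> x \<oplus>\<^bsub>U\<^esub> \<iota> y"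
proof -
  have "(Gen (x \<oplus>\<^bsub>\<gg>\<^esub> y), Add (Gen x) (Gen y)) \<in> U_rel"
    using assms unfolding U_rel_def linear_rel_def by blast
  then show ?thesis using assms unfolding \<iota>_def U_eq
    by (simp add: presented_add expr_class_relI \<gg>_add)
qed

lemma \<iota>_smult:
  assumes "c \<in> carrier R" "x \<in> carrier \<gg>"
  shows "\<iota> (c \<odot>\<^bsub>TA\<^esub> x) = c \<odot>\<^bsub>U\<^esub> \<iota> x"
proof -
  have "(Gen (c \<odot>\<^bsub>\<gg>\<^esub> x), Scale c (Gen x)) \<in> U_rel"
    using assms unfolding U_rel_def linear_rel_def by blast
  then show ?thesis using assms unfolding \<iota>_def U_eq
    by (simp add: presented_smult expr_class_relI \<gg>_smult)
qed

lemma \<iota>_bracket: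
  assumes "x \<in> carrier \<gg>" "y \<in> carrier \<gg>"
  shows "\<iota> (x \<otimes>\<^bsub>L\<^esub> y) = \<iota> x \<otimes>\<^bsub>U\<^esub> \<iota> y \<ominus>\<^bsub>U\<^esub> \<iota> y \<otimes>\<^bsub>U\<^esub> \<iota> x"
proof -
  have "(Add (Mul (Gen x) (Gen y)) (Neg (Mul (Gen y) (Gen x))), Gen (x \<otimes>\<^bsub>\<gg>\<^esub> y)) \<in> U_rel"
    using assms unfolding U_rel_def by blast
  then show ?thesis using assms \<gg>_bracket[OF assms] unfolding \<iota>_def U_eq a_minus_def
    by (simp add: presented_add presented_minus presented_mult expr_class_relI del: TA.commutator_algebra_simps)
qed

lemma \<iota>_hom: "\<iota> \<in> add_hom \<gg> U"
  by (rule add_homI) (simp_all add: \<iota>_closed \<iota>_add)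

lemma \<iota>_zero: "\<iota> \<zero>\<^bsub>TA\<^esub> = \<zero>\<^bsub>U\<^esub>"
  using add_hom_zero[OF \<iota>_hom \<gg>_abelian U.abelian_group_axioms] by simp

lemma \<iota>_minus:
  assumes "x \<in> carrier \<gg>"
  shows "\<iota> (\<ominus>\<^bsub>TA\<^esub> x) = \<ominus>\<^bsub>U\<^esub> \<iota> x"
proof -
  have "\<iota> (\<ominus>\<^bsub>TA\<^esub> x) \<oplus>\<^bsub>U\<^esub> \<iota> x = \<zero>\<^bsub>U\<^esub>"
    using assms \<gg>_subset by (auto simp: \<iota>_add[symmetric] \<gg>_minus \<iota>_zero TA.l_neg subsetD)
  then show ?thesis using assms by (metis U.minus_equality \<iota>_closed \<gg>_minus)
qed

lemma U_induct [consumes 1, case_names gen one zero add minus smult mult]: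
  assumes "x \<in> carrier U"
    and "\<And>x. x \<in> carrier \<gg> \<Longrightarrow> P (\<iota> x)"
    and "P \<one>\<^bsub>U\<^esub>"
    and "P \<zero>\<^bsub>U\<^esub>"
    and "\<And>x y. x \<in> carrier U \<Longrightarrow> y \<in> carrier U \<Longrightarrow> P x \<Longrightarrow> P y \<Longrightarrow> P (x \<oplus>\<^bsub>U\<^esub> y)"
    and "\<And>x. x \<in> carrier U \<Longrightarrow> P x \<Longrightarrow> P (\<ominus>\<^bsub>U\<^esub> x)"
    and "\<And>c x. c \<in> carrier R \<Longrightarrow> x \<in> carrier U \<Longrightarrow> P x \<Longrightarrow> P (c \<odot>\<^bsub>U\<^esub> x)"
    and "\<And>x y. x \<in> carrier U \<Longrightarrow> y \<in> carrier U \<Longrightarrow> P x \<Longrightarrow> P y \<Longrightarrow> P (x \<otimes>\<^bsub>U\<^esub> y)"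
  shows "P x"
proof -
  let ?c = "expr_class R U_exprs U_rel"
  obtain e where e: "e \<in> U_exprs" "x = ?c e"
    using assms(1) unfolding U_eq carrier_presented by blast
  note in_U = expr_class_in_presented[of _ U_exprs R U_rel, folded U_eq]
  have "P (?c e)" using e(1)
  proof (induction rule: exprs.induct)
    case (1 x) then show ?case using assms(2) by (simp add: \<iota>_def)
  next
    case 2 then show ?case using assms(4) by (simp add: U_eq presented_zero)
  next
    case (3 s t) then show ?case using assms(5)[OF in_U in_U, of s t] by (simp add: U_eq presented_add)
  next
    case (4 s) then show ?case using assms(6)[OF in_U, of s] by (simp add: U_eq presented_minus)
  next
    case (5 c s) then show ?case using assms(7)[OF _ in_U, of c s] by (simp add: U_eq presented_smult)
  next
    case (6 s t) then show ?case using assms(8)[OF in_U in_U, of s t] by (simp add: U_eq presented_mult)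
  next
    case 7 then show ?case using assms(3) by (simp add: U_eq presented_one)
  qed
  then show ?thesis using e(2) by simp
qed

end

section \<open>The augmentation ideal and the Fox derivative\<close>

text \<open>The predicate \<open>abelian_group\<close> speaks of an entire record; this transfers it
  to records with another multiplication or another action.\<close>

lemma abelian_group_cong:
  assumes "abelian_group G" "carrier H = carrier G" "add H = add G" "zero H = zero G"
  shows "abelian_group H"
proof -
  interpret G: abelian_group G by fact
  show ?thesis
    using assms(2-4) G.l_neg by (intro abelian_groupI) (auto simp: G.a_ac intro!: bexI[of _ "\<ominus>\<^bsub>G\<^esub> _"])
qed

lemma right_module_subring:
  assumes "right_module R P" "subring S R"
  shows "right_module (R\<lparr>carrier := S\<rparr>) P"
proof -
  interpret P: right_module R P by fact
  have S: "S \<subseteq> carrier R" using assms(2) by (simp add: subringE(1))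
  interpret S: ring "R\<lparr>carrier := S\<rparr>" by (rule P.R.subring_is_ring[OF assms(2)])
  show ?thesis
    by unfold_locales
      (use S in \<open>auto simp: P.ract_closed P.ract_add_scalar P.ract_add P.ract_mult P.ract_one subsetD\<close>)
qed

context right_module
begin

lemma ract_zero_r: "r \<in> carrier R \<Longrightarrow> r \<odot>\<^bsub>P\<^esub> \<zero>\<^bsub>P\<^esub> = \<zero>\<^bsub>P\<^esub>"
  using ract_add[of r "\<zero>\<^bsub>P\<^esub>" "\<zero>\<^bsub>P\<^esub>"] ract_closed[of r "\<zero>\<^bsub>P\<^esub>"]
    P.add.l_cancel_one'[of "r \<odot>\<^bsub>P\<^esub> \<zero>\<^bsub>P\<^esub>" "r \<odot>\<^bsub>P\<^esub> \<zero>\<^bsub>P\<^esub>"] by simp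

lemma ract_zero_l: "x \<in> carrier P \<Longrightarrow> \<zero> \<odot>\<^bsub>P\<^esub> x = \<zero>\<^bsub>P\<^esub>"
  using ract_add_scalar[of \<zero> \<zero> x] ract_closed[of \<zero> x]
    P.add.l_cancel_one'[of "\<zero> \<odot>\<^bsub>P\<^esub> x" "\<zero> \<odot>\<^bsub>P\<^esub> x"] by simp

end

lemma (in cring) regular_unital_algebra: "unital_algebra R (regular_algebra R)"
proof -
  have ab: "abelian_group (regular_algebra R)"
    by (rule abelian_groupI) (auto simp: a_ac intro!: bexI[of _ "\<ominus> _"] l_neg)
  then have "expr_model Unital (carrier R) R (regular_algebra R)"
    by (intro expr_model.intro expr_model_axioms.intro) (simp_all add: l_distr r_distr m_ac)
  moreover have "ring (regular_algebra R)"
    using ab by (intro ringI monoidI) (simp_all add: l_distr r_distr m_assoc)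
  ultimately show ?thesis using is_cring by (simp add: unital_algebra_def)
qed

context free_lie
begin

sublocale Reg: unital_algebra R "regular_algebra R" by (rule R.regular_unital_algebra)

abbreviation "\<epsilon> \<equiv> augmentation R :: ('c, 'b) U_elem \<Rightarrow> 'c"

lemma reg_minus [simp]: "\<ominus>\<^bsub>regular_algebra R\<^esub> x = \<ominus>\<^bsub>R\<^esub> x"
  by (simp add: a_inv_def m_inv_def)

lemma aug_compatible: "Reg.compatible (\<lambda>_. \<zero>\<^bsub>R\<^esub>) (carrier \<gg>) U_rel"
  unfolding U_rel_def Reg.compatible_Un
  by (intro conjI Reg.compatible_assoc_rel Reg.compatible_linear_rel Reg.compatibleI) auto

lemma \<epsilon>_gen: "x \<in> carrier \<gg> \<Longrightarrow> \<epsilon> (\<iota> x) = \<zero>\<^bsub>R\<^esub>"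
  and \<epsilon>_closed: "u \<in> carrier U \<Longrightarrow> \<epsilon> u \<in> carrier R"
  and \<epsilon>_add: "u \<in> carrier U \<Longrightarrow> v \<in> carrier U \<Longrightarrow> \<epsilon> (u \<oplus>\<^bsub>U\<^esub> v) = \<epsilon> u \<oplus>\<^bsub>R\<^esub> \<epsilon> v"
  and \<epsilon>_zero: "\<epsilon> \<zero>\<^bsub>U\<^esub> = \<zero>\<^bsub>R\<^esub>"
  and \<epsilon>_minus: "u \<in> carrier U \<Longrightarrow> \<epsilon> (\<ominus>\<^bsub>U\<^esub> u) = \<ominus>\<^bsub>R\<^esub> \<epsilon> u"
  and \<epsilon>_smult: "c \<in> carrier R \<Longrightarrow> u \<in> carrier U \<Longrightarrow> \<epsilon> (c \<odot>\<^bsub>U\<^esub> u) = c \<otimes>\<^bsub>R\<^esub> \<epsilon> u"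
  and \<epsilon>_mult: "u \<in> carrier U \<Longrightarrow> v \<in> carrier U \<Longrightarrow> \<epsilon> (u \<otimes>\<^bsub>U\<^esub> v) = \<epsilon> u \<otimes>\<^bsub>R\<^esub> \<epsilon> v"
  and \<epsilon>_one: "\<epsilon> \<one>\<^bsub>U\<^esub> = \<one>\<^bsub>R\<^esub>"
  using Reg.ext_gen[OF aug_compatible] Reg.ext_closed[OF aug_compatible] Reg.ext_add[OF aug_compatible]
    Reg.ext_zero[OF aug_compatible] Reg.ext_minus[OF aug_compatible] Reg.ext_smult[OF aug_compatible]
    Reg.ext_mult[OF aug_compatible] Reg.ext_one[OF aug_compatible]
  unfolding augmentation_def \<iota>_def U_eq by simp_all

section \<open>The base ring inside the enveloping algebra\<close>

abbreviation "k c \<equiv> c \<odot>\<^bsub>U\<^esub> \<one>\<^bsub>U\<^esub>"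
abbreviation "S \<equiv> base_subring R U"

lemma k_closed: "c \<in> carrier R \<Longrightarrow> k c \<in> carrier U"
  by (simp add: U.smult_closed)

lemma k_add: "c \<in> carrier R \<Longrightarrow> d \<in> carrier R \<Longrightarrow> k (c \<oplus>\<^bsub>R\<^esub> d) = k c \<oplus>\<^bsub>U\<^esub> k d"
  by (simp add: U.smult_l_distr)

lemma k_zero: "k \<zero>\<^bsub>R\<^esub> = \<zero>\<^bsub>U\<^esub>"
  by (simp add: U.smult_zero)

lemma k_one: "k \<one>\<^bsub>R\<^esub> = \<one>\<^bsub>U\<^esub>"
  by (simp add: U.smult_one)

lemma k_mult: "c \<in> carrier R \<Longrightarrow> d \<in> carrier R \<Longrightarrow> k (c \<otimes>\<^bsub>R\<^esub> d) = k c \<otimes>\<^bsub>U\<^esub> k d"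
  by (simp add: U.smult_one_mult)

lemma k_minus: "c \<in> carrier R \<Longrightarrow> k (\<ominus>\<^bsub>R\<^esub> c) = \<ominus>\<^bsub>U\<^esub> k c"
proof -
  assume c: "c \<in> carrier R"
  then have "k (\<ominus>\<^bsub>R\<^esub> c) \<oplus>\<^bsub>U\<^esub> k c = \<zero>\<^bsub>U\<^esub>"
    using k_add[of "\<ominus>\<^bsub>R\<^esub> c" c] by (simp add: R.l_neg k_zero)
  with c show ?thesis by (metis U.minus_equality k_closed R.a_inv_closed)
qed

text \<open>Hence \<open>k\<close> is injective and \<open>S\<close> is a faithful copy of the base
  ring.\<close>

lemma \<epsilon>_k: "c \<in> carrier R \<Longrightarrow> \<epsilon> (k c) = c"
  by (simp add: \<epsilon>_smult \<epsilon>_one)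

lemma S_subset: "S \<subseteq> carrier U"
  by (auto simp: base_subring_def k_closed)

lemma k_in_S: "c \<in> carrier R \<Longrightarrow> k c \<in> S"
  by (auto simp: base_subring_def)

lemma S_cases: "s \<in> S \<Longrightarrow> (\<And>c. c \<in> carrier R \<Longrightarrow> s = k c \<Longrightarrow> P) \<Longrightarrow> P"
  by (auto simp: base_subring_def)

lemma S_subring: "subring S U"
proof (rule U.subringI)
  show "\<one>\<^bsub>U\<^esub> \<in> S" using k_in_S[of "\<one>\<^bsub>R\<^esub>"] by (simp add: k_one)
  show "\<ominus>\<^bsub>U\<^esub> h \<in> S" if "h \<in> S" for h
    using that by (metis S_cases k_in_S k_minus R.a_inv_closed)
  show "h1 \<otimes>\<^bsub>U\<^esub> h2 \<in> S" if "h1 \<in> S" "h2 \<in> S" for h1 h2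
    using that by (metis S_cases k_in_S k_mult R.m_closed)
  show "h1 \<oplus>\<^bsub>U\<^esub> h2 \<in> S" if "h1 \<in> S" "h2 \<in> S" for h1 h2
    using that by (metis S_cases k_in_S k_add R.a_closed)
qed (rule S_subset)

text \<open>Differs from \<open>regular_algebra U\<close>, whose scalars multiply from the left: in
  a right module the field \<open>smult\<close> has to hold the right multiplication.\<close>

definition UR :: "(('c, 'b) U_elem, ('c, 'b) U_elem) module" where
  "UR = \<lparr>carrier = carrier U, mult = mult U, one = one U, zero = zero U, add = add U,
     smult = (\<lambda>r x. x \<otimes>\<^bsub>U\<^esub> r)\<rparr>"

lemma UR_simps [simp]:
  "carrier UR = carrier U" "add UR = add U" "zero UR = zero U" "r \<odot>\<^bsub>UR\<^esub> x = x \<otimes>\<^bsub>U\<^esub> r"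
  by (simp_all add: UR_def)

lemma UR_module: "right_module U UR"
proof -
  interpret ab: abelian_group UR
    by (rule abelian_group_cong[OF U.abelian_group_axioms]) simp_all
  show ?thesis by unfold_locales (simp_all add: U.r_distr U.l_distr U.m_assoc)
qed

lemma trivial_rep_simps [simp]:
  "carrier (trivial_rep R) = carrier R" "add (trivial_rep R) = add R" "zero (trivial_rep R) = zero R"
  "u \<odot>\<^bsub>trivial_rep R\<^esub> c = augmentation R u \<otimes>\<^bsub>R\<^esub> c"
  by (simp_all add: trivial_rep_def)

lemma trivial_rep_module: "right_module U (trivial_rep R)"
proof -
  interpret ab: abelian_group "trivial_rep R :: (('c, 'b) U_elem, 'c) module"
    by (rule abelian_group_cong[OF R.abelian_group_axioms]) simp_all
  show ?thesis
    by unfold_locales (simp_all add: \<epsilon>_closed \<epsilon>_add \<epsilon>_mult \<epsilon>_one R.l_distr R.r_distr R.m_ac)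
qed

lemma \<epsilon>_hom: "\<epsilon> \<in> right_module_hom U UR (trivial_rep R)"
  by (intro right_module_homI add_homI) (simp_all add: \<epsilon>_closed \<epsilon>_add \<epsilon>_mult R.m_comm)

sublocale Wi: induced U S UR
  by (intro induced.intro induced_axioms.intro right_module_subring UR_module S_subring S_subset U.ring_axioms)

text \<open>The target of the Fox derivative. The natural first factor would be \<open>M\<close>;
  with all of \<open>U\<close> in its place the augmentation ideal is a retract instead of the whole
  module, which is enough for relative projectivity.\<close>

abbreviation "W \<equiv> induced_module U S UR"
abbreviation "pr \<equiv> pure_tensor (U\<lparr>carrier := S\<rparr>) UR (regular_algebra U)"

sublocale W: right_module U W by (rule Wi.Ind_module)

declare Wi.Ind_simps [simp del] Wi.Ind_add_monoid [simp del]

lemma pr_closed: "a \<in> carrier U \<Longrightarrow> x \<in> carrier U \<Longrightarrow> pr a x \<in> carrier W"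
  using Wi.pure_closed[of a x] by (simp add: Wi.Ind_simps)

lemma pr_add_l: "a \<in> carrier U \<Longrightarrow> b \<in> carrier U \<Longrightarrow> x \<in> carrier U \<Longrightarrow>
    pr (a \<oplus>\<^bsub>U\<^esub> b) x = pr a x \<oplus>\<^bsub>W\<^esub> pr b x"
  using pure_tensor_add_l[of a UR b x "regular_algebra U" "U\<lparr>carrier := S\<rparr>"] by (simp add: Wi.Ind_simps)

lemma pr_act: "r \<in> carrier U \<Longrightarrow> a \<in> carrier U \<Longrightarrow> x \<in> carrier U \<Longrightarrow>
    r \<odot>\<^bsub>W\<^esub> pr a x = pr a (x \<otimes>\<^bsub>U\<^esub> r)"
  using Wi.act_pure[of r a x] by simp

lemma pr_smult: "c \<in> carrier R \<Longrightarrow> a \<in> carrier U \<Longrightarrow> pr (c \<odot>\<^bsub>U\<^esub> a) \<one>\<^bsub>U\<^esub> = k c \<odot>\<^bsub>W\<^esub> pr a \<one>\<^bsub>U\<^esub>"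
  using pure_tensor_balanced[of "k c" "U\<lparr>carrier := S\<rparr>" a UR "\<one>\<^bsub>U\<^esub>" "regular_algebra U"]
  by (simp add: k_in_S k_closed U.smult_closed pr_act U.smult_mult_one_r)

text \<open>The base ring acts on \<open>W\<close> through its central image in \<open>U\<close>, so
  this action commutes with that of \<open>U\<close>. It also serves, after applying \<epsilon>, as
  the left action in \<open>fox\<close>.\<close>

definition scale_W where "scale_W c w = k c \<odot>\<^bsub>W\<^esub> w"

lemma scale_W_closed: "c \<in> carrier R \<Longrightarrow> w \<in> carrier W \<Longrightarrow> scale_W c w \<in> carrier W"
  by (simp add: scale_W_def k_closed W.ract_closed)

lemma scale_W_add: "c \<in> carrier R \<Longrightarrow> v \<in> carrier W \<Longrightarrow> w \<in> carrier W \<Longrightarrow>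
    scale_W c (v \<oplus>\<^bsub>W\<^esub> w) = scale_W c v \<oplus>\<^bsub>W\<^esub> scale_W c w"
  by (simp add: scale_W_def k_closed W.ract_add)

lemma scale_W_add_scalar: "c \<in> carrier R \<Longrightarrow> d \<in> carrier R \<Longrightarrow> w \<in> carrier W \<Longrightarrow>
    scale_W (c \<oplus>\<^bsub>R\<^esub> d) w = scale_W c w \<oplus>\<^bsub>W\<^esub> scale_W d w"
  by (simp add: scale_W_def k_closed k_add W.ract_add_scalar)

lemma scale_W_one: "w \<in> carrier W \<Longrightarrow> scale_W \<one>\<^bsub>R\<^esub> w = w"
  by (simp add: scale_W_def k_one W.ract_one)

lemma scale_W_zero: "w \<in> carrier W \<Longrightarrow> scale_W \<zero>\<^bsub>R\<^esub> w = \<zero>\<^bsub>W\<^esub>"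
  by (simp add: scale_W_def k_zero W.ract_zero_l)

lemma scale_W_zero_r: "c \<in> carrier R \<Longrightarrow> scale_W c \<zero>\<^bsub>W\<^esub> = \<zero>\<^bsub>W\<^esub>"
  by (simp add: scale_W_def k_closed W.ract_zero_r)

lemma scale_W_mult: "c \<in> carrier R \<Longrightarrow> d \<in> carrier R \<Longrightarrow> w \<in> carrier W \<Longrightarrow>
    scale_W (c \<otimes>\<^bsub>R\<^esub> d) w = scale_W c (scale_W d w)"
  using W.ract_mult[of "k d" "k c" w] k_mult[of d c]
  by (simp add: scale_W_def k_closed R.m_comm)

lemma act_scale_W: "c \<in> carrier R \<Longrightarrow> u \<in> carrier U \<Longrightarrow> w \<in> carrier W \<Longrightarrow>
    u \<odot>\<^bsub>W\<^esub> scale_W c w = scale_W c (u \<odot>\<^bsub>W\<^esub> w)"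
  by (simp add: scale_W_def k_closed U.smult_one_central flip: W.ract_mult)

lemma smult_act_W: "c \<in> carrier R \<Longrightarrow> u \<in> carrier U \<Longrightarrow> w \<in> carrier W \<Longrightarrow>
    (c \<odot>\<^bsub>U\<^esub> u) \<odot>\<^bsub>W\<^esub> w = scale_W c (u \<odot>\<^bsub>W\<^esub> w)"
  using W.ract_mult[of u "k c" w] U.smult_mult_one_r[of c u] by (simp add: scale_W_def k_closed)

text \<open>
  A homomorphism to this algebra with second component the identity is a map \<open>D\<close> with
  \<open>D (u v) = D u \<cdot> v + \<epsilon> u \<cdot> D v\<close> in its first component.
\<close>

definition fox where
  "fox = \<lparr>carrier = carrier W \<times> carrier U,
     mult = (\<lambda>(w, u) (w', u'). ((u' \<odot>\<^bsub>W\<^esub> w) \<oplus>\<^bsub>W\<^esub> scale_W (\<epsilon> u) w', u \<otimes>\<^bsub>U\<^esub> u')),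
     one = (\<zero>\<^bsub>W\<^esub>, \<one>\<^bsub>U\<^esub>), zero = (\<zero>\<^bsub>W\<^esub>, \<zero>\<^bsub>U\<^esub>),
     add = (\<lambda>(w, u) (w', u'). (w \<oplus>\<^bsub>W\<^esub> w', u \<oplus>\<^bsub>U\<^esub> u')),
     smult = (\<lambda>c (w, u). (scale_W c w, c \<odot>\<^bsub>U\<^esub> u))\<rparr>"

lemma fox_simps [simp]:
  "carrier fox = carrier W \<times> carrier U"
  "(w, u) \<otimes>\<^bsub>fox\<^esub> (w', u') = ((u' \<odot>\<^bsub>W\<^esub> w) \<oplus>\<^bsub>W\<^esub> scale_W (\<epsilon> u) w', u \<otimes>\<^bsub>U\<^esub> u')"
  "\<one>\<^bsub>fox\<^esub> = (\<zero>\<^bsub>W\<^esub>, \<one>\<^bsub>U\<^esub>)" "\<zero>\<^bsub>fox\<^esub> = (\<zero>\<^bsub>W\<^esub>, \<zero>\<^bsub>U\<^esub>)"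
  "(w, u) \<oplus>\<^bsub>fox\<^esub> (w', u') = (w \<oplus>\<^bsub>W\<^esub> w', u \<oplus>\<^bsub>U\<^esub> u')"
  "c \<odot>\<^bsub>fox\<^esub> (w, u) = (scale_W c w, c \<odot>\<^bsub>U\<^esub> u)"
  by (simp_all add: fox_def)

lemma fox_abelian: "abelian_group fox"
proof (rule abelian_groupI)
  fix x assume "x \<in> carrier fox"
  then show "\<exists>y\<in>carrier fox. y \<oplus>\<^bsub>fox\<^esub> x = \<zero>\<^bsub>fox\<^esub>"
    by (intro bexI[of _ "(\<ominus>\<^bsub>W\<^esub> fst x, \<ominus>\<^bsub>U\<^esub> snd x)"]) (auto simp: W.P.l_neg U.l_neg)
qed (clarsimp simp: W.P.a_ac U.a_ac)+

text \<open>\<open>W\<close> is a bimodule over \<open>U\<close>, with its given right action and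
  with the left action by scalars through \<epsilon>. The algebra is the square-zero extension of
  \<open>U\<close> by this bimodule; associativity rests on \<epsilon> being multiplicative and on
  scalars commuting with the right action.\<close>

lemma fox_unital_algebra: "unital_algebra R fox"
proof -
  note c = \<epsilon>_closed W.ract_closed scale_W_closed U.smult_closed
  have "monoid fox"
  proof (rule monoidI)
    fix x y z assume "x \<in> carrier fox" "y \<in> carrier fox" "z \<in> carrier fox"
    then show "x \<otimes>\<^bsub>fox\<^esub> y \<otimes>\<^bsub>fox\<^esub> z = x \<otimes>\<^bsub>fox\<^esub> (y \<otimes>\<^bsub>fox\<^esub> z)"
      by (clarsimp simp: c W.ract_add act_scale_W \<epsilon>_mult scale_W_mult scale_W_add W.ract_mult W.P.a_assoc U.m_assoc)
  qed (clarsimp simp: c W.ract_zero_r scale_W_zero_r \<epsilon>_one scale_W_one W.ract_one)+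
  moreover have "expr_model Unital (carrier R) R fox"
  proof (intro expr_model.intro expr_model_axioms.intro fox_abelian, goal_cases)
    case (4 c d x) then show ?case
      by (clarsimp simp: c scale_W_mult U.smult_assoc)
  next
    case (9 c x y) then show ?case
      by (clarsimp simp: c \<epsilon>_smult scale_W_add scale_W_mult act_scale_W U.smult_mult_l)
  next
    case (10 c x y)
    moreover have "scale_W (\<epsilon> u) (scale_W c w) = scale_W c (scale_W (\<epsilon> u) w)"
      if "u \<in> carrier U" "w \<in> carrier W" for u w
      using that 10 by (simp add: c R.m_comm flip: scale_W_mult)
    ultimately show ?case
      by (clarsimp simp: c scale_W_add smult_act_W U.smult_mult_r)
  qed (clarsimp simp: c W.ract_zero_r scale_W_zero_r \<epsilon>_one scale_W_one W.ract_one W.ract_add W.ract_add_scalar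
      scale_W_add scale_W_add_scalar U.smult_l_distr U.smult_r_distr U.smult_one U.l_distr U.r_distr \<epsilon>_add W.P.a_ac)+
  ultimately show ?thesis
    unfolding unital_algebra_def
    by (intro conjI R.is_cring ringI fox_abelian)
      (simp_all add: expr_model.mult_l_distr expr_model.mult_r_distr)
qed

sublocale F: unital_algebra R fox by (rule fox_unital_algebra)

text \<open>In terms of projections, because the values of \<open>\<theta>\<close> and
  \<open>\<Theta>\<close> are not written as pairs.\<close>

lemma fox_ops:
  "x \<oplus>\<^bsub>fox\<^esub> y = (fst x \<oplus>\<^bsub>W\<^esub> fst y, snd x \<oplus>\<^bsub>U\<^esub> snd y)"
  "x \<otimes>\<^bsub>fox\<^esub> y = ((snd y \<odot>\<^bsub>W\<^esub> fst x) \<oplus>\<^bsub>W\<^esub> scale_W (\<epsilon> (snd x)) (fst y), snd x \<otimes>\<^bsub>U\<^esub> snd y)"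
  "c \<odot>\<^bsub>fox\<^esub> x = (scale_W c (fst x), c \<odot>\<^bsub>U\<^esub> snd x)"
  by (cases x; cases y; simp)+

lemma fox_minus:
  assumes "x \<in> carrier fox"
  shows "\<ominus>\<^bsub>fox\<^esub> x = (\<ominus>\<^bsub>W\<^esub> fst x, \<ominus>\<^bsub>U\<^esub> snd x)"
  by (rule F.minus_equality) (use assms in \<open>auto simp: fox_ops W.P.l_neg U.l_neg\<close>)

lemma fox_closed: "x \<in> carrier fox \<longleftrightarrow> fst x \<in> carrier W \<and> snd x \<in> carrier U"
  by (cases x) simp

text \<open>Here the freeness of the tensor algebra enters: values may be prescribed on
  \<open>M\<close>, subject only to linearity. The second component is the algebra map from
  \<open>TA\<close> to \<open>U\<close>, the first is the derivative along it.\<close>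

definition \<theta> where "\<theta> = extend_hom fox (\<lambda>m. (pr (\<iota> (\<mu> m)) \<one>\<^bsub>U\<^esub>, \<iota> (\<mu> m)))"

lemma \<theta>_compatible: "F.compatible (\<lambda>m. (pr (\<iota> (\<mu> m)) \<one>\<^bsub>U\<^esub>, \<iota> (\<mu> m))) (carrier M) T_rel"
  unfolding T_rel_def F.compatible_Un
  by (intro conjI F.compatible_linear_rel F.compatible_assoc_rel)
    (auto simp: pr_closed \<iota>_closed \<gg>_gen \<mu>_add \<mu>_smult \<iota>_add \<iota>_smult pr_add_l pr_smult scale_W_def)

lemma \<theta>_gen: "m \<in> carrier M \<Longrightarrow> \<theta> (\<mu> m) = (pr (\<iota> (\<mu> m)) \<one>\<^bsub>U\<^esub>, \<iota> (\<mu> m))"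
  and \<theta>_closed: "x \<in> carrier TA \<Longrightarrow> \<theta> x \<in> carrier fox"
  and \<theta>_add: "x \<in> carrier TA \<Longrightarrow> y \<in> carrier TA \<Longrightarrow> \<theta> (x \<oplus>\<^bsub>TA\<^esub> y) = \<theta> x \<oplus>\<^bsub>fox\<^esub> \<theta> y"
  and \<theta>_zero: "\<theta> \<zero>\<^bsub>TA\<^esub> = \<zero>\<^bsub>fox\<^esub>"
  and \<theta>_minus: "x \<in> carrier TA \<Longrightarrow> \<theta> (\<ominus>\<^bsub>TA\<^esub> x) = \<ominus>\<^bsub>fox\<^esub> \<theta> x"
  and \<theta>_smult: "c \<in> carrier R \<Longrightarrow> x \<in> carrier TA \<Longrightarrow> \<theta> (c \<odot>\<^bsub>TA\<^esub> x) = c \<odot>\<^bsub>fox\<^esub> \<theta> x"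
  and \<theta>_mult: "x \<in> carrier TA \<Longrightarrow> y \<in> carrier TA \<Longrightarrow> \<theta> (x \<otimes>\<^bsub>TA\<^esub> y) = \<theta> x \<otimes>\<^bsub>fox\<^esub> \<theta> y"
  using F.ext_gen[OF \<theta>_compatible] F.ext_closed[OF \<theta>_compatible] F.ext_add[OF \<theta>_compatible]
    F.ext_zero[OF \<theta>_compatible] F.ext_minus[OF \<theta>_compatible] F.ext_smult[OF \<theta>_compatible]
    F.ext_mult[OF \<theta>_compatible]
  unfolding \<theta>_def \<mu>_eq TA_eq by (simp_all del: fox_simps)

definition aug_ideal :: "(('c, 'b) U_elem, ('c, 'b) U_elem) module" where
  "aug_ideal = UR\<lparr>carrier := {x \<in> carrier U. \<epsilon> x = \<zero>\<^bsub>R\<^esub>}\<rparr>"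

lemma aug_ideal_simps [simp]:
  "carrier aug_ideal = {x \<in> carrier U. \<epsilon> x = \<zero>\<^bsub>R\<^esub>}" "add aug_ideal = add U" "zero aug_ideal = zero U"
  "r \<odot>\<^bsub>aug_ideal\<^esub> x = x \<otimes>\<^bsub>U\<^esub> r"
  by (simp_all add: aug_ideal_def)

lemma aug_ideal_module: "right_module U aug_ideal"
  using right_module_kernel[OF UR_module trivial_rep_module \<epsilon>_hom] by (simp add: aug_ideal_def)

abbreviation "reduced u \<equiv> u \<ominus>\<^bsub>U\<^esub> k (\<epsilon> u)"

lemma reduced_closed: "u \<in> carrier U \<Longrightarrow> reduced u \<in> carrier aug_ideal"
  by (simp add: a_minus_def k_closed \<epsilon>_closed \<epsilon>_add \<epsilon>_minus \<epsilon>_k R.r_neg)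

text \<open>The projection onto the augmentation ideal along the scalars is shown linear over
  \<open>S\<close>, which is all that induction from \<open>S\<close> requires. It induces
  \<open>retraction\<close> on \<open>W\<close>, and it reappears as the contraction of the
  resolution of length one.\<close>

lemma reduced_hom: "(\<lambda>u. reduced u) \<in> right_module_hom (U\<lparr>carrier := S\<rparr>) UR aug_ideal"
proof (intro right_module_homI add_homI reduced_closed)
  fix u v assume "u \<in> carrier UR" "v \<in> carrier UR"
  then show "reduced (u \<oplus>\<^bsub>UR\<^esub> v) = reduced u \<oplus>\<^bsub>aug_ideal\<^esub> reduced v"
    by (simp add: a_minus_def k_closed \<epsilon>_closed \<epsilon>_add k_add U.minus_add U.a_ac)
next
  fix s u assume "s \<in> carrier (U\<lparr>carrier := S\<rparr>)" "u \<in> carrier UR"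
  then obtain c where c: "c \<in> carrier R" "s = k c" "u \<in> carrier U" by (auto elim: S_cases)
  then show "reduced (s \<odot>\<^bsub>UR\<^esub> u) = s \<odot>\<^bsub>aug_ideal\<^esub> reduced u"
    by (simp add: a_minus_def k_closed \<epsilon>_closed \<epsilon>_mult \<epsilon>_k k_mult U.l_distr U.l_minus)
qed simp_all

lemma retraction_exists: "\<exists>F. F \<in> right_module_hom U W aug_ideal \<and>
    (\<forall>a\<in>carrier U. \<forall>x\<in>carrier U. F (pr a x) = reduced a \<otimes>\<^bsub>U\<^esub> x)"
  by (rule Wi.Ind_extend[OF aug_ideal_module reduced_hom]) auto

text \<open>Project the first factor to the augmentation ideal, then multiply. The choice is
  harmless, since on \<open>W\<close> the values on pure tensors determine the map.\<close>

definition retraction where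
  "retraction = (SOME F. F \<in> right_module_hom U W aug_ideal \<and>
    (\<forall>a\<in>carrier U. \<forall>x\<in>carrier U. F (pr a x) = reduced a \<otimes>\<^bsub>U\<^esub> x))"

lemma retraction_hom: "retraction \<in> right_module_hom U W aug_ideal"
  and retraction_pr: "a \<in> carrier U \<Longrightarrow> x \<in> carrier U \<Longrightarrow> retraction (pr a x) = reduced a \<otimes>\<^bsub>U\<^esub> x"
  using someI_ex[OF retraction_exists] unfolding retraction_def by blast+

lemma retraction_closed: "w \<in> carrier W \<Longrightarrow> retraction w \<in> carrier U"
  using right_module_hom_closed[OF retraction_hom] by simp

lemma retraction_add: "v \<in> carrier W \<Longrightarrow> w \<in> carrier W \<Longrightarrow>
    retraction (v \<oplus>\<^bsub>W\<^esub> w) = retraction v \<oplus>\<^bsub>U\<^esub> retraction w"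
  using right_module_hom_add[OF retraction_hom] by simp

lemma retraction_zero: "retraction \<zero>\<^bsub>W\<^esub> = \<zero>\<^bsub>U\<^esub>"
  using right_module_hom_zero[OF retraction_hom W.P.abelian_group_axioms right_module_abelian[OF aug_ideal_module]] by simp

lemma retraction_act: "r \<in> carrier U \<Longrightarrow> w \<in> carrier W \<Longrightarrow> retraction (r \<odot>\<^bsub>W\<^esub> w) = retraction w \<otimes>\<^bsub>U\<^esub> r"
  using right_module_homD(2)[OF retraction_hom] by simp

lemma retraction_scale: "c \<in> carrier R \<Longrightarrow> w \<in> carrier W \<Longrightarrow> retraction (scale_W c w) = c \<odot>\<^bsub>U\<^esub> retraction w"
  by (simp add: scale_W_def retraction_act k_closed retraction_closed U.smult_mult_one_r)

lemma retraction_minus: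
  assumes "w \<in> carrier W"
  shows "retraction (\<ominus>\<^bsub>W\<^esub> w) = \<ominus>\<^bsub>U\<^esub> retraction w"
proof -
  have "retraction (\<ominus>\<^bsub>W\<^esub> w) \<oplus>\<^bsub>U\<^esub> retraction w = \<zero>\<^bsub>U\<^esub>"
    using assms by (simp add: W.P.l_neg retraction_zero flip: retraction_add)
  then show ?thesis using assms U.minus_equality[of "retraction (\<ominus>\<^bsub>W\<^esub> w)" "retraction w"]
    by (simp add: retraction_closed)
qed

text \<open>The Fox formula for Lie elements, needed as the generator case of
  \<open>\<Theta>_U\<close>. It contains no augmentation term, because \<epsilon> vanishes on the
  image of the Lie algebra; bracket expressions therefore reproduce themselves under the
  retraction.\<close>

lemma \<theta>_\<gg>:
  assumes "x \<in> carrier \<gg>"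
  shows "snd (\<theta> x) = \<iota> x \<and> retraction (fst (\<theta> x)) = \<iota> x"
  using assms
proof (induction rule: \<gg>_induct)
  case (gen m)
  then show ?case
    by (simp add: \<theta>_gen retraction_pr \<iota>_closed \<gg>_gen \<epsilon>_gen k_zero a_minus_def)
next
  case zero then show ?case by (simp add: \<theta>_zero retraction_zero \<iota>_zero)
next
  case (add x y)
  then have "x \<in> carrier TA" "y \<in> carrier TA" using \<gg>_subset by blast+
  then show ?case using add \<theta>_closed[of x] \<theta>_closed[of y]
    by (simp add: \<theta>_add fox_ops retraction_add \<iota>_add fox_closed del: fox_simps)
next
  case (minus x)
  then have "x \<in> carrier TA" using \<gg>_subset by blast+
  then show ?case using minus \<theta>_closed[of x]
    by (simp add: \<theta>_minus fox_minus retraction_minus \<iota>_minus fox_closed del: fox_simps)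
next
  case (smult c x)
  then have "x \<in> carrier TA" using \<gg>_subset by blast+
  then show ?case using smult \<theta>_closed[of x]
    by (simp add: \<theta>_smult fox_ops retraction_scale \<iota>_smult fox_closed del: fox_simps)
next
  case (bracket x y)
  then have x: "x \<in> carrier TA" "y \<in> carrier TA" using \<gg>_subset by blast+
  \<comment> \<open>The second term of the product rule carries the factor
    \<open>\<epsilon> (\<iota> a)\<close>, which is zero.\<close>
  have br: "\<theta> (a \<otimes>\<^bsub>TA\<^esub> b) = (\<iota> b \<odot>\<^bsub>W\<^esub> fst (\<theta> a), \<iota> a \<otimes>\<^bsub>U\<^esub> \<iota> b)"
    if "a \<in> carrier \<gg>" "b \<in> carrier \<gg>" "snd (\<theta> a) = \<iota> a" "snd (\<theta> b) = \<iota> b" for a b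
  proof -
    have "a \<in> carrier TA" "b \<in> carrier TA" using that \<gg>_subset by blast+
    then show ?thesis using that \<theta>_closed[of a] \<theta>_closed[of b]
      by (simp add: \<theta>_mult fox_ops \<epsilon>_gen scale_W_zero fox_closed W.ract_closed \<iota>_closed del: fox_simps)
  qed
  have "\<theta> (x \<otimes>\<^bsub>L\<^esub> y) = \<theta> (x \<otimes>\<^bsub>TA\<^esub> y) \<oplus>\<^bsub>fox\<^esub> \<ominus>\<^bsub>fox\<^esub> \<theta> (y \<otimes>\<^bsub>TA\<^esub> x)"
    using x by (simp add: a_minus_def \<theta>_add \<theta>_minus del: fox_simps)
  moreover have "\<theta> (y \<otimes>\<^bsub>TA\<^esub> x) \<in> carrier fox" using x by (simp add: \<theta>_closed del: fox_simps)
  ultimately have "\<theta> (x \<otimes>\<^bsub>L\<^esub> y) = ((\<iota> y \<odot>\<^bsub>W\<^esub> fst (\<theta> x)) \<oplus>\<^bsub>W\<^esub> \<ominus>\<^bsub>W\<^esub> (\<iota> x \<odot>\<^bsub>W\<^esub> fst (\<theta> y)),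
      \<iota> x \<otimes>\<^bsub>U\<^esub> \<iota> y \<oplus>\<^bsub>U\<^esub> \<ominus>\<^bsub>U\<^esub> (\<iota> y \<otimes>\<^bsub>U\<^esub> \<iota> x))"
    using bracket by (simp add: fox_minus fox_ops br del: fox_simps)
  then show ?case using bracket x \<theta>_closed[of x] \<theta>_closed[of y]
    by (simp add: \<iota>_bracket a_minus_def retraction_add retraction_minus retraction_act W.ract_closed \<iota>_closed
        fox_closed del: fox_simps TA.commutator_algebra_simps)
qed

text \<open>As an algebra map, \<open>\<theta>\<close> turns commutators into commutators, so its
  restriction to the Lie algebra satisfies the relations of \<open>U\<close>. This carries the
  derivative from \<open>TA\<close> over to \<open>U\<close>.\<close>

lemma \<Theta>_compatible: "F.compatible \<theta> (carrier \<gg>) U_rel"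
proof -
  have c: "\<theta> x \<in> carrier fox" "x \<in> carrier TA" if "x \<in> carrier \<gg>" for x
    using that \<gg>_subset \<theta>_closed by blast+
  show ?thesis
    unfolding U_rel_def F.compatible_Un
  proof (intro conjI F.compatible_linear_rel F.compatible_assoc_rel F.compatibleI)
    fix s t :: "('c, ('c, 'b) expr set) expr" assume "(s, t) \<in> {(Add (Mul (Gen x) (Gen y)) (Neg (Mul (Gen y) (Gen x))), Gen (x \<otimes>\<^bsub>\<gg>\<^esub> y)) | x y.
         x \<in> carrier \<gg> \<and> y \<in> carrier \<gg>}"
    then obtain x y where "s = Add (Mul (Gen x) (Gen y)) (Neg (Mul (Gen y) (Gen x)))"
      "t = Gen (x \<otimes>\<^bsub>L\<^esub> y)" "x \<in> carrier \<gg>" "y \<in> carrier \<gg>" by auto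
    then show "expr_eval fox \<theta> s = expr_eval fox \<theta> t"
      by (simp add: c \<theta>_add \<theta>_minus \<theta>_mult a_minus_def del: fox_simps)
  qed (use c in \<open>auto simp: \<theta>_add \<theta>_smult simp del: fox_simps\<close>)
qed

definition \<Theta> where "\<Theta> = extend_hom fox \<theta>"

lemma \<Theta>_gen: "x \<in> carrier \<gg> \<Longrightarrow> \<Theta> (\<iota> x) = \<theta> x"
  and \<Theta>_closed: "u \<in> carrier U \<Longrightarrow> \<Theta> u \<in> carrier fox"
  and \<Theta>_add: "u \<in> carrier U \<Longrightarrow> v \<in> carrier U \<Longrightarrow> \<Theta> (u \<oplus>\<^bsub>U\<^esub> v) = \<Theta> u \<oplus>\<^bsub>fox\<^esub> \<Theta> v"
  and \<Theta>_zero: "\<Theta> \<zero>\<^bsub>U\<^esub> = \<zero>\<^bsub>fox\<^esub>"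
  and \<Theta>_minus: "u \<in> carrier U \<Longrightarrow> \<Theta> (\<ominus>\<^bsub>U\<^esub> u) = \<ominus>\<^bsub>fox\<^esub> \<Theta> u"
  and \<Theta>_smult: "c \<in> carrier R \<Longrightarrow> u \<in> carrier U \<Longrightarrow> \<Theta> (c \<odot>\<^bsub>U\<^esub> u) = c \<odot>\<^bsub>fox\<^esub> \<Theta> u"
  and \<Theta>_mult: "u \<in> carrier U \<Longrightarrow> v \<in> carrier U \<Longrightarrow> \<Theta> (u \<otimes>\<^bsub>U\<^esub> v) = \<Theta> u \<otimes>\<^bsub>fox\<^esub> \<Theta> v"
  and \<Theta>_one: "\<Theta> \<one>\<^bsub>U\<^esub> = \<one>\<^bsub>fox\<^esub>"
  using F.ext_gen[OF \<Theta>_compatible] F.ext_closed[OF \<Theta>_compatible] F.ext_add[OF \<Theta>_compatible]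
    F.ext_zero[OF \<Theta>_compatible] F.ext_minus[OF \<Theta>_compatible] F.ext_smult[OF \<Theta>_compatible]
    F.ext_mult[OF \<Theta>_compatible] F.ext_one[OF \<Theta>_compatible]
  unfolding \<Theta>_def \<iota>_def U_eq by (simp_all del: fox_simps)

text \<open>The fundamental formula of Fox calculus: u - \<epsilon> u is recovered from the
  derivative of u. Both sides obey the same product rule with the twist by \<epsilon>, so the
  formula spreads from the generators to all of \<open>U\<close>.\<close>

lemma \<Theta>_U:
  assumes "u \<in> carrier U"
  shows "snd (\<Theta> u) = u \<and> retraction (fst (\<Theta> u)) = reduced u"
  using assms
proof (induction rule: U_induct)
  case (gen x)
  then show ?case by (simp add: \<Theta>_gen \<theta>_\<gg> \<epsilon>_gen k_zero a_minus_def \<iota>_closed)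
next
  case one
  show ?case by (simp add: \<Theta>_one retraction_zero \<epsilon>_one k_one a_minus_def U.r_neg)
next
  case zero
  show ?case by (simp add: \<Theta>_zero retraction_zero \<epsilon>_zero k_zero a_minus_def)
next
  case (add u v)
  then show ?case using \<Theta>_closed[of u] \<Theta>_closed[of v]
    by (simp add: \<Theta>_add fox_ops retraction_add fox_closed \<epsilon>_add k_add \<epsilon>_closed k_closed a_minus_def
        U.minus_add U.a_ac del: fox_simps)
next
  case (minus u)
  then show ?case using \<Theta>_closed[of u]
    by (simp add: \<Theta>_minus fox_minus retraction_minus fox_closed \<epsilon>_minus k_minus \<epsilon>_closed k_closed a_minus_def
        U.minus_add del: fox_simps)
next
  case (smult c u)
  have "k (c \<otimes>\<^bsub>R\<^esub> \<epsilon> u) = c \<odot>\<^bsub>U\<^esub> k (\<epsilon> u)" using smult by (simp add: U.smult_assoc \<epsilon>_closed)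
  then show ?case using smult \<Theta>_closed[of u]
    by (simp add: \<Theta>_smult fox_ops retraction_scale fox_closed \<epsilon>_smult \<epsilon>_closed k_closed a_minus_def
        U.smult_r_distr U.smult_minus del: fox_simps)
next
  case (mult u v)
  then have "retraction (fst (\<Theta> (u \<otimes>\<^bsub>U\<^esub> v))) = reduced u \<otimes>\<^bsub>U\<^esub> v \<oplus>\<^bsub>U\<^esub> k (\<epsilon> u) \<otimes>\<^bsub>U\<^esub> reduced v"
    using \<Theta>_closed[of u] \<Theta>_closed[of v]
    by (simp add: \<Theta>_mult fox_ops retraction_add retraction_act retraction_scale fox_closed \<epsilon>_closed k_closed
        W.ract_closed scale_W_closed U.smult_mult_one_l del: fox_simps)
  also have "\<dots> = reduced (u \<otimes>\<^bsub>U\<^esub> v)"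
    using mult by (simp add: a_minus_def \<epsilon>_closed k_closed \<epsilon>_mult k_mult U.l_distr U.r_distr U.l_minus U.r_minus
        U.a_assoc U.r_neg1)
  finally show ?case using mult by (simp add: \<Theta>_mult fox_ops del: fox_simps)
qed

text \<open>For u in the augmentation ideal the twisted term \<epsilon> u D v of the product rule
  disappears, and what remains is linearity for the right action.\<close>

lemma fox_derivative_hom: "(\<lambda>u. fst (\<Theta> u)) \<in> right_module_hom U aug_ideal W"
proof (intro right_module_homI add_homI)
  fix u v assume uv: "u \<in> carrier aug_ideal" "v \<in> carrier aug_ideal"
  then show "fst (\<Theta> u) \<in> carrier W" using \<Theta>_closed[of u] by (simp add: fox_closed del: fox_simps)
  show "fst (\<Theta> (u \<oplus>\<^bsub>aug_ideal\<^esub> v)) = fst (\<Theta> u) \<oplus>\<^bsub>W\<^esub> fst (\<Theta> v)"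
    using uv by (simp add: \<Theta>_add fox_ops del: fox_simps)
next
  fix r u assume "r \<in> carrier U" "u \<in> carrier aug_ideal"
  then show "fst (\<Theta> (r \<odot>\<^bsub>aug_ideal\<^esub> u)) = r \<odot>\<^bsub>W\<^esub> fst (\<Theta> u)"
    using \<Theta>_closed[of u] \<Theta>_closed[of r] \<Theta>_U[of u] \<Theta>_U[of r]
    by (simp add: \<Theta>_mult fox_ops fox_closed scale_W_zero W.ract_closed del: fox_simps)
qed

section \<open>The relative resolution of length one\<close>

lemma UR_S_module: "right_module (U\<lparr>carrier := S\<rparr>) UR"
  by (rule right_module_subring[OF UR_module S_subring])

lemma aug_ideal_projective:
  "rel_projective TYPE(('c, 'b) U_elem) U S aug_ideal"
proof (rule rel_projectiveI[OF aug_ideal_module UR_S_module S_subset fox_derivative_hom retraction_hom])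
  fix x assume "x \<in> carrier aug_ideal"
  then show "retraction (fst (\<Theta> x)) = x" by (simp add: \<Theta>_U k_zero a_minus_def)
qed

text \<open>A retract of \<open>W\<close>: the section is x \<mapsto> 1 \<otimes> x and the
  retraction is multiplication. In this way both terms of the resolution are summands of the same
  induced module.\<close>

lemma UR_projective: "rel_projective TYPE(('c, 'b) U_elem) U S UR"
proof -
  have "(\<lambda>x. x) \<in> right_module_hom (U\<lparr>carrier := S\<rparr>) UR UR"
    by (auto simp: right_module_hom_def hom_def)
  then obtain F where F: "F \<in> right_module_hom U W UR"
    "\<And>a x. a \<in> carrier UR \<Longrightarrow> x \<in> carrier U \<Longrightarrow> F (pr a x) = x \<odot>\<^bsub>UR\<^esub> a"
    using Wi.Ind_extend[OF UR_module] by blast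
  have "(\<lambda>x. pr \<one>\<^bsub>U\<^esub> x) \<in> right_module_hom U UR W"
    using pure_tensor_add_r[of "\<one>\<^bsub>U\<^esub>" UR _ "regular_algebra U" _ "U\<lparr>carrier := S\<rparr>"]
    by (intro right_module_homI add_homI) (simp_all add: pr_closed pr_act, simp add: Wi.Ind_simps)
  then show ?thesis
    by (rule rel_projectiveI[OF UR_module UR_S_module S_subset _ F(1)]) (simp add: F(2))
qed

text \<open>Fills the degrees from two on. It is cut out of \<open>UR\<close> because all terms of a
  resolution share one type.\<close>

definition zero_module :: "(('c, 'b) U_elem, ('c, 'b) U_elem) module" where
  "zero_module = UR\<lparr>carrier := {\<zero>\<^bsub>U\<^esub>}\<rparr>"

lemma zero_module_simps [simp]:
  "carrier zero_module = {\<zero>\<^bsub>U\<^esub>}" "add zero_module = add U" "zero zero_module = zero U"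
  "r \<odot>\<^bsub>zero_module\<^esub> x = x \<otimes>\<^bsub>U\<^esub> r"
  by (simp_all add: zero_module_def)

lemma zero_module_module: "right_module U zero_module"
proof -
  have id: "(\<lambda>x. x) \<in> right_module_hom U UR UR" by (auto simp: right_module_hom_def hom_def)
  have "{x \<in> carrier UR. x = \<zero>\<^bsub>UR\<^esub>} = {\<zero>\<^bsub>U\<^esub>}" by auto
  then have "zero_module = UR\<lparr>carrier := {x \<in> carrier UR. x = \<zero>\<^bsub>UR\<^esub>}\<rparr>"
    by (simp only: zero_module_def)
  then show ?thesis using right_module_kernel[OF UR_module UR_module id] by (simp only:)
qed

lemma zero_module_projective: "rel_projective TYPE(('c, 'b) U_elem) U S zero_module"
  by (rule rel_projectiveI[OF zero_module_module UR_S_module S_subset,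
        where h = "\<lambda>_. \<zero>\<^bsub>W\<^esub>" and r = "\<lambda>_. \<zero>\<^bsub>U\<^esub>"])
    (auto intro!: right_module_homI add_homI simp: W.ract_zero_r)

lemma unit_hom: "k \<in> right_module_hom (U\<lparr>carrier := S\<rparr>) (trivial_rep R) UR"
proof (intro right_module_homI add_homI)
  fix s c assume "s \<in> carrier (U\<lparr>carrier := S\<rparr>)"
    "c \<in> carrier (trivial_rep R :: (('c, 'b) U_elem, 'c) module)"
  then obtain d where "d \<in> carrier R" "s = k d" "c \<in> carrier R" by (auto elim: S_cases)
  then show "k (s \<odot>\<^bsub>trivial_rep R\<^esub> c) = s \<odot>\<^bsub>UR\<^esub> k c"
    by (simp add: \<epsilon>_k k_mult R.m_comm[of d])
qed (simp_all add: k_closed k_add)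

lemma aug_ideal_inclusion: "(\<lambda>x. x) \<in> right_module_hom U aug_ideal UR"
  by (auto simp: right_module_hom_def hom_def)

lemma augmentation_splitting: "u \<in> carrier U \<Longrightarrow> reduced u \<oplus>\<^bsub>U\<^esub> k (\<epsilon> u) = u"
  by (simp add: a_minus_def k_closed \<epsilon>_closed U.a_assoc U.l_neg)

text \<open>The augmentation ideal includes into \<open>U\<close> with cokernel the base ring, and
  over \<open>S\<close> the maps \<open>k\<close> and \<open>reduced\<close> split this
  sequence.\<close>

theorem RT_resolution_exists:
  "\<exists>(P :: nat \<Rightarrow> (('c, 'b) U_elem, ('c, 'b) U_elem) module) d e.
     RT_resolution TYPE(('c, 'b) U_elem) R \<gg> P d e"
proof -
  define P where "P n = (case n of 0 \<Rightarrow> UR | Suc 0 \<Rightarrow> aug_ideal | _ \<Rightarrow> zero_module)" for n :: nat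
  define d :: "nat \<Rightarrow> ('c, 'b) U_elem \<Rightarrow> ('c, 'b) U_elem"
    where "d n x = (if n = 0 then x else \<zero>\<^bsub>U\<^esub>)" for n x
  define s :: "nat \<Rightarrow> ('c, 'b) U_elem \<Rightarrow> ('c, 'b) U_elem"
    where "s n x = (if n = 0 then reduced x else \<zero>\<^bsub>U\<^esub>)" for n x
  have P: "P 0 = UR" "P (Suc 0) = aug_ideal" "P (Suc (Suc n)) = zero_module" for n
    by (simp_all add: P_def)
  \<comment> \<open>The terms differ in their carriers only; the operations are those of
    \<open>UR\<close>.\<close>
  have zero_P: "\<zero>\<^bsub>P n\<^esub> = \<zero>\<^bsub>U\<^esub>" "add (P n) = add U" "r \<odot>\<^bsub>P n\<^esub> x = x \<otimes>\<^bsub>U\<^esub> r" for n r x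
    by (auto simp: P_def split: nat.split)
  have sub: "carrier (P n) \<subseteq> carrier U" "\<zero>\<^bsub>U\<^esub> \<in> carrier (P n)" for n
    by (auto simp: P_def \<epsilon>_zero split: nat.split)
  have zh: "(\<lambda>_. \<zero>\<^bsub>U\<^esub>) \<in> right_module_hom B (P n) (P m)" if "carrier B \<subseteq> carrier U" for n m
    and B :: "('c, ('c, 'b) U_elem) module"
    using that by (intro right_module_homI add_homI) (auto simp: zero_P sub subsetD)
  have "rel_projective TYPE(('c, 'b) U_elem) U S (P n)" for n
    by (auto simp: P_def UR_projective aug_ideal_projective zero_module_projective split: nat.split)
  moreover have "d n \<in> right_module_hom U (P (Suc n)) (P n)" for n
    using zh[of U "Suc n" n] aug_ideal_inclusion
    by (cases n) (simp_all add: d_def[abs_def] P)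
  moreover have "\<epsilon> \<in> right_module_hom U (P 0) (trivial_rep R)" by (simp add: P \<epsilon>_hom)
  moreover have "d n (d (Suc n) x) = \<zero>\<^bsub>P n\<^esub>" for n x by (simp add: d_def zero_P)
  moreover have "\<epsilon> (d 0 x) = \<zero>\<^bsub>trivial_rep R :: (('c, 'b) U_elem, 'c) module\<^esub>"
    if "x \<in> carrier (P 1)" for x using that by (simp add: d_def P)
  moreover have "k \<in> right_module_hom (U\<lparr>carrier := S\<rparr>) (trivial_rep R) (P 0)" by (simp add: P unit_hom)
  moreover have "s n \<in> right_module_hom (U\<lparr>carrier := S\<rparr>) (P n) (P (Suc n))" for n
    using zh[of "U\<lparr>carrier := S\<rparr>" n "Suc n"] reduced_hom S_subset
    by (cases n) (simp_all add: s_def[abs_def] P)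
  moreover have "\<epsilon> (k y) = y" if "y \<in> carrier (trivial_rep R :: (('c, 'b) U_elem, 'c) module)" for y
    using that by (simp add: \<epsilon>_k)
  moreover have "d 0 (s 0 x) \<oplus>\<^bsub>P 0\<^esub> k (\<epsilon> x) = x" if "x \<in> carrier (P 0)" for x
    using that by (simp add: d_def s_def P augmentation_splitting)
  moreover have "d (Suc n) (s (Suc n) x) \<oplus>\<^bsub>P (Suc n)\<^esub> s n (d n x) = x" if "x \<in> carrier (P (Suc n))" for n x
    using that by (cases n) (simp_all add: d_def s_def P k_zero a_minus_def)
  ultimately have "RT_resolution TYPE(('c, 'b) U_elem) R \<gg> P d \<epsilon>"
    unfolding RT_resolution_def rel_projective_resolution_def by blast
  then show ?thesis by blast
qed

text \<open>The small complex in \<open>resolution_homotopy\<close> is the inclusion of the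
  augmentation ideal into \<open>U\<close>. Its \<open>S\<close>-linear left inverse is
  \<open>reduced\<close>, the identity on elements of augmentation zero.\<close>

theorem RT_homology_trivial:
  fixes P :: "nat \<Rightarrow> (('c, 'b) U_elem, 'p) module"
  assumes res: "RT_resolution ty R \<gg> P d e"
  shows "carrier (RT_homology R \<gg> P d 2) = {\<one>\<^bsub>RT_homology R \<gg> P d 2\<^esub>}"
proof -
  note res' = res[unfolded RT_resolution_def]
  obtain h1 h2 where h: "h1 \<in> right_module_hom U (P 1) (P 2)" "h2 \<in> right_module_hom U (P 2) (P 3)"
    "\<And>x. x \<in> carrier (P 2) \<Longrightarrow> d 2 (h2 x) \<oplus>\<^bsub>P 2\<^esub> h1 (d 1 x) = x"
    by (rule resolution_homotopy[OF res' trivial_rep_module S_subset UR_projective aug_ideal_projective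
        aug_ideal_inclusion \<epsilon>_hom _ unit_hom reduced_hom])
      (simp_all add: \<epsilon>_k augmentation_splitting, simp add: k_zero a_minus_def)
  have "carrier (tensor_complex_homology U P d (trivial_rep R) (Suc (Suc 0)))
    = {\<one>\<^bsub>tensor_complex_homology U P d (trivial_rep R) (Suc (Suc 0))\<^esub>}"
  proof (rule tensor_complex_homology_trivial[where ?h1.0 = h1 and ?h2.0 = h2])
    show "right_module U (P n)" for n by (rule rel_projective_right_module[OF resolutionD(1)[OF res']])
  qed (use h resolutionD(2,4)[OF res'] in \<open>simp_all add: numeral_2_eq_2 numeral_3_eq_3\<close>)
  then show ?thesis by (simp add: RT_homology_def numeral_2_eq_2)
qed

end

section \<open>Quotients of coordinate modules and square-zero extensions\<close>

lemma coord_module_simps [simp]: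
  "carrier (coord_module R) = {v. \<forall>i. v i \<in> carrier R}"
  "v \<oplus>\<^bsub>coord_module R\<^esub> w = (\<lambda>i. v i \<oplus>\<^bsub>R\<^esub> w i)"
  "\<zero>\<^bsub>coord_module R\<^esub> = (\<lambda>_. \<zero>\<^bsub>R\<^esub>)"
  "c \<odot>\<^bsub>coord_module R\<^esub> v = (\<lambda>i. c \<otimes>\<^bsub>R\<^esub> v i)"
  by (simp_all add: coord_module_def)

lemma (in cring) coord_module_model:
  "expr_model Linear (carrier R) R (coord_module R :: ('a, 'i \<Rightarrow> 'a) module)"
proof -
  have "abelian_group (coord_module R :: ('a, 'i \<Rightarrow> 'a) module)"
  proof (rule abelian_groupI)
    fix v :: "'i \<Rightarrow> 'a" assume "v \<in> carrier (coord_module R)"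
    then show "\<exists>w\<in>carrier (coord_module R). w \<oplus>\<^bsub>coord_module R\<^esub> v = \<zero>\<^bsub>coord_module R\<^esub>"
      by (intro bexI[of _ "\<lambda>i. \<ominus> v i"]) (auto simp: l_neg)
  qed (auto simp: a_ac)
  then show ?thesis
    by (intro expr_model.intro expr_model_axioms.intro) (auto simp: l_distr r_distr m_assoc)
qed

lemma (in cring) finsum_coord_module:
  fixes f :: "'j \<Rightarrow> 'i \<Rightarrow> 'a"
  assumes "finite A" "f \<in> A \<rightarrow> carrier (coord_module R)"
  shows "finsum (coord_module R) f A i = (\<Oplus>j\<in>A. f j i)"
  using assms
proof (induction A)
  case empty
  interpret c: expr_model Linear "carrier R" R "coord_module R :: ('a, 'i \<Rightarrow> 'a) module"
    by (rule coord_module_model)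
  show ?case by simp
next
  case (insert x A)
  interpret c: expr_model Linear "carrier R" R "coord_module R :: ('a, 'i \<Rightarrow> 'a) module"
    by (rule coord_module_model)
  have "f \<in> A \<rightarrow> carrier (coord_module R)" "f x \<in> carrier (coord_module R)" using insert by auto
  moreover have "(\<lambda>j. f j i) \<in> A \<rightarrow> carrier R" "f x i \<in> carrier R" using insert by auto
  ultimately show ?case using insert by simp
qed

text \<open>Identifies the relation in the definition of \<open>MM\<close> with the vector
  \<open>tt\<close> itself.\<close>

lemma (in cring) sum_unit_vectors:
  fixes t :: "'i :: finite \<Rightarrow> 'a"
  assumes "\<And>i. t i \<in> carrier R"
  shows "(\<Oplus>\<^bsub>coord_module R\<^esub>i\<in>UNIV. t i \<odot>\<^bsub>coord_module R\<^esub> unit_vector R i) = t"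
proof
  fix j
  have "(\<Oplus>\<^bsub>coord_module R\<^esub>i\<in>UNIV. t i \<odot>\<^bsub>coord_module R\<^esub> unit_vector R i) j
    = (\<Oplus>i\<in>UNIV. t i \<otimes> unit_vector R i j)"
    using assms by (subst finsum_coord_module) (auto simp: unit_vector_def)
  also have "\<dots> = (\<Oplus>i\<in>UNIV. if j = i then t i else \<zero>)"
    using assms by (intro finsum_cong') (auto simp: unit_vector_def)
  also have "\<dots> = t j"
    using assms add.finprod_singleton[of j UNIV t] by (simp add: Pi_def)
  finally show "(\<Oplus>\<^bsub>coord_module R\<^esub>i\<in>UNIV. t i \<odot>\<^bsub>coord_module R\<^esub> unit_vector R i) j = t j" .
qed

section \<open>The quotient of a module by one element\<close>

locale quotient_by = cring R + V: expr_model Linear "carrier R" R V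
  for R :: "('c, 'r) ring_scheme" (structure) and V :: "('c, 'b) module" +
  fixes r :: 'b
  assumes r_closed: "r \<in> carrier V"
begin

abbreviation "N \<equiv> cyclic_submodule R V r"
abbreviation "Q \<equiv> quotient_module V N"

definition coset where "coset v = N +>\<^bsub>V\<^esub> v"

lemma coset_alt: "coset v = {(c \<odot>\<^bsub>V\<^esub> r) \<oplus>\<^bsub>V\<^esub> v | c. c \<in> carrier R}"
  by (auto simp: coset_def a_r_coset_def' cyclic_submodule_def)

lemma zero_smult: "x \<in> carrier V \<Longrightarrow> \<zero> \<odot>\<^bsub>V\<^esub> x = \<zero>\<^bsub>V\<^esub>"
  by (rule V.smult_zero) simp_all

lemma mem_cosetI: "c \<in> carrier R \<Longrightarrow> (c \<odot>\<^bsub>V\<^esub> r) \<oplus>\<^bsub>V\<^esub> v \<in> coset v"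
  by (auto simp: coset_alt)

lemma self_mem_coset: "v \<in> carrier V \<Longrightarrow> v \<in> coset v"
  using mem_cosetI[of \<zero> v] by (simp add: zero_smult r_closed)

lemma coset_shift:
  assumes "d \<in> carrier R" "v \<in> carrier V"
  shows "coset ((d \<odot>\<^bsub>V\<^esub> r) \<oplus>\<^bsub>V\<^esub> v) = coset v"
proof -
  have 1: "(c \<odot>\<^bsub>V\<^esub> r) \<oplus>\<^bsub>V\<^esub> ((d \<odot>\<^bsub>V\<^esub> r) \<oplus>\<^bsub>V\<^esub> v) = ((c \<oplus> d) \<odot>\<^bsub>V\<^esub> r) \<oplus>\<^bsub>V\<^esub> v" if "c \<in> carrier R" for c
    using that assms by (simp add: V.smult_l_distr V.smult_closed r_closed V.a_assoc)
  have 2: "(c \<odot>\<^bsub>V\<^esub> r) \<oplus>\<^bsub>V\<^esub> v = ((c \<ominus> d) \<odot>\<^bsub>V\<^esub> r) \<oplus>\<^bsub>V\<^esub> ((d \<odot>\<^bsub>V\<^esub> r) \<oplus>\<^bsub>V\<^esub> v)" if "c \<in> carrier R" for c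
    using 1[of "c \<ominus> d"] that assms by (simp add: a_minus_def a_assoc l_neg)
  show ?thesis
  proof (intro equalityI subsetI)
    fix x assume "x \<in> coset ((d \<odot>\<^bsub>V\<^esub> r) \<oplus>\<^bsub>V\<^esub> v)"
    then obtain c where "c \<in> carrier R" "x = (c \<odot>\<^bsub>V\<^esub> r) \<oplus>\<^bsub>V\<^esub> ((d \<odot>\<^bsub>V\<^esub> r) \<oplus>\<^bsub>V\<^esub> v)"
      unfolding coset_alt by blast
    then show "x \<in> coset v" using 1 mem_cosetI[of "c \<oplus> d" v] assms by simp
  next
    fix x assume "x \<in> coset v"
    then obtain c where "c \<in> carrier R" "x = (c \<odot>\<^bsub>V\<^esub> r) \<oplus>\<^bsub>V\<^esub> v"
      unfolding coset_alt by blast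
    then show "x \<in> coset ((d \<odot>\<^bsub>V\<^esub> r) \<oplus>\<^bsub>V\<^esub> v)"
      using 2[of c] mem_cosetI[of "c \<ominus> d" "(d \<odot>\<^bsub>V\<^esub> r) \<oplus>\<^bsub>V\<^esub> v"] assms by simp
  qed
qed

lemma carrier_Q: "carrier Q = {coset v | v. v \<in> carrier V}"
  by (auto simp: quotient_module_def A_RCOSETS_def' coset_def)

lemma coset_mem_Q: "v \<in> carrier V \<Longrightarrow> coset v \<in> carrier Q"
  by (auto simp: carrier_Q)

lemma mem_coset_closed: "x \<in> coset v \<Longrightarrow> v \<in> carrier V \<Longrightarrow> x \<in> carrier V"
  by (auto simp: coset_alt V.smult_closed r_closed)

lemma Q_add:
  assumes "v \<in> carrier V" "w \<in> carrier V"
  shows "coset v \<oplus>\<^bsub>Q\<^esub> coset w = coset (v \<oplus>\<^bsub>V\<^esub> w)"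
proof -
  have eq: "((c \<odot>\<^bsub>V\<^esub> r) \<oplus>\<^bsub>V\<^esub> v) \<oplus>\<^bsub>V\<^esub> ((d \<odot>\<^bsub>V\<^esub> r) \<oplus>\<^bsub>V\<^esub> w) = ((c \<oplus> d) \<odot>\<^bsub>V\<^esub> r) \<oplus>\<^bsub>V\<^esub> (v \<oplus>\<^bsub>V\<^esub> w)"
    if "c \<in> carrier R" "d \<in> carrier R" for c d
    using that assms by (simp add: V.smult_l_distr V.smult_closed r_closed V.a_ac)
  have "coset v <+>\<^bsub>V\<^esub> coset w = coset (v \<oplus>\<^bsub>V\<^esub> w)"
  proof (intro equalityI subsetI)
    fix x assume "x \<in> coset v <+>\<^bsub>V\<^esub> coset w"
    then obtain c d where "c \<in> carrier R" "d \<in> carrier R"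
      "x = ((c \<odot>\<^bsub>V\<^esub> r) \<oplus>\<^bsub>V\<^esub> v) \<oplus>\<^bsub>V\<^esub> ((d \<odot>\<^bsub>V\<^esub> r) \<oplus>\<^bsub>V\<^esub> w)"
      unfolding set_add_def' coset_alt by blast
    then show "x \<in> coset (v \<oplus>\<^bsub>V\<^esub> w)" using eq mem_cosetI by simp
  next
    fix x assume "x \<in> coset (v \<oplus>\<^bsub>V\<^esub> w)"
    then obtain c where c: "c \<in> carrier R" "x = (c \<odot>\<^bsub>V\<^esub> r) \<oplus>\<^bsub>V\<^esub> (v \<oplus>\<^bsub>V\<^esub> w)"
      unfolding coset_alt by blast
    then have "x = ((c \<odot>\<^bsub>V\<^esub> r) \<oplus>\<^bsub>V\<^esub> v) \<oplus>\<^bsub>V\<^esub> w"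
      using assms by (simp add: V.a_assoc V.smult_closed r_closed)
    then show "x \<in> coset v <+>\<^bsub>V\<^esub> coset w"
      unfolding set_add_def' using mem_cosetI[OF c(1)] self_mem_coset[OF assms(2)] by blast
  qed
  then show ?thesis by (simp add: quotient_module_def)
qed

lemma Q_zero: "\<zero>\<^bsub>Q\<^esub> = coset \<zero>\<^bsub>V\<^esub>"
proof -
  have "\<zero>\<^bsub>Q\<^esub> = (\<lambda>c. c \<odot>\<^bsub>V\<^esub> r) ` carrier R"
    by (simp add: quotient_module_def cyclic_submodule_def Setcompr_eq_image)
  also have "\<dots> = (\<lambda>c. (c \<odot>\<^bsub>V\<^esub> r) \<oplus>\<^bsub>V\<^esub> \<zero>\<^bsub>V\<^esub>) ` carrier R"
    by (rule image_cong) (simp_all add: V.smult_closed r_closed)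
  finally show ?thesis unfolding coset_alt Setcompr_eq_image .
qed

text \<open>The quotient defines scaling as a union over all representatives. Multiples of two
  representatives differ by a multiple of \<open>r\<close>, so the union has only one distinct
  member.\<close>

lemma Q_smult:
  assumes "c \<in> carrier R" "v \<in> carrier V"
  shows "c \<odot>\<^bsub>Q\<^esub> coset v = coset (c \<odot>\<^bsub>V\<^esub> v)"
proof -
  have "coset (c \<odot>\<^bsub>V\<^esub> x) = coset (c \<odot>\<^bsub>V\<^esub> v)" if "x \<in> coset v" for x
  proof -
    from that obtain d where "d \<in> carrier R" "x = (d \<odot>\<^bsub>V\<^esub> r) \<oplus>\<^bsub>V\<^esub> v"
      by (auto simp: coset_alt)
    then have "c \<odot>\<^bsub>V\<^esub> x = ((c \<otimes> d) \<odot>\<^bsub>V\<^esub> r) \<oplus>\<^bsub>V\<^esub> (c \<odot>\<^bsub>V\<^esub> v)"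
      using assms by (simp add: V.smult_r_distr V.smult_assoc V.smult_closed r_closed)
    then show ?thesis using assms \<open>d \<in> carrier R\<close> by (simp add: coset_shift V.smult_closed)
  qed
  then have "(\<Union>x\<in>coset v. coset (c \<odot>\<^bsub>V\<^esub> x)) = (\<Union>x\<in>coset v. coset (c \<odot>\<^bsub>V\<^esub> v))"
    by (intro SUP_cong refl)
  also have "\<dots> = coset (c \<odot>\<^bsub>V\<^esub> v)" using self_mem_coset[OF assms(2)] by blast
  finally show ?thesis by (simp add: quotient_module_def coset_def)
qed

lemma Q_cases: "x \<in> carrier Q \<Longrightarrow> \<exists>v\<in>carrier V. x = coset v"
  by (auto simp: carrier_Q)

lemma Q_model: "expr_model Linear (carrier R) R Q"
proof -
  have "abelian_group Q"
  proof (rule abelian_groupI)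
    fix x assume "x \<in> carrier Q"
    then obtain v where v: "x = coset v" "v \<in> carrier V" by (auto simp: carrier_Q)
    then have "coset (\<ominus>\<^bsub>V\<^esub> v) \<oplus>\<^bsub>Q\<^esub> x = \<zero>\<^bsub>Q\<^esub>" by (simp add: Q_add V.l_neg Q_zero)
    then show "\<exists>y\<in>carrier Q. y \<oplus>\<^bsub>Q\<^esub> x = \<zero>\<^bsub>Q\<^esub>" using v coset_mem_Q[of "\<ominus>\<^bsub>V\<^esub> v"] by auto
  qed (auto dest!: Q_cases simp: Q_zero Q_add V.a_ac coset_mem_Q)
  then show ?thesis
    by (intro expr_model.intro expr_model_axioms.intro)
      (auto dest!: Q_cases simp: Q_add Q_smult V.smult_l_distr V.smult_r_distr V.smult_assoc V.smult_one
        V.smult_closed coset_mem_Q)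
qed

end

text \<open>A commutative algebra, so algebra maps into it kill all commutators. With
  \<open>M\<close> as the second summand it detects the part of weight one of a tensor.\<close>

definition square_zero_extension ::
    "('c, 'r) ring_scheme \<Rightarrow> ('c, 'b, 'm) module_scheme \<Rightarrow> ('c, 'c \<times> 'b) module" where
  "square_zero_extension R V = \<lparr>carrier = carrier R \<times> carrier V,
     mult = (\<lambda>(a, v) (b, w). (a \<otimes>\<^bsub>R\<^esub> b, (a \<odot>\<^bsub>V\<^esub> w) \<oplus>\<^bsub>V\<^esub> (b \<odot>\<^bsub>V\<^esub> v))),
     one = (\<one>\<^bsub>R\<^esub>, \<zero>\<^bsub>V\<^esub>), zero = (\<zero>\<^bsub>R\<^esub>, \<zero>\<^bsub>V\<^esub>),
     add = (\<lambda>(a, v) (b, w). (a \<oplus>\<^bsub>R\<^esub> b, v \<oplus>\<^bsub>V\<^esub> w)),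
     smult = (\<lambda>c (a, v). (c \<otimes>\<^bsub>R\<^esub> a, c \<odot>\<^bsub>V\<^esub> v))\<rparr>"

lemma square_zero_simps [simp]:
  "carrier (square_zero_extension R V) = carrier R \<times> carrier V"
  "(a, v) \<otimes>\<^bsub>square_zero_extension R V\<^esub> (b, w) = (a \<otimes>\<^bsub>R\<^esub> b, (a \<odot>\<^bsub>V\<^esub> w) \<oplus>\<^bsub>V\<^esub> (b \<odot>\<^bsub>V\<^esub> v))"
  "\<one>\<^bsub>square_zero_extension R V\<^esub> = (\<one>\<^bsub>R\<^esub>, \<zero>\<^bsub>V\<^esub>)" "\<zero>\<^bsub>square_zero_extension R V\<^esub> = (\<zero>\<^bsub>R\<^esub>, \<zero>\<^bsub>V\<^esub>)"
  "(a, v) \<oplus>\<^bsub>square_zero_extension R V\<^esub> (b, w) = (a \<oplus>\<^bsub>R\<^esub> b, v \<oplus>\<^bsub>V\<^esub> w)"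
  "c \<odot>\<^bsub>square_zero_extension R V\<^esub> (a, v) = (c \<otimes>\<^bsub>R\<^esub> a, c \<odot>\<^bsub>V\<^esub> v)"
  by (simp_all add: square_zero_extension_def)

lemma square_zero_unital_algebra:
  fixes V :: "('c, 'b, 'm) module_scheme" and R :: "('c, 'r) ring_scheme"
  assumes R: "cring R" and V: "expr_model Linear (carrier R) R V"
  shows "unital_algebra R (square_zero_extension R V)"
proof -
  interpret R: cring R by fact
  interpret V: expr_model Linear "carrier R" R V by fact
  let ?E = "square_zero_extension R V"
  have zero_r: "c \<odot>\<^bsub>V\<^esub> \<zero>\<^bsub>V\<^esub> = \<zero>\<^bsub>V\<^esub>" if "c \<in> carrier R" for c
    by (rule add_hom_zero[OF _ V.abelian_group_axioms V.abelian_group_axioms])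
      (use that in \<open>auto intro!: add_homI simp: V.smult_closed V.smult_r_distr\<close>)
  have zero_l: "\<zero>\<^bsub>R\<^esub> \<odot>\<^bsub>V\<^esub> v = \<zero>\<^bsub>V\<^esub>" if "v \<in> carrier V" for v
    using that by (simp add: V.smult_zero)
  have swap: "a \<odot>\<^bsub>V\<^esub> (b \<odot>\<^bsub>V\<^esub> v) = b \<odot>\<^bsub>V\<^esub> (a \<odot>\<^bsub>V\<^esub> v)"
    if "a \<in> carrier R" "b \<in> carrier R" "v \<in> carrier V" for a b v
    using that by (simp add: R.m_comm flip: V.smult_assoc)
  have ab: "abelian_group ?E"
  proof (rule abelian_groupI)
    fix x assume "x \<in> carrier ?E"
    then show "\<exists>y\<in>carrier ?E. y \<oplus>\<^bsub>?E\<^esub> x = \<zero>\<^bsub>?E\<^esub>"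
      by (intro bexI[of _ "(\<ominus>\<^bsub>R\<^esub> fst x, \<ominus>\<^bsub>V\<^esub> snd x)"]) (auto simp: V.l_neg R.l_neg)
  qed (clarsimp simp: R.a_ac V.a_ac)+
  have "monoid ?E"
    by (rule monoidI)
      (clarsimp simp: V.smult_closed zero_r V.smult_one V.smult_assoc V.smult_r_distr R.m_assoc V.a_assoc swap)+
  moreover have "expr_model Unital (carrier R) R ?E"
    by (intro expr_model.intro expr_model_axioms.intro ab)
      (clarsimp simp: V.smult_closed zero_r zero_l V.smult_one V.smult_assoc V.smult_r_distr V.smult_l_distr
        R.m_ac R.l_distr R.r_distr V.a_ac swap)+
  ultimately show ?thesis
    unfolding unital_algebra_def
    by (intro conjI R ringI ab) (simp_all add: expr_model.mult_l_distr expr_model.mult_r_distr)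
qed

lemma square_zero_commute:
  assumes "cring R" "expr_model Linear (carrier R) R V"
    and "x \<in> carrier (square_zero_extension R V)" "y \<in> carrier (square_zero_extension R V)"
  shows "x \<otimes>\<^bsub>square_zero_extension R V\<^esub> y = y \<otimes>\<^bsub>square_zero_extension R V\<^esub> x"
proof -
  interpret R: cring R by fact
  interpret V: expr_model Linear "carrier R" R V by fact
  show ?thesis using assms(3,4) by (clarsimp simp: R.m_comm V.smult_closed V.a_comm)
qed

section \<open>The Chevalley--Eilenberg complex in low degrees\<close>

lemma exterior_model: "expr_model Linear (carrier R) R (exterior_power R g n)"
  unfolding exterior_power_def exterior_exprs_def by (rule presented_model)

lemma wedge_alt: "wedge R g xs = expr_class R (exterior_exprs R g (length xs)) (exterior_rel R g) (Gen xs)"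
  by (simp add: wedge_def expr_class_def)

lemma wedge_closed:
  "set xs \<subseteq> carrier g \<Longrightarrow> length xs = n \<Longrightarrow> wedge R g xs \<in> carrier (exterior_power R g n)"
  unfolding wedge_alt exterior_power_def
  by (auto simp: exterior_exprs_def intro!: expr_class_in_presented)

lemma wedge_add:
  assumes "set (us @ [x, y, x \<oplus>\<^bsub>g\<^esub> y] @ vs) \<subseteq> carrier g" "length (us @ [x] @ vs) = n"
  shows "wedge R g (us @ [x \<oplus>\<^bsub>g\<^esub> y] @ vs)
    = wedge R g (us @ [x] @ vs) \<oplus>\<^bsub>exterior_power R g n\<^esub> wedge R g (us @ [y] @ vs)"
proof -
  have "(Gen (us @ [x \<oplus>\<^bsub>g\<^esub> y] @ vs), Add (Gen (us @ [x] @ vs)) (Gen (us @ [y] @ vs))) \<in> exterior_rel R g"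
    using assms unfolding exterior_rel_def by auto
  then show ?thesis using assms unfolding wedge_alt exterior_power_def exterior_exprs_def
    by (clarsimp simp: presented_add expr_class_relI)
qed

lemma wedge_smult:
  assumes "set (us @ [x, c \<odot>\<^bsub>g\<^esub> x] @ vs) \<subseteq> carrier g" "length (us @ [x] @ vs) = n" "c \<in> carrier R"
  shows "wedge R g (us @ [c \<odot>\<^bsub>g\<^esub> x] @ vs) = c \<odot>\<^bsub>exterior_power R g n\<^esub> wedge R g (us @ [x] @ vs)"
proof -
  have "(Gen (us @ [c \<odot>\<^bsub>g\<^esub> x] @ vs), Scale c (Gen (us @ [x] @ vs))) \<in> exterior_rel R g"
    using assms unfolding exterior_rel_def by auto
  then show ?thesis using assms unfolding wedge_alt exterior_power_def exterior_exprs_def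
    by (clarsimp simp: presented_smult expr_class_relI)
qed

text \<open>\<open>exterior_rel\<close> speaks of an arbitrary position in a list. In length two
  only finitely many positions are left, and the premises list them;
  \<open>compatible_exterior3\<close> does the same for triples.\<close>

lemma (in expr_model) compatible_exterior2:
  fixes g :: "('c, 'd, 'n) module_scheme"
  assumes K: "K = Linear" "C = carrier R"
    and cl: "\<And>x y. x \<in> carrier g \<Longrightarrow> y \<in> carrier g \<Longrightarrow> f [x, y] \<in> carrier A"
    and add1: "\<And>x x' y. x \<in> carrier g \<Longrightarrow> x' \<in> carrier g \<Longrightarrow> x \<oplus>\<^bsub>g\<^esub> x' \<in> carrier g \<Longrightarrow> y \<in> carrier g \<Longrightarrow>
      f [x \<oplus>\<^bsub>g\<^esub> x', y] = f [x, y] \<oplus> f [x', y]"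
    and add2: "\<And>x y y'. x \<in> carrier g \<Longrightarrow> y \<in> carrier g \<Longrightarrow> y' \<in> carrier g \<Longrightarrow> y \<oplus>\<^bsub>g\<^esub> y' \<in> carrier g \<Longrightarrow>
      f [x, y \<oplus>\<^bsub>g\<^esub> y'] = f [x, y] \<oplus> f [x, y']"
    and sm1: "\<And>c x y. c \<in> carrier R \<Longrightarrow> x \<in> carrier g \<Longrightarrow> c \<odot>\<^bsub>g\<^esub> x \<in> carrier g \<Longrightarrow> y \<in> carrier g \<Longrightarrow>
      f [c \<odot>\<^bsub>g\<^esub> x, y] = c \<odot>\<^bsub>A\<^esub> f [x, y]"
    and sm2: "\<And>c x y. c \<in> carrier R \<Longrightarrow> x \<in> carrier g \<Longrightarrow> y \<in> carrier g \<Longrightarrow> c \<odot>\<^bsub>g\<^esub> y \<in> carrier g \<Longrightarrow>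
      f [x, c \<odot>\<^bsub>g\<^esub> y] = c \<odot>\<^bsub>A\<^esub> f [x, y]"
    and alt: "\<And>x. x \<in> carrier g \<Longrightarrow> f [x, x] = \<zero>"
  shows "compatible f {xs. set xs \<subseteq> carrier g \<and> length xs = 2} (exterior_rel R g)"
proof (rule compatibleI)
  fix xs assume "xs \<in> {xs. set xs \<subseteq> carrier g \<and> length xs = 2}"
  then show "f xs \<in> carrier A" by (auto simp: numeral_2_eq_2 length_Suc_conv cl)
next
  \<comment> \<open>Besides the entry that varies there is exactly one other, before it or after
    it.\<close>
  have cases: "(us = [] \<and> (\<exists>v. vs = [v])) \<or> (\<exists>u. us = [u] \<and> vs = [])"
    if "length us + length vs = Suc 0" for us vs :: "'x list"
    using that by (cases us; cases vs) auto
  fix s t :: "('c, 'd list) expr"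
  assume "(s, t) \<in> exterior_rel R g"
    "s \<in> exprs K C {xs. set xs \<subseteq> carrier g \<and> length xs = 2}" "t \<in> exprs K C {xs. set xs \<subseteq> carrier g \<and> length xs = 2}"
  then show "expr_eval A f s = expr_eval A f t"
    unfolding exterior_rel_def
    by (auto simp: K numeral_2_eq_2 dest!: cases intro!: add1 add2 sm1 sm2 alt)
qed

lemma (in expr_model) compatible_exterior3:
  fixes g :: "('c, 'd, 'n) module_scheme"
  assumes K: "K = Linear" "C = carrier R"
    and cl: "\<And>x y z. x \<in> carrier g \<Longrightarrow> y \<in> carrier g \<Longrightarrow> z \<in> carrier g \<Longrightarrow> f [x, y, z] \<in> carrier A"
    and add1: "\<And>x x' y z. x \<in> carrier g \<Longrightarrow> x' \<in> carrier g \<Longrightarrow> x \<oplus>\<^bsub>g\<^esub> x' \<in> carrier g \<Longrightarrow> y \<in> carrier g \<Longrightarrow>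
      z \<in> carrier g \<Longrightarrow> f [x \<oplus>\<^bsub>g\<^esub> x', y, z] = f [x, y, z] \<oplus> f [x', y, z]"
    and add2: "\<And>x y y' z. x \<in> carrier g \<Longrightarrow> y \<in> carrier g \<Longrightarrow> y' \<in> carrier g \<Longrightarrow> y \<oplus>\<^bsub>g\<^esub> y' \<in> carrier g \<Longrightarrow>
      z \<in> carrier g \<Longrightarrow> f [x, y \<oplus>\<^bsub>g\<^esub> y', z] = f [x, y, z] \<oplus> f [x, y', z]"
    and add3: "\<And>x y z z'. x \<in> carrier g \<Longrightarrow> y \<in> carrier g \<Longrightarrow> z \<in> carrier g \<Longrightarrow> z' \<in> carrier g \<Longrightarrow>
      z \<oplus>\<^bsub>g\<^esub> z' \<in> carrier g \<Longrightarrow> f [x, y, z \<oplus>\<^bsub>g\<^esub> z'] = f [x, y, z] \<oplus> f [x, y, z']"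
    and sm1: "\<And>c x y z. c \<in> carrier R \<Longrightarrow> x \<in> carrier g \<Longrightarrow> c \<odot>\<^bsub>g\<^esub> x \<in> carrier g \<Longrightarrow> y \<in> carrier g \<Longrightarrow>
      z \<in> carrier g \<Longrightarrow> f [c \<odot>\<^bsub>g\<^esub> x, y, z] = c \<odot>\<^bsub>A\<^esub> f [x, y, z]"
    and sm2: "\<And>c x y z. c \<in> carrier R \<Longrightarrow> x \<in> carrier g \<Longrightarrow> y \<in> carrier g \<Longrightarrow> c \<odot>\<^bsub>g\<^esub> y \<in> carrier g \<Longrightarrow>
      z \<in> carrier g \<Longrightarrow> f [x, c \<odot>\<^bsub>g\<^esub> y, z] = c \<odot>\<^bsub>A\<^esub> f [x, y, z]"
    and sm3: "\<And>c x y z. c \<in> carrier R \<Longrightarrow> x \<in> carrier g \<Longrightarrow> y \<in> carrier g \<Longrightarrow> z \<in> carrier g \<Longrightarrow>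
      c \<odot>\<^bsub>g\<^esub> z \<in> carrier g \<Longrightarrow> f [x, y, c \<odot>\<^bsub>g\<^esub> z] = c \<odot>\<^bsub>A\<^esub> f [x, y, z]"
    and alt: "\<And>x y. x \<in> carrier g \<Longrightarrow> y \<in> carrier g \<Longrightarrow> f [x, x, y] = \<zero>"
      "\<And>x y. x \<in> carrier g \<Longrightarrow> y \<in> carrier g \<Longrightarrow> f [x, y, x] = \<zero>"
      "\<And>x y. x \<in> carrier g \<Longrightarrow> y \<in> carrier g \<Longrightarrow> f [x, y, y] = \<zero>"
  shows "compatible f {xs. set xs \<subseteq> carrier g \<and> length xs = 3} (exterior_rel R g)"
proof (rule compatibleI)
  fix xs assume "xs \<in> {xs. set xs \<subseteq> carrier g \<and> length xs = 3}"
  then show "f xs \<in> carrier A" by (auto simp: numeral_3_eq_3 length_Suc_conv cl)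
next
  have cases: "(us = [] \<and> (\<exists>v w. vs = [v, w])) \<or> (\<exists>u v. us = [u] \<and> vs = [v]) \<or> (\<exists>u v. us = [u, v] \<and> vs = [])"
    if "length us + length vs = Suc (Suc 0)" for us vs :: "'x list"
    using that by (auto simp: add_eq_if length_Suc_conv split: if_splits; cases us; cases vs) (auto simp: length_Suc_conv)
  have cases': "(us = [] \<and> vs = [] \<and> (\<exists>w. ws = [w])) \<or> (us = [] \<and> ws = [] \<and> (\<exists>w. vs = [w])) \<or>
      (vs = [] \<and> ws = [] \<and> (\<exists>w. us = [w]))"
    if "length us + (length vs + length ws) = Suc 0" for us vs ws :: "'x list"
    using that by (cases us; cases vs; cases ws) auto
  fix s t :: "('c, 'd list) expr"
  assume "(s, t) \<in> exterior_rel R g"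
    "s \<in> exprs K C {xs. set xs \<subseteq> carrier g \<and> length xs = 3}" "t \<in> exprs K C {xs. set xs \<subseteq> carrier g \<and> length xs = 3}"
  then show "expr_eval A f s = expr_eval A f t"
    unfolding exterior_rel_def
    by (auto simp: K numeral_3_eq_3 dest!: cases cases' intro!: add1 add2 add3 sm1 sm2 sm3 alt)
qed

text \<open>In a trivial quotient the coset of the cycle x would be the subgroup of boundaries
  itself; since it contains 0 + x, the cycle would be a boundary.\<close>

lemma homology_nontrivial:
  assumes C: "abelian_group (C (Suc n))" and C': "abelian_group (C (Suc (Suc n)))"
    and d: "d (Suc n) \<in> add_hom (C (Suc (Suc n))) (C (Suc n))"
    and x: "x \<in> carrier (C (Suc n))" "d n x = \<zero>\<^bsub>C n\<^esub>"
    and nb: "x \<notin> d (Suc n) ` carrier (C (Suc (Suc n)))"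
  shows "carrier (homology C d (Suc n)) \<noteq> {\<one>\<^bsub>homology C d (Suc n)\<^esub>}"
proof
  interpret C: abelian_group "C (Suc n)" by (rule C)
  interpret C': abelian_group "C (Suc (Suc n))" by (rule C')
  let ?B = "d (Suc n) ` carrier (C (Suc (Suc n)))"
  assume eq: "carrier (homology C d (Suc n)) = {\<one>\<^bsub>homology C d (Suc n)\<^esub>}"
  have "x \<in> cycles C d (Suc n)" using x by (simp add: a_kernel_def kernel_def)
  then have "(\<Union>h\<in>?B. {h \<oplus>\<^bsub>C (Suc n)\<^esub> x}) \<in> carrier (homology C d (Suc n))"
    unfolding homology_def A_FactGroup_def FactGroup_def RCOSETS_def r_coset_def by auto
  then have "(\<Union>h\<in>?B. {h \<oplus>\<^bsub>C (Suc n)\<^esub> x}) = ?B"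
    unfolding eq by (simp add: homology_def A_FactGroup_def FactGroup_def)
  moreover have "\<zero>\<^bsub>C (Suc n)\<^esub> \<in> ?B"
    using imageI[OF C'.zero_closed, of "d (Suc n)"] by (simp add: add_hom_zero[OF d C' C])
  then have "\<zero>\<^bsub>C (Suc n)\<^esub> \<oplus>\<^bsub>C (Suc n)\<^esub> x \<in> (\<Union>h\<in>?B. {h \<oplus>\<^bsub>C (Suc n)\<^esub> x})" by blast
  ultimately show False using nb x(1) by simp
qed

section \<open>A class of degree two\<close>

lemma expr_model_linear:
  assumes "expr_model K C R A"
  shows "expr_model Linear C R A"
proof -
  interpret expr_model K C R A by fact
  show ?thesis
    by unfold_locales (simp_all add: smult_closed smult_l_distr smult_r_distr smult_assoc smult_one)
qed

lemma UNIV_3_eq: "(UNIV :: 3 set) = {0, 1, 2}"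
proof -
  have "x \<in> {0, 1, 2}" for x :: 3
  proof (cases x)
    case (of_int z)
    then have "z = 0 \<or> z = 1 \<or> z = 2" by auto
    with of_int show ?thesis by auto
  qed
  then show ?thesis by blast
qed

lemma three_distinct [simp]: "(0 :: 3) \<noteq> 1" "(0 :: 3) \<noteq> 2" "(1 :: 3) \<noteq> 2" "(1 :: 3) \<noteq> 0" "(2 :: 3) \<noteq> 0" "(2 :: 3) \<noteq> 1"
  by (simp_all add: bit1.Rep_inject_sym bit1.Rep_0 bit1.Rep_1 bit1.Rep_numeral)

text \<open>What the argument uses of the base ring: characteristic two and three elements of square
  zero with non-zero product. The indices 0, 1, 2 of the type \<open>3\<close> replace 1, 2,
  3.\<close>

locale cartier = cring R
  for R :: "('c, 'r) ring_scheme" (structure) +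
  fixes t :: "3 \<Rightarrow> 'c"
  assumes t_closed: "t i \<in> carrier R"
    and t_sq: "t i \<otimes> t i = \<zero>"
    and two: "\<one> \<oplus> \<one> = \<zero>"
    and t_prod: "t 0 \<otimes> (t 1 \<otimes> t 2) \<noteq> \<zero>"
begin

abbreviation "V \<equiv> coord_module R :: ('c, 3 \<Rightarrow> 'c) module"

sublocale V: expr_model Linear "carrier R" R V by (rule coord_module_model)

sublocale Q: quotient_by R V t by unfold_locales (simp add: t_closed)

abbreviation "M \<equiv> quotient_module V (cyclic_submodule R V t)"

sublocale free_lie R M ..

sublocale M: expr_model Linear "carrier R" R M by (rule Q.Q_model)

section \<open>The alternating form on the quotient module\<close>

lemma double: "x \<in> carrier R \<Longrightarrow> x \<oplus> x = \<zero>"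
  using l_distr[of \<one> \<one> x] by (simp add: two)

lemma double': "x \<in> carrier R \<Longrightarrow> y \<in> carrier R \<Longrightarrow> x \<oplus> (x \<oplus> y) = y"
  by (simp add: double flip: a_assoc)

lemma minus_one: "\<ominus> \<one> = \<one>"
  by (rule minus_equality) (simp_all add: two)

lemma model_double:
  assumes "expr_model Linear (carrier R) R A" "x \<in> carrier A"
  shows "x \<oplus>\<^bsub>A\<^esub> x = \<zero>\<^bsub>A\<^esub>"
proof -
  interpret A: expr_model Linear "carrier R" R A by fact
  have "x \<oplus>\<^bsub>A\<^esub> x = (\<one> \<oplus> \<one>) \<odot>\<^bsub>A\<^esub> x" using assms(2) by (simp only: A.smult_l_distr A.smult_one one_closed a_closed)
  then show ?thesis using assms(2) by (simp add: two A.smult_zero)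
qed

text \<open>The determinant of \<open>t\<close>, \<open>v\<close>, \<open>w\<close>; signs do not matter in characteristic two.\<close>

definition det3 :: "(3 \<Rightarrow> 'c) \<Rightarrow> (3 \<Rightarrow> 'c) \<Rightarrow> 'c" where
  "det3 v w = (t 0 \<otimes> (v 1 \<otimes> w 2 \<oplus> v 2 \<otimes> w 1)) \<oplus>
    ((t 1 \<otimes> (v 0 \<otimes> w 2 \<oplus> v 2 \<otimes> w 0)) \<oplus> (t 2 \<otimes> (v 0 \<otimes> w 1 \<oplus> v 1 \<otimes> w 0)))"

lemma det3_closed: "v \<in> carrier V \<Longrightarrow> w \<in> carrier V \<Longrightarrow> det3 v w \<in> carrier R"
  by (simp add: det3_def t_closed)

lemma det3_add_l: "v \<in> carrier V \<Longrightarrow> v' \<in> carrier V \<Longrightarrow> w \<in> carrier V \<Longrightarrow>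
    det3 (v \<oplus>\<^bsub>V\<^esub> v') w = det3 v w \<oplus> det3 v' w"
  by (simp add: det3_def t_closed l_distr r_distr a_ac)

lemma det3_smult_l: "c \<in> carrier R \<Longrightarrow> v \<in> carrier V \<Longrightarrow> w \<in> carrier V \<Longrightarrow>
    det3 (c \<odot>\<^bsub>V\<^esub> v) w = c \<otimes> det3 v w"
  by (simp add: det3_def t_closed r_distr m_ac)

lemma det3_commute: "v \<in> carrier V \<Longrightarrow> w \<in> carrier V \<Longrightarrow> det3 v w = det3 w v"
  by (simp add: det3_def m_comm a_comm)

lemma det3_self: "v \<in> carrier V \<Longrightarrow> det3 v v = \<zero>"
  by (simp add: det3_def t_closed m_comm[of "v 2"] m_comm[of "v 1" "v 0"] double)

text \<open>Two rows of the determinant coincide, so each monomial occurs twice and cancels. This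
  puts \<open>t\<close> into the radical of the form, which therefore descends to
  \<open>M\<close>.\<close>

lemma det3_t: "w \<in> carrier V \<Longrightarrow> det3 t w = \<zero>"
  by (simp add: det3_def t_closed r_distr m_ac a_ac double double')

lemma det3_coset_l:
  assumes "x \<in> Q.coset v" "v \<in> carrier V" "w \<in> carrier V"
  shows "det3 x w = det3 v w"
proof -
  obtain c where c: "c \<in> carrier R" "x = (c \<odot>\<^bsub>V\<^esub> t) \<oplus>\<^bsub>V\<^esub> v"
    using assms(1) by (auto simp: Q.coset_alt simp del: coord_module_simps)
  have "det3 x w = (c \<otimes> det3 t w) \<oplus> det3 v w"
    using c assms(2,3) Q.r_closed
    by (simp add: det3_add_l det3_smult_l V.smult_closed del: coord_module_simps)
  then show ?thesis using c assms(2,3) by (simp add: det3_t det3_closed del: coord_module_simps)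
qed

lemma det3_coset:
  assumes "x \<in> Q.coset v" "y \<in> Q.coset w" "v \<in> carrier V" "w \<in> carrier V"
  shows "det3 x y = det3 v w"
proof -
  have xy: "x \<in> carrier V" "y \<in> carrier V" using assms Q.mem_coset_closed by blast+
  have "det3 x y = det3 v y" by (rule det3_coset_l[OF assms(1,3) xy(2)])
  also have "\<dots> = det3 y v" by (rule det3_commute[OF assms(3) xy(2)])
  also have "\<dots> = det3 w v" by (rule det3_coset_l[OF assms(2,4,3)])
  finally show ?thesis using det3_commute[OF assms(4,3)] by simp
qed

text \<open>Independent of the representatives chosen, by \<open>det3_coset\<close>.\<close>

definition form :: "(3 \<Rightarrow> 'c) set \<Rightarrow> (3 \<Rightarrow> 'c) set \<Rightarrow> 'c" where
  "form X Y = det3 (SOME v. v \<in> X) (SOME w. w \<in> Y)"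

lemma form_coset:
  assumes "v \<in> carrier V" "w \<in> carrier V"
  shows "form (Q.coset v) (Q.coset w) = det3 v w"
proof -
  have "(SOME x. x \<in> Q.coset u) \<in> Q.coset u" if "u \<in> carrier V" for u
    by (rule someI[of "\<lambda>x. x \<in> Q.coset u", OF Q.self_mem_coset[OF that]])
  with assms show ?thesis unfolding form_def by (intro det3_coset)
qed

lemma form_closed: "X \<in> carrier M \<Longrightarrow> Y \<in> carrier M \<Longrightarrow> form X Y \<in> carrier R"
  by (auto dest!: Q.Q_cases simp: form_coset det3_closed simp del: coord_module_simps)

lemma form_commute: "X \<in> carrier M \<Longrightarrow> Y \<in> carrier M \<Longrightarrow> form X Y = form Y X"
  by (auto dest!: Q.Q_cases simp: form_coset det3_commute simp del: coord_module_simps)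

lemma form_self: "X \<in> carrier M \<Longrightarrow> form X X = \<zero>"
  by (auto dest!: Q.Q_cases simp: form_coset det3_self simp del: coord_module_simps)

lemma form_add_l: "X \<in> carrier M \<Longrightarrow> X' \<in> carrier M \<Longrightarrow> Y \<in> carrier M \<Longrightarrow>
    form (X \<oplus>\<^bsub>M\<^esub> X') Y = form X Y \<oplus> form X' Y"
  by (auto dest!: Q.Q_cases simp: form_coset Q.Q_add det3_add_l simp del: coord_module_simps)

lemma form_smult_l: "c \<in> carrier R \<Longrightarrow> X \<in> carrier M \<Longrightarrow> Y \<in> carrier M \<Longrightarrow>
    form (c \<odot>\<^bsub>M\<^esub> X) Y = c \<otimes> form X Y"
  by (auto dest!: Q.Q_cases simp: form_coset Q.Q_smult det3_smult_l V.smult_closed simp del: coord_module_simps)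

lemma form_add_r: "X \<in> carrier M \<Longrightarrow> Y \<in> carrier M \<Longrightarrow> Y' \<in> carrier M \<Longrightarrow>
    form X (Y \<oplus>\<^bsub>M\<^esub> Y') = form X Y \<oplus> form X Y'"
  by (simp add: form_commute[of X] form_add_l)

lemma form_smult_r: "c \<in> carrier R \<Longrightarrow> X \<in> carrier M \<Longrightarrow> Y \<in> carrier M \<Longrightarrow>
    form X (c \<odot>\<^bsub>M\<^esub> Y) = c \<otimes> form X Y"
  by (simp add: form_commute[of X] form_smult_l M.smult_closed)

lemma form_zero_l: "Y \<in> carrier M \<Longrightarrow> form \<zero>\<^bsub>M\<^esub> Y = \<zero>"
  using form_smult_l[of \<zero> "\<zero>\<^bsub>M\<^esub>" Y] by (simp add: M.smult_zero form_closed)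

section \<open>The component of weight one\<close>

abbreviation "SZ \<equiv> square_zero_extension R M"

sublocale SZ: unital_algebra R SZ
  by (rule square_zero_unital_algebra[OF is_cring M.expr_model_axioms])

text \<open>The projection of the tensor algebra to \<open>M\<close>. The presented algebra carries
  no grading, so the projection is obtained from the algebra map that sends a generator m to (0,
  m).\<close>

definition weight_one where "weight_one x = snd (extend_hom SZ (\<lambda>m. (\<zero>, m)) x)"

lemma weight_compatible: "SZ.compatible (\<lambda>m. (\<zero>, m)) (carrier M) T_rel"
  unfolding T_rel_def SZ.compatible_Un
  by (intro conjI SZ.compatible_linear_rel SZ.compatible_assoc_rel) auto

lemmas SZ_ext = SZ.ext_gen[OF weight_compatible, folded \<mu>_eq] SZ.ext_closed[OF weight_compatible, folded TA_eq]
  SZ.ext_add[OF weight_compatible, folded TA_eq] SZ.ext_smult[OF weight_compatible, folded TA_eq]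
  SZ.ext_minus[OF weight_compatible, folded TA_eq] SZ.ext_mult[OF weight_compatible, folded TA_eq]

lemma SZ_snd:
  "snd (x \<oplus>\<^bsub>SZ\<^esub> y) = snd x \<oplus>\<^bsub>M\<^esub> snd y" "snd (c \<odot>\<^bsub>SZ\<^esub> x) = c \<odot>\<^bsub>M\<^esub> snd x"
  by (cases x; cases y; simp)+

lemma weight_gen: "m \<in> carrier M \<Longrightarrow> weight_one (\<mu> m) = m"
  by (simp add: weight_one_def SZ_ext(1))

lemma weight_closed: "x \<in> carrier TA \<Longrightarrow> weight_one x \<in> carrier M"
  using SZ_ext(2)[of x] by (auto simp: weight_one_def)

lemma weight_add: "x \<in> carrier TA \<Longrightarrow> y \<in> carrier TA \<Longrightarrow>
    weight_one (x \<oplus>\<^bsub>TA\<^esub> y) = weight_one x \<oplus>\<^bsub>M\<^esub> weight_one y"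
  by (simp add: weight_one_def SZ_ext(3) SZ_snd)

lemma weight_smult: "c \<in> carrier R \<Longrightarrow> x \<in> carrier TA \<Longrightarrow> weight_one (c \<odot>\<^bsub>TA\<^esub> x) = c \<odot>\<^bsub>M\<^esub> weight_one x"
  by (simp add: weight_one_def SZ_ext(4) SZ_snd)

text \<open>\<open>SZ\<close> is commutative, so both products in a commutator have the same image,
  whatever the constant terms are.\<close>

lemma weight_bracket:
  assumes "x \<in> carrier TA" "y \<in> carrier TA"
  shows "weight_one (x \<otimes>\<^bsub>L\<^esub> y) = \<zero>\<^bsub>M\<^esub>"
proof -
  let ?F = "extend_hom SZ (\<lambda>m. (\<zero>, m))"
  have "?F (x \<otimes>\<^bsub>L\<^esub> y) = ?F x \<otimes>\<^bsub>SZ\<^esub> ?F y \<oplus>\<^bsub>SZ\<^esub> \<ominus>\<^bsub>SZ\<^esub> (?F y \<otimes>\<^bsub>SZ\<^esub> ?F x)"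
    using assms by (simp add: a_minus_def SZ_ext del: square_zero_simps)
  also have "\<dots> = \<zero>\<^bsub>SZ\<^esub>"
    using assms square_zero_commute[OF is_cring M.expr_model_axioms, of "?F x" "?F y"]
    by (simp add: SZ_ext(2) SZ.r_neg del: square_zero_simps)
  finally show ?thesis by (simp add: weight_one_def)
qed

end

section \<open>The differentials out of degrees two and three\<close>

context cartier
begin

declare One_nat_def [simp del] TA.commutator_algebra_simps(5) [simp del]

abbreviation "\<Lambda> n \<equiv> exterior_power R \<gg> n"

lemma \<Lambda>_model: "expr_model Linear (carrier R) R (\<Lambda> n)" by (rule exterior_model)

sublocale \<Lambda>1: expr_model Linear "carrier R" R "\<Lambda> 1" by (rule \<Lambda>_model)
sublocale \<Lambda>2: expr_model Linear "carrier R" R "\<Lambda> 2" by (rule \<Lambda>_model)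

definition w1 where "w1 x = wedge R \<gg> [x]"
definition w2 where "w2 x y = wedge R \<gg> [x, y]"

lemma w1_closed: "x \<in> carrier \<gg> \<Longrightarrow> w1 x \<in> carrier (\<Lambda> 1)"
  unfolding w1_def by (rule wedge_closed) auto

lemma w1_add: "x \<in> carrier \<gg> \<Longrightarrow> y \<in> carrier \<gg> \<Longrightarrow> w1 (x \<oplus>\<^bsub>TA\<^esub> y) = w1 x \<oplus>\<^bsub>\<Lambda> 1\<^esub> w1 y"
  using wedge_add[of "[]" x y \<gg> "[]" 1 R] by (simp add: w1_def \<gg>_add)

lemma w1_smult: "c \<in> carrier R \<Longrightarrow> x \<in> carrier \<gg> \<Longrightarrow> w1 (c \<odot>\<^bsub>TA\<^esub> x) = c \<odot>\<^bsub>\<Lambda> 1\<^esub> w1 x"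
  using wedge_smult[where us = "[]" and vs = "[]" and x = x and c = c and g = \<gg> and n = 1 and R = R] by (simp add: w1_def \<gg>_smult)

lemma w1_zero: "w1 \<zero>\<^bsub>TA\<^esub> = \<zero>\<^bsub>\<Lambda> 1\<^esub>"
  using w1_smult[of \<zero> "\<zero>\<^bsub>TA\<^esub>"] by (simp add: \<gg>_zero TA.smult_zero \<Lambda>1.smult_zero w1_closed)

lemma w2_closed: "x \<in> carrier \<gg> \<Longrightarrow> y \<in> carrier \<gg> \<Longrightarrow> w2 x y \<in> carrier (\<Lambda> 2)"
  unfolding w2_def by (rule wedge_closed) auto

lemma w2_add_l: "x \<in> carrier \<gg> \<Longrightarrow> x' \<in> carrier \<gg> \<Longrightarrow> y \<in> carrier \<gg> \<Longrightarrow>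
    w2 (x \<oplus>\<^bsub>TA\<^esub> x') y = w2 x y \<oplus>\<^bsub>\<Lambda> 2\<^esub> w2 x' y"
  using wedge_add[of "[]" x x' \<gg> "[y]" 2 R] by (simp add: w2_def \<gg>_add)

lemma w2_add_r: "x \<in> carrier \<gg> \<Longrightarrow> y \<in> carrier \<gg> \<Longrightarrow> y' \<in> carrier \<gg> \<Longrightarrow>
    w2 x (y \<oplus>\<^bsub>TA\<^esub> y') = w2 x y \<oplus>\<^bsub>\<Lambda> 2\<^esub> w2 x y'"
  using wedge_add[of "[x]" y y' \<gg> "[]" 2 R] by (simp add: w2_def \<gg>_add)

lemma w2_smult_l: "c \<in> carrier R \<Longrightarrow> x \<in> carrier \<gg> \<Longrightarrow> y \<in> carrier \<gg> \<Longrightarrow>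
    w2 (c \<odot>\<^bsub>TA\<^esub> x) y = c \<odot>\<^bsub>\<Lambda> 2\<^esub> w2 x y"
  using wedge_smult[where us = "[]" and vs = "[y]" and x = x and c = c and g = \<gg> and n = 2 and R = R] by (simp add: w2_def \<gg>_smult)

lemma w2_smult_r: "c \<in> carrier R \<Longrightarrow> x \<in> carrier \<gg> \<Longrightarrow> y \<in> carrier \<gg> \<Longrightarrow>
    w2 x (c \<odot>\<^bsub>TA\<^esub> y) = c \<odot>\<^bsub>\<Lambda> 2\<^esub> w2 x y"
  using wedge_smult[where us = "[x]" and vs = "[]" and x = y and c = c and g = \<gg> and n = 2 and R = R] by (simp add: w2_def \<gg>_smult)

lemma w2_zero_l: "y \<in> carrier \<gg> \<Longrightarrow> w2 \<zero>\<^bsub>TA\<^esub> y = \<zero>\<^bsub>\<Lambda> 2\<^esub>"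
  using w2_smult_l[of \<zero> "\<zero>\<^bsub>TA\<^esub>" y] by (simp add: \<gg>_zero TA.smult_zero \<Lambda>2.smult_zero w2_closed)

lemma TA_minus: "x \<in> carrier TA \<Longrightarrow> \<ominus>\<^bsub>TA\<^esub> x = x"
  using model_double[OF expr_model_linear[OF TA.expr_model_axioms]] by (intro TA.minus_equality)

abbreviation bracket where "bracket x y \<equiv> x \<otimes>\<^bsub>L\<^esub> y"

lemma \<gg>_TA: "x \<in> carrier \<gg> \<Longrightarrow> x \<in> carrier TA"
  using \<gg>_subset by blast

lemma bracket_commute: "x \<in> carrier \<gg> \<Longrightarrow> y \<in> carrier \<gg> \<Longrightarrow> bracket x y = bracket y x"
  by (simp add: TA.commutator_algebra_simps(5) \<gg>_TA a_minus_def TA_minus TA.a_comm)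

lemma bracket_self: "x \<in> carrier \<gg> \<Longrightarrow> bracket x x = \<zero>\<^bsub>TA\<^esub>"
  by (simp add: TA.commutator_algebra_simps(5) \<gg>_TA a_minus_def TA.r_neg)

lemma bracket_add_l: "x \<in> carrier \<gg> \<Longrightarrow> x' \<in> carrier \<gg> \<Longrightarrow> y \<in> carrier \<gg> \<Longrightarrow>
    bracket (x \<oplus>\<^bsub>TA\<^esub> x') y = bracket x y \<oplus>\<^bsub>TA\<^esub> bracket x' y"
  using L.mult_l_distr[of x x' y] by (simp add: \<gg>_TA)

lemma bracket_add_r: "x \<in> carrier \<gg> \<Longrightarrow> y \<in> carrier \<gg> \<Longrightarrow> y' \<in> carrier \<gg> \<Longrightarrow>
    bracket x (y \<oplus>\<^bsub>TA\<^esub> y') = bracket x y \<oplus>\<^bsub>TA\<^esub> bracket x y'"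
  using L.mult_r_distr[of y y' x] by (simp add: \<gg>_TA)

lemma bracket_smult_l: "c \<in> carrier R \<Longrightarrow> x \<in> carrier \<gg> \<Longrightarrow> y \<in> carrier \<gg> \<Longrightarrow>
    bracket (c \<odot>\<^bsub>TA\<^esub> x) y = c \<odot>\<^bsub>TA\<^esub> bracket x y"
  using L.smult_mult_l[of c x y] by (simp add: \<gg>_TA)

lemma bracket_smult_r: "c \<in> carrier R \<Longrightarrow> x \<in> carrier \<gg> \<Longrightarrow> y \<in> carrier \<gg> \<Longrightarrow>
    bracket x (c \<odot>\<^bsub>TA\<^esub> y) = c \<odot>\<^bsub>TA\<^esub> bracket x y"
  using L.smult_mult_r[of c x y] by (simp add: \<gg>_TA)

definition CE_gen where
  "CE_gen n xs = finsum (\<Lambda> n)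
       (\<lambda>(i, j). ((\<ominus> \<one>) [^] (i + j)) \<odot>\<^bsub>\<Lambda> n\<^esub>
          wedge R \<gg> ((xs ! i \<otimes>\<^bsub>\<gg>\<^esub> xs ! j) # nths xs (- {i, j})))
       {(i, j). i < j \<and> j < length xs}"

lemma CE_differential_alt: "CE_differential R \<gg> n = extend_hom (\<Lambda> n) (CE_gen n)"
  by (simp add: CE_differential_def CE_gen_def[abs_def])

text \<open>The signs (-1)^(i+j) are all one in characteristic two, here and in
  \<open>CE_gen_3\<close>.\<close>

lemma CE_gen_2:
  assumes "x \<in> carrier \<gg>" "y \<in> carrier \<gg>"
  shows "CE_gen 1 [x, y] = w1 (bracket x y)"
proof -
  have "{(i, j). i < j \<and> j < length [x, y]} = {(0, Suc 0)}" by auto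
  moreover have "bracket x y \<in> carrier \<gg>" by (rule \<gg>_bracket[OF assms])
  ultimately show ?thesis
    using w1_closed[of "bracket x y"]
    by (simp add: CE_gen_def nths_Cons minus_one \<Lambda>1.smult_one flip: w1_def)
qed

lemma CE_gen_3:
  assumes "x \<in> carrier \<gg>" "y \<in> carrier \<gg>" "z \<in> carrier \<gg>"
  shows "CE_gen 2 [x, y, z] =
    w2 (bracket x y) z \<oplus>\<^bsub>\<Lambda> 2\<^esub> (w2 (bracket x z) y \<oplus>\<^bsub>\<Lambda> 2\<^esub> w2 (bracket y z) x)"
proof -
  have "{(i, j). i < j \<and> j < length [x, y, z]} = {(0, Suc 0), (0, 2), (Suc 0, 2)}"
    by (auto simp: less_Suc_eq numeral_2_eq_2)
  moreover have "w2 (bracket x y) z \<in> carrier (\<Lambda> 2)" "w2 (bracket x z) y \<in> carrier (\<Lambda> 2)"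
    "w2 (bracket y z) x \<in> carrier (\<Lambda> 2)"
    by (intro w2_closed \<gg>_bracket assms)+
  ultimately show ?thesis
    by (simp add: CE_gen_def nths_Cons minus_one \<Lambda>2.smult_one flip: w2_def)
qed

lemma CE_compatible_2: "\<Lambda>1.compatible (CE_gen 1) {xs. set xs \<subseteq> carrier \<gg> \<and> length xs = 2} (exterior_rel R \<gg>)"
  by (rule \<Lambda>1.compatible_exterior2)
    (simp_all add: CE_gen_2 bracket_add_l bracket_add_r bracket_smult_l bracket_smult_r bracket_self
      w1_add w1_smult w1_zero w1_closed \<gg>_bracket \<gg>_add \<gg>_smult)

lemma CE_compatible_3: "\<Lambda>2.compatible (CE_gen 2) {xs. set xs \<subseteq> carrier \<gg> \<and> length xs = 3} (exterior_rel R \<gg>)"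
proof (rule \<Lambda>2.compatible_exterior3)
  note d = model_double[OF \<Lambda>_model]
  \<comment> \<open>One of the three brackets is zero. The two remaining terms agree, as the bracket
    is symmetric in characteristic two, and their sum is a double.\<close>
  show "CE_gen 2 [x, x, y] = \<zero>\<^bsub>\<Lambda> 2\<^esub>" "CE_gen 2 [x, y, x] = \<zero>\<^bsub>\<Lambda> 2\<^esub>" "CE_gen 2 [x, y, y] = \<zero>\<^bsub>\<Lambda> 2\<^esub>"
    if "x \<in> carrier \<gg>" "y \<in> carrier \<gg>" for x y
    using that bracket_commute[of x y]
    by (simp_all add: CE_gen_3 bracket_self w2_zero_l w2_closed \<gg>_bracket d)
qed (simp_all add: CE_gen_3 bracket_add_l bracket_add_r bracket_smult_l bracket_smult_r
      w2_add_l w2_add_r w2_smult_l w2_smult_r w2_closed \<gg>_bracket \<gg>_add \<gg>_smult \<Lambda>2.smult_r_distr \<Lambda>2.smult_closed \<Lambda>2.a_ac)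

lemma \<Lambda>_eq: "\<Lambda> n = presented R (exprs Linear (carrier R) {xs. set xs \<subseteq> carrier \<gg> \<and> length xs = n}) (exterior_rel R \<gg>)"
  by (simp add: exterior_power_def exterior_exprs_def)

lemma w2_eq: "w2 x y = expr_class R (exprs Linear (carrier R) {xs. set xs \<subseteq> carrier \<gg> \<and> length xs = 2}) (exterior_rel R \<gg>) (Gen [x, y])"
  by (simp add: w2_def wedge_alt exterior_exprs_def numeral_2_eq_2)

text \<open>Named by the degree of the source, whereas the number in \<open>CE_differential\<close>
  is the degree of the target.\<close>

abbreviation "bd2 \<equiv> CE_differential R \<gg> 1"
abbreviation "bd3 \<equiv> CE_differential R \<gg> 2"

lemma bd2_add: "a \<in> carrier (\<Lambda> 2) \<Longrightarrow> b \<in> carrier (\<Lambda> 2) \<Longrightarrow> bd2 (a \<oplus>\<^bsub>\<Lambda> 2\<^esub> b) = bd2 a \<oplus>\<^bsub>\<Lambda> 1\<^esub> bd2 b"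
  and bd2_smult: "c \<in> carrier R \<Longrightarrow> a \<in> carrier (\<Lambda> 2) \<Longrightarrow> bd2 (c \<odot>\<^bsub>\<Lambda> 2\<^esub> a) = c \<odot>\<^bsub>\<Lambda> 1\<^esub> bd2 a"
  and bd2_w2: "x \<in> carrier \<gg> \<Longrightarrow> y \<in> carrier \<gg> \<Longrightarrow> bd2 (w2 x y) = w1 (bracket x y)"
  using \<Lambda>1.ext_add[OF CE_compatible_2, folded \<Lambda>_eq] \<Lambda>1.ext_smult[OF CE_compatible_2, folded \<Lambda>_eq]
    \<Lambda>1.ext_gen[OF CE_compatible_2, of "[x, y]", folded w2_eq] CE_gen_2[of x y]
  unfolding CE_differential_alt by simp_all

lemma bd3_hom: "bd3 \<in> add_hom (\<Lambda> 3) (\<Lambda> 2)"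
  using \<Lambda>2.ext_add[OF CE_compatible_3, folded \<Lambda>_eq] \<Lambda>2.ext_closed[OF CE_compatible_3, folded \<Lambda>_eq]
  unfolding CE_differential_alt by (intro add_homI)

section \<open>A functional that vanishes on boundaries\<close>

sublocale Reg_linear: expr_model Linear "carrier R" R "regular_algebra R"
  by (rule expr_model_linear[OF Reg.expr_model_axioms])

definition functional where
  "functional = extend_hom (regular_algebra R) (\<lambda>xs. form (weight_one (xs ! 0)) (weight_one (xs ! Suc 0)))"

lemma functional_compatible: "Reg_linear.compatible (\<lambda>xs. form (weight_one (xs ! 0)) (weight_one (xs ! Suc 0)))
    {xs. set xs \<subseteq> carrier \<gg> \<and> length xs = 2} (exterior_rel R \<gg>)"
  by (rule Reg_linear.compatible_exterior2)
    (simp_all add: weight_closed weight_add weight_smult \<gg>_TA form_closed form_self form_add_l form_add_r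
      form_smult_l form_smult_r)

lemma functional_add: "a \<in> carrier (\<Lambda> 2) \<Longrightarrow> b \<in> carrier (\<Lambda> 2) \<Longrightarrow>
    functional (a \<oplus>\<^bsub>\<Lambda> 2\<^esub> b) = functional a \<oplus> functional b"
  and functional_smult: "c \<in> carrier R \<Longrightarrow> a \<in> carrier (\<Lambda> 2) \<Longrightarrow> functional (c \<odot>\<^bsub>\<Lambda> 2\<^esub> a) = c \<otimes> functional a"
  and functional_zero: "functional \<zero>\<^bsub>\<Lambda> 2\<^esub> = \<zero>"
  and functional_minus: "a \<in> carrier (\<Lambda> 2) \<Longrightarrow> functional (\<ominus>\<^bsub>\<Lambda> 2\<^esub> a) = \<ominus> functional a"
  and functional_w2: "x \<in> carrier \<gg> \<Longrightarrow> y \<in> carrier \<gg> \<Longrightarrow> functional (w2 x y) = form (weight_one x) (weight_one y)"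
  using Reg_linear.ext_add[OF functional_compatible, folded \<Lambda>_eq] Reg_linear.ext_smult[OF functional_compatible, folded \<Lambda>_eq]
    Reg_linear.ext_zero[OF functional_compatible, folded \<Lambda>_eq] Reg_linear.ext_minus[OF functional_compatible, folded \<Lambda>_eq]
    Reg_linear.ext_gen[OF functional_compatible, of "[x, y]", folded w2_eq]
  unfolding functional_def by simp_all

lemma functional_boundary:
  assumes "z \<in> carrier (\<Lambda> 3)"
  shows "functional (bd3 z) = \<zero>"
proof -
  let ?T = "exprs Linear (carrier R) {xs. set xs \<subseteq> carrier \<gg> \<and> length xs = 3}"
  obtain e where e: "e \<in> ?T" "z = expr_class R ?T (exterior_rel R \<gg>) e"
    using assms unfolding \<Lambda>_eq carrier_presented by blast
  have cl: "expr_eval (\<Lambda> 2) (CE_gen 2) e \<in> carrier (\<Lambda> 2)" if "e \<in> ?T" for e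
    using \<Lambda>2.eval_closed[OF that, of "CE_gen 2"] CE_compatible_3 by (simp add: \<Lambda>2.compatible_def)
  have "functional (expr_eval (\<Lambda> 2) (CE_gen 2) e) = \<zero>" using e(1)
  proof (induction rule: exprs.induct)
    case (1 xs)
    then obtain x y z where "xs = [x, y, z]" "x \<in> carrier \<gg>" "y \<in> carrier \<gg>" "z \<in> carrier \<gg>"
      by (auto simp: numeral_3_eq_3 length_Suc_conv)
    then show ?case
      by (simp add: CE_gen_3 functional_add functional_w2 w2_closed \<gg>_bracket weight_bracket \<gg>_TA weight_closed
          form_zero_l)
  qed (simp_all add: cl functional_add functional_zero functional_smult functional_minus)
  then show ?thesis using e \<Lambda>2.compatible_eval[OF CE_compatible_3 e(1)] by (simp add: CE_differential_alt)
qed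

section \<open>The cycle\<close>

definition \<xi> where "\<xi> i = \<mu> (Q.coset (unit_vector R i))"

lemma unit_vector_closed: "unit_vector R i \<in> carrier V"
  by (simp add: unit_vector_def)

lemma \<xi>_closed: "\<xi> i \<in> carrier \<gg>"
  unfolding \<xi>_def by (intro \<gg>_gen Q.coset_mem_Q unit_vector_closed)

lemma weight_\<xi>: "weight_one (\<xi> i) = Q.coset (unit_vector R i)"
  unfolding \<xi>_def by (intro weight_gen Q.coset_mem_Q unit_vector_closed)

lemma \<mu>_zero: "\<mu> \<zero>\<^bsub>M\<^esub> = \<zero>\<^bsub>TA\<^esub>"
  using \<mu>_smult[of \<zero> "\<zero>\<^bsub>M\<^esub>"] by (simp add: M.smult_zero TA.smult_zero \<mu>_closed)

lemma relation: "(t 0 \<odot>\<^bsub>TA\<^esub> \<xi> 0) \<oplus>\<^bsub>TA\<^esub> ((t 1 \<odot>\<^bsub>TA\<^esub> \<xi> 1) \<oplus>\<^bsub>TA\<^esub> (t 2 \<odot>\<^bsub>TA\<^esub> \<xi> 2)) = \<zero>\<^bsub>TA\<^esub>"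
proof -
  let ?e = "\<lambda>i. t i \<odot>\<^bsub>V\<^esub> unit_vector R i"
  have ec: "?e i \<in> carrier V" for i by (intro V.smult_closed t_closed unit_vector_closed)
  have tx: "t i \<odot>\<^bsub>TA\<^esub> \<xi> i = \<mu> (Q.coset (?e i))" for i
    unfolding \<xi>_def
    using \<mu>_smult[OF t_closed Q.coset_mem_Q[OF unit_vector_closed], of i i]
    by (simp add: Q.Q_smult[OF t_closed unit_vector_closed] Q.coset_mem_Q[OF ec] del: coord_module_simps)
  have "?e 0 \<oplus>\<^bsub>V\<^esub> (?e 1 \<oplus>\<^bsub>V\<^esub> ?e 2) = t"
  proof
    fix i :: 3
    have "i \<in> {0, 1, 2}" using UNIV_3_eq by blast
    then show "(?e 0 \<oplus>\<^bsub>V\<^esub> (?e 1 \<oplus>\<^bsub>V\<^esub> ?e 2)) i = t i"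
      by (auto simp: unit_vector_def t_closed)
  qed
  moreover have "Q.coset t = Q.coset \<zero>\<^bsub>V\<^esub>"
    using Q.coset_shift[of \<one> "\<zero>\<^bsub>V\<^esub>"] Q.r_closed
    by (simp add: V.smult_one del: coord_module_simps)
  ultimately have "Q.coset (?e 0 \<oplus>\<^bsub>V\<^esub> (?e 1 \<oplus>\<^bsub>V\<^esub> ?e 2)) = \<zero>\<^bsub>M\<^esub>" by (simp add: Q.Q_zero)
  then have "\<mu> (Q.coset (?e 0) \<oplus>\<^bsub>M\<^esub> (Q.coset (?e 1) \<oplus>\<^bsub>M\<^esub> Q.coset (?e 2))) = \<zero>\<^bsub>TA\<^esub>"
    by (simp add: Q.Q_add ec \<mu>_zero del: coord_module_simps)
  then show ?thesis
    unfolding tx using Q.coset_mem_Q[OF ec] by (simp add: \<mu>_add del: coord_module_simps)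
qed

text \<open>One half of the formal square of the relation in the exterior square. The diagonal terms
  vanish there and the two orders of a pair cancel, so the full square is zero; keeping only i < j
  leaves something that the form can detect.\<close>

definition \<omega> where
  "\<omega> = (t 0 \<otimes> t 1) \<odot>\<^bsub>\<Lambda> 2\<^esub> w2 (\<xi> 0) (\<xi> 1) \<oplus>\<^bsub>\<Lambda> 2\<^esub>
    ((t 0 \<otimes> t 2) \<odot>\<^bsub>\<Lambda> 2\<^esub> w2 (\<xi> 0) (\<xi> 2) \<oplus>\<^bsub>\<Lambda> 2\<^esub> (t 1 \<otimes> t 2) \<odot>\<^bsub>\<Lambda> 2\<^esub> w2 (\<xi> 1) (\<xi> 2))"

lemma \<omega>_closed: "\<omega> \<in> carrier (\<Lambda> 2)"
  by (simp add: \<omega>_def \<Lambda>2.smult_closed w2_closed \<xi>_closed t_closed)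

text \<open>The bracket image of \<open>\<omega>\<close> is the square of \<open>t\<^sub>0\<xi>\<^sub>0 + t\<^sub>1\<xi>\<^sub>1 + t\<^sub>2\<xi>\<^sub>2 = 0\<close>, because \<open>t\<^sub>i\<^sup>2 = 0\<close>.\<close>

lemma bracket_\<omega>: "(t 0 \<otimes> t 1) \<odot>\<^bsub>TA\<^esub> bracket (\<xi> 0) (\<xi> 1) \<oplus>\<^bsub>TA\<^esub>
    ((t 0 \<otimes> t 2) \<odot>\<^bsub>TA\<^esub> bracket (\<xi> 0) (\<xi> 2) \<oplus>\<^bsub>TA\<^esub> (t 1 \<otimes> t 2) \<odot>\<^bsub>TA\<^esub> bracket (\<xi> 1) (\<xi> 2)) = \<zero>\<^bsub>TA\<^esub>"
proof -
  define a where "a i = t i \<odot>\<^bsub>TA\<^esub> \<xi> i" for i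
  have ac: "a i \<in> carrier TA" for i by (simp add: a_def TA.smult_closed t_closed \<gg>_TA \<xi>_closed)
  have sq: "a i \<otimes>\<^bsub>TA\<^esub> a i = \<zero>\<^bsub>TA\<^esub>" for i
  proof -
    have "a i \<otimes>\<^bsub>TA\<^esub> a i = (t i \<otimes> t i) \<odot>\<^bsub>TA\<^esub> (\<xi> i \<otimes>\<^bsub>TA\<^esub> \<xi> i)"
      by (simp add: a_def TA.smult_mult_l TA.smult_mult_r TA.smult_assoc TA.smult_closed t_closed \<gg>_TA \<xi>_closed)
    then show ?thesis by (simp add: t_sq TA.smult_zero \<gg>_TA \<xi>_closed)
  qed
  have br: "(t i \<otimes> t j) \<odot>\<^bsub>TA\<^esub> bracket (\<xi> i) (\<xi> j) = a i \<otimes>\<^bsub>TA\<^esub> a j \<oplus>\<^bsub>TA\<^esub> a j \<otimes>\<^bsub>TA\<^esub> a i" for i j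
  proof -
    have "t i \<odot>\<^bsub>TA\<^esub> (t j \<odot>\<^bsub>TA\<^esub> b) = t j \<odot>\<^bsub>TA\<^esub> (t i \<odot>\<^bsub>TA\<^esub> b)" if "b \<in> carrier TA" for b
      using that by (simp add: m_comm t_closed flip: TA.smult_assoc)
    then have "(t i \<otimes> t j) \<odot>\<^bsub>TA\<^esub> bracket (\<xi> i) (\<xi> j) = bracket (a i) (a j)"
      by (simp add: a_def bracket_smult_l bracket_smult_r TA.smult_assoc t_closed \<xi>_closed \<gg>_smult \<gg>_TA \<gg>_bracket)
    then show ?thesis using ac by (simp add: TA.commutator_algebra_simps(5) a_minus_def TA_minus)
  qed
  have "(a 0 \<oplus>\<^bsub>TA\<^esub> (a 1 \<oplus>\<^bsub>TA\<^esub> a 2)) \<otimes>\<^bsub>TA\<^esub> (a 0 \<oplus>\<^bsub>TA\<^esub> (a 1 \<oplus>\<^bsub>TA\<^esub> a 2)) = \<zero>\<^bsub>TA\<^esub>"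
    using relation by (simp flip: a_def)
  then have "a 0 \<otimes>\<^bsub>TA\<^esub> a 1 \<oplus>\<^bsub>TA\<^esub> (a 1 \<otimes>\<^bsub>TA\<^esub> a 0 \<oplus>\<^bsub>TA\<^esub> (a 0 \<otimes>\<^bsub>TA\<^esub> a 2 \<oplus>\<^bsub>TA\<^esub> (a 2 \<otimes>\<^bsub>TA\<^esub> a 0 \<oplus>\<^bsub>TA\<^esub>
      (a 1 \<otimes>\<^bsub>TA\<^esub> a 2 \<oplus>\<^bsub>TA\<^esub> a 2 \<otimes>\<^bsub>TA\<^esub> a 1)))) = \<zero>\<^bsub>TA\<^esub>"
    by (simp add: TA.l_distr TA.r_distr sq ac TA.a_ac)
  then show ?thesis unfolding br using ac by (simp add: TA.a_assoc)
qed

lemma bd2_\<omega>: "bd2 \<omega> = \<zero>\<^bsub>\<Lambda> 1\<^esub>"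
proof -
  have "bd2 \<omega> = w1 ((t 0 \<otimes> t 1) \<odot>\<^bsub>TA\<^esub> bracket (\<xi> 0) (\<xi> 1) \<oplus>\<^bsub>TA\<^esub>
    ((t 0 \<otimes> t 2) \<odot>\<^bsub>TA\<^esub> bracket (\<xi> 0) (\<xi> 2) \<oplus>\<^bsub>TA\<^esub> (t 1 \<otimes> t 2) \<odot>\<^bsub>TA\<^esub> bracket (\<xi> 1) (\<xi> 2)))"
    by (simp add: \<omega>_def bd2_add bd2_smult bd2_w2 w1_add w1_smult \<Lambda>2.smult_closed w2_closed \<xi>_closed t_closed
        \<gg>_bracket \<gg>_smult \<gg>_add)
  then show ?thesis by (simp only: bracket_\<omega> w1_zero)
qed

lemma functional_\<omega>: "functional \<omega> \<noteq> \<zero>"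
proof -
  have f: "functional (w2 (\<xi> i) (\<xi> j)) = det3 (unit_vector R i) (unit_vector R j)" for i j
    by (simp add: functional_w2 \<xi>_closed weight_\<xi> form_coset unit_vector_closed del: coord_module_simps)
  have "det3 (unit_vector R 0) (unit_vector R 1) = t 2" "det3 (unit_vector R 0) (unit_vector R 2) = t 1"
    "det3 (unit_vector R 1) (unit_vector R 2) = t 0"
    by (simp_all add: det3_def unit_vector_def t_closed)
  then have "functional \<omega> = (t 0 \<otimes> t 1) \<otimes> t 2 \<oplus> ((t 0 \<otimes> t 2) \<otimes> t 1 \<oplus> (t 1 \<otimes> t 2) \<otimes> t 0)"
    by (simp add: \<omega>_def functional_add functional_smult f \<Lambda>2.smult_closed w2_closed \<xi>_closed t_closed)
  also have "\<dots> = t 0 \<otimes> (t 1 \<otimes> t 2)"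
    by (simp add: t_closed m_ac double)
  finally show ?thesis using t_prod by simp
qed

theorem CE_homology_nontrivial: "carrier (CE_homology R \<gg> 2) \<noteq> {\<one>\<^bsub>CE_homology R \<gg> 2\<^esub>}"
proof -
  have "\<omega> \<notin> bd3 ` carrier (\<Lambda> 3)" using functional_boundary functional_\<omega> by auto
  \<comment> \<open>\<open>Suc 1\<close> is degree two: the cycles are taken for differential number
    one, the boundaries for number two.\<close>
  then have "carrier (homology \<Lambda> (CE_differential R \<gg>) (Suc 1)) \<noteq> {\<one>\<^bsub>homology \<Lambda> (CE_differential R \<gg>) (Suc 1)\<^esub>}"
    using expr_model.axioms(1)[OF \<Lambda>_model] bd3_hom \<omega>_closed bd2_\<omega>
    by (intro homology_nontrivial[where x = \<omega>]) (simp_all add: numeral_2_eq_2 numeral_3_eq_3)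
  then show ?thesis by (simp add: CE_homology_def numeral_2_eq_2)
qed

end

section \<open>The base ring\<close>

lemma poly3_simps [simp]:
  "carrier poly3_ring = UNIV" "p \<otimes>\<^bsub>poly3_ring\<^esub> q = p * q" "p \<oplus>\<^bsub>poly3_ring\<^esub> q = p + q"
  "\<one>\<^bsub>poly3_ring\<^esub> = 1" "\<zero>\<^bsub>poly3_ring\<^esub> = 0"
  by (simp_all add: poly3_ring_def)

lemma poly3_cring: "cring poly3_ring"
proof (rule cringI)
  show "abelian_group poly3_ring"
  proof (rule abelian_groupI)
    fix x :: poly3
    show "\<exists>y\<in>carrier poly3_ring. y \<oplus>\<^bsub>poly3_ring\<^esub> x = \<zero>\<^bsub>poly3_ring\<^esub>"
      by (intro bexI[of _ "- x"]) simp_all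
  qed (simp_all add: ac_simps)
  show "Group.comm_monoid poly3_ring"
    by (rule comm_monoidI) (simp_all add: ac_simps)
qed (simp add: distrib_right)

lemma squares_ideal: "ideal squares_ideal poly3_ring"
proof -
  interpret cring poly3_ring by (rule poly3_cring)
  show ?thesis unfolding squares_ideal_def by (rule genideal_ideal) simp
qed

lemma poly3_double: "p + p = (0 :: poly3)"
proof (rule poly_mapping_eqI)
  fix m
  show "Poly_Mapping.lookup (p + p) m = Poly_Mapping.lookup 0 m"
    unfolding lookup_add by (cases "Poly_Mapping.lookup p m") simp_all
qed

definition square_free :: "(3 \<Rightarrow>\<^sub>0 nat) \<Rightarrow> bool" where
  "square_free m \<longleftrightarrow> (\<forall>i. Poly_Mapping.lookup m i \<le> 1)"

text \<open>The polynomials without square-free monomials form an ideal, because a factor of a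
  square-free monomial is square-free. This ideal contains the squares of the variables and hence
  all that they generate.\<close>

lemma squares_ideal_lookup:
  assumes "p \<in> squares_ideal" "square_free m"
  shows "Poly_Mapping.lookup p m = 0"
proof -
  interpret cring poly3_ring by (rule poly3_cring)
  let ?J = "{p :: poly3. \<forall>m. square_free m \<longrightarrow> Poly_Mapping.lookup p m = 0}"
  have mult: "q * p \<in> ?J" if p: "p \<in> ?J" for p q
  proof -
    have "Poly_Mapping.lookup (q * p) m = 0" if m: "square_free m" for m
    proof -
      \<comment> \<open>A coefficient of the product is a sum over the decompositions m = l + r, and
        each r occurring there is square-free along with m.\<close>
      have "(Poly_Mapping.lookup p r when m = l + r) = 0" for l r
      proof (cases "m = l + r")
        case True
        then have "square_free r" using m by (auto simp: square_free_def lookup_add intro: le_trans[OF le_add2])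
        then show ?thesis using p by simp
      qed simp
      then show ?thesis by (simp add: times_poly_mapping.rep_eq prod_fun_def)
    qed
    then show ?thesis by simp
  qed
  have "ideal ?J poly3_ring"
  proof (rule idealI[OF ring_axioms])
    show "subgroup ?J (add_monoid poly3_ring)"
    proof (rule group.subgroupI[OF a_group])
      fix a :: poly3 assume a: "a \<in> ?J"
      have "\<ominus>\<^bsub>poly3_ring\<^esub> a = a" by (rule minus_equality) (simp_all add: poly3_double)
      then show "inv\<^bsub>add_monoid poly3_ring\<^esub> a \<in> ?J" using a by (simp add: a_inv_def)
    qed (auto simp: lookup_add intro: exI[of _ 0])
  qed (use mult in \<open>simp_all add: mult.commute\<close>)
  moreover have "{var i ^ 2 | i. True} \<subseteq> ?J"
  proof
    fix p assume "p \<in> {var i ^ 2 | i. True}"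
    then obtain i where p: "p = var i ^ 2" by blast
    have "p = Poly_Mapping.single (Poly_Mapping.single i 2) 1"
      by (simp add: p var_def power2_eq_square mult_single numeral_2_eq_2 flip: single_add)
    then show "p \<in> ?J" by (auto simp: lookup_single when_def square_free_def)
  qed
  ultimately have "squares_ideal \<subseteq> ?J" unfolding squares_ideal_def by (rule genideal_minimal)
  then show ?thesis using assms by blast
qed

lemma var_prod_not_in_ideal: "var 0 * (var 1 * var 2) \<notin> squares_ideal"
proof
  let ?m = "Poly_Mapping.single 0 1 + (Poly_Mapping.single 1 1 + Poly_Mapping.single 2 1) :: 3 \<Rightarrow>\<^sub>0 nat"
  assume "var 0 * (var 1 * var 2) \<in> squares_ideal"
  moreover have "square_free ?m"
    by (auto simp: square_free_def lookup_add lookup_single when_def)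
  ultimately have "Poly_Mapping.lookup (var 0 * (var 1 * var 2)) ?m = 0" by (rule squares_ideal_lookup)
  then show False by (simp add: var_def mult_single)
qed

lemma kk_cartier: "cartier kk tt"
proof -
  interpret P: cring poly3_ring by (rule poly3_cring)
  interpret I: ideal squares_ideal poly3_ring by (rule squares_ideal)
  interpret kk: cring kk unfolding kk_def by (rule I.quotient_is_cring[OF poly3_cring])
  define q where "q p = squares_ideal +>\<^bsub>poly3_ring\<^esub> p" for p
  have q_hom: "q \<in> ring_hom poly3_ring kk"
    unfolding kk_def q_def[abs_def] by (rule I.rcos_ring_hom)
  have q_zero: "q p = \<zero>\<^bsub>kk\<^esub> \<longleftrightarrow> p \<in> squares_ideal" for p
    unfolding q_def kk_def using I.rcos_const_imp_mem[of p] I.a_rcos_const[of p]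
    by (auto simp: FactRing_def)
  have q_mult: "q a \<otimes>\<^bsub>kk\<^esub> q b = q (a * b)" and q_add: "q a \<oplus>\<^bsub>kk\<^esub> q b = q (a + b)" and q_one: "\<one>\<^bsub>kk\<^esub> = q 1" for a b
    using ring_hom_mult[OF q_hom, of a b] ring_hom_add[OF q_hom, of a b] ring_hom_one[OF q_hom] by simp_all
  have tt: "tt i = q (var i)" for i by (simp add: tt_def q_def)
  show ?thesis
  proof unfold_locales
    show "tt i \<in> carrier kk" for i using ring_hom_closed[OF q_hom, of "var i"] by (simp add: tt)
    have "var i ^ 2 \<in> squares_ideal" for i
      unfolding squares_ideal_def by (rule subsetD[OF P.genideal_self]) auto
    then show "tt i \<otimes>\<^bsub>kk\<^esub> tt i = \<zero>\<^bsub>kk\<^esub>" for i by (simp add: tt q_mult q_zero power2_eq_square)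
    have "0 \<in> squares_ideal" using I.zero_closed by simp
    then show "\<one>\<^bsub>kk\<^esub> \<oplus>\<^bsub>kk\<^esub> \<one>\<^bsub>kk\<^esub> = \<zero>\<^bsub>kk\<^esub>" by (simp only: q_one q_add q_zero poly3_double)
    show "tt 0 \<otimes>\<^bsub>kk\<^esub> (tt 1 \<otimes>\<^bsub>kk\<^esub> tt 2) \<noteq> \<zero>\<^bsub>kk\<^esub>"
      by (simp add: tt q_mult q_zero var_prod_not_in_ideal)
  qed
qed

lemma MM_eq: "MM = quotient_module (coord_module kk) (cyclic_submodule kk (coord_module kk) tt)"
proof -
  interpret cartier kk tt by (rule kk_cartier)
  show ?thesis unfolding MM_def kk3_def by (simp only: sum_unit_vectors[OF t_closed])
qed

theorem proposition8p6:
  shows "carrier (CE_homology kk gg 2) \<noteq> {\<one>\<^bsub>CE_homology kk gg 2\<^esub>} \<and>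
         (\<exists>(P :: nat \<Rightarrow> (Ugg_elem, Ugg_elem) module) d e.
            RT_resolution TYPE(Ugg_elem) kk gg P d e) \<and>
         (\<forall>(P :: nat \<Rightarrow> (Ugg_elem, 'p) module) d e.
            RT_resolution TYPE('a) kk gg P d e \<longrightarrow>
            carrier (RT_homology kk gg P d 2) = {\<one>\<^bsub>RT_homology kk gg P d 2\<^esub>})"
proof -
  interpret cartier kk tt by (rule kk_cartier)
  show ?thesis
    unfolding gg_def MM_eq
    using CE_homology_nontrivial RT_resolution_exists RT_homology_trivial by blast
qed

end
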